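(* For every $(x,t)\in\mathbb{R}^2$ the functional $\rho\mapsto\mathcal E[\rho](x,t)$ attains a minimum on $\mathcal A$; denote $E^{\min}_\infty(x,t):=\min_{\rho\in\mathcal A}\mathcal E[\rho](x,t)$. Moreover $$\lim_{N\to\infty}E^{\min}_N(x,t)=E^{\min}_\infty(x,t)$$ uniformly on compact subsets of $(x,t)\in\mathbb{R}^2$.
   Context: Fix $\delta>0$ and an admissible $u_0$ ($C^1$, positive, $\to0$ at $\pm\infty$, $\int(x^2+1)u_0<\infty$, $u_0'$ vanishing only at $x_{\max}$ where the maximum $u_{\max}$ is attained) with $\int\sqrt{u_0}<\infty$. Lambert $W$: standard branches $W_n$ of the inverse of $w\mapsto we^w$; for real $a\in[-e^{-1},0)$, $W_0(a)\in[-1,0)$, $W_{-1}(a)\le-1$; for real $a<-e^{-1}$, $W_0(a)$ is the solution with $0<\operatorname{Im}w<\pi$, $W_{-1}(a):=\overline{W_0(a)}$. $\zeta(\kappa):=\kappa\cot(2\delta\kappa)+i\kappa$, $\zeta(0):=1/(2\delta)$; $E(\zeta):=-\zeta+\frac1{2\delta}(1+\operatorname{Log}(2\delta\zeta))$; $\kappa_{\max}:=\operatorname{Im}[-\frac1{2\delta}W_{-1}(-e^{2\delta u_{\max}-1})]$; for $\kappa\in(0,\kappa_{\max}]$, $x_-(\kappa)\le x_{\max}\le x_+(\kappa)$ solve $u_0(x)=E(\zeta(\kappa))$, $x_\pm(0)=\pm\infty$; $a(\kappa,u):=-2\delta\zeta(\kappa)e^{-2\delta(\zeta(\kappa)+u)}$.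 $R^{\mathrm{Wyl}}(\kappa):=\frac1{4\delta}\int_{x_-(\kappa)}^{x_+(\kappa)}[W_0-W_{-1}](a(\kappa,u_0(x)))dx$ (strictly decreasing, $R^{\mathrm{Wyl}}(\kappa_{\max})=0$); $\rho^{\mathrm{Wyl}}:=-\frac{d}{d\kappa}R^{\mathrm{Wyl}}$. $\theta_+(\kappa):=\kappa x_+(\kappa)+\int_{x_+(\kappa)}^\infty\operatorname{Im}[\zeta(\kappa)+\frac1{2\delta}W_{-1}(a(\kappa,u_0(x)))]dx$. $\epsilon_N:=R^{\mathrm{Wyl}}(0)/(\pi N)$; $\kappa_n$ defined by $R^{\mathrm{Wyl}}(\kappa_n)=\pi(n-\frac12)\epsilon_N$, $\zeta_n:=\zeta(\kappa_n)$, $1\le n\le N$. $V(\kappa;x,t):=x\kappa+t\operatorname{Im}[(\zeta(\kappa)-\frac1{2\delta})^2]-\theta_+(\kappa)$. $g(\zeta,\lambda):=\log|(\zeta-\bar\lambda)/(\zeta-\lambda)|$ ($\zeta\neq\lambda$), $g(\zeta,\zeta):=\log|\zeta-\bar\zeta|$. For $S\subseteq\{1,\dots,N\}$: $E_{N,S}(x,t):=\pi\epsilon_N\sum_{n\in S}V(\kappa_n;x,t)+\frac{\pi\epsilon_N^2}2\sum_{n,\ell\in S}g(\zeta_n,\zeta_\ell)$, and $E^{\min}_N(x,t):=\min_SE_{N,S}(x,t)$. $\mathcal A$: real measurable $\rho$ on $[0,\kappa_{\max}]$ with $0\le\rho\le\rho^{\mathrm{Wyl}}$ a.e. $\mathcal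 L[\rho](\lambda):=\frac1\pi\int_0^{\kappa_{\max}}\log\big|\frac{\lambda-\overline{\zeta(\eta)}}{\lambda-\zeta(\eta)}\big|\rho(\eta)d\eta$; $\mathcal E[\rho](x,t):=\int_0^{\kappa_{\max}}\big(V(\kappa;x,t)+\frac12\mathcal L[\rho](\zeta(\kappa))\big)\rho(\kappa)\,d\kappa$. *)

theory Defs
  imports "HOL-Analysis.Analysis"
begin

definition lambertW0 :: "real \<Rightarrow> complex" where
  "lambertW0 a =
     (if - exp (-1) \<le> a then complex_of_real (THE w::real. w * exp w = a \<and> -1 \<le> w)
      else (THE w::complex. w * exp w = complex_of_real a \<and> 0 < Im w \<and> Im w < pi))"

definition lambertWm1 :: "real \<Rightarrow> complex" where
  "lambertWm1 a =
     (if - exp (-1) \<le> a \<and> a < 0 then complex_of_real (THE w::real. w * exp w = a \<and> w \<le> -1)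
      else if a < - exp (-1) then cnj (lambertW0 a)
      else undefined)"

section \<open>Spectral quantities (parameters: d = delta, u0, xm = x_max)\<close>

definition zeta :: "real \<Rightarrow> real \<Rightarrow> complex" where
  "zeta d \<kappa> = (if \<kappa> = 0 then complex_of_real (1 / (2 * d))
                 else Complex (\<kappa> * cot (2 * d * \<kappa>)) \<kappa>)"

definition Efun :: "real \<Rightarrow> complex \<Rightarrow> complex" where
  "Efun d z = - z + (1 + Ln (2 * of_real d * z)) / (2 * of_real d)"

definition kmax :: "real \<Rightarrow> real \<Rightarrow> real" where
  "kmax d umax = Im (- (1 / (2 * of_real d)) * lambertWm1 (- exp (2 * d * umax - 1)))"

text \<open>a(kappa,u); it is real for kappa in [0, kmax], W is applied to its real part.\<close>
definition aa :: "real \<Rightarrow> real \<Rightarrow> real \<Rightarrow> complex" where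
  "aa d \<kappa> u = - 2 * of_real d * zeta d \<kappa> * exp (- 2 * of_real d * (zeta d \<kappa> + of_real u))"

definition xplus :: "real \<Rightarrow> (real \<Rightarrow> real) \<Rightarrow> real \<Rightarrow> real \<Rightarrow> real" where
  "xplus d u0 xm \<kappa> = (THE x. xm \<le> x \<and> u0 x = Re (Efun d (zeta d \<kappa>)))"

definition xminus :: "real \<Rightarrow> (real \<Rightarrow> real) \<Rightarrow> real \<Rightarrow> real \<Rightarrow> real" where
  "xminus d u0 xm \<kappa> = (THE x. x \<le> xm \<and> u0 x = Re (Efun d (zeta d \<kappa>)))"

definition Rwyl :: "real \<Rightarrow> (real \<Rightarrow> real) \<Rightarrow> real \<Rightarrow> real \<Rightarrow> real" where
  "Rwyl d u0 xm \<kappa> =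
     (let f = (\<lambda>x. Re (lambertW0 (Re (aa d \<kappa> (u0 x))) - lambertWm1 (Re (aa d \<kappa> (u0 x)))))
      in (if \<kappa> = 0 then integral UNIV f
          else integral {xminus d u0 xm \<kappa> .. xplus d u0 xm \<kappa>} f) / (4 * d))"

definition rhoWyl :: "real \<Rightarrow> (real \<Rightarrow> real) \<Rightarrow> real \<Rightarrow> real \<Rightarrow> real" where
  "rhoWyl d u0 xm \<kappa> = - deriv (Rwyl d u0 xm) \<kappa>"

definition thetaPlus :: "real \<Rightarrow> (real \<Rightarrow> real) \<Rightarrow> real \<Rightarrow> real \<Rightarrow> real" where
  "thetaPlus d u0 xm \<kappa> = \<kappa> * xplus d u0 xm \<kappa> +
     integral {xplus d u0 xm \<kappa> ..}
       (\<lambda>x. Im (zeta d \<kappa> + lambertWm1 (Re (aa d \<kappa> (u0 x))) / (2 * of_real d)))"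

definition epsN :: "real \<Rightarrow> (real \<Rightarrow> real) \<Rightarrow> real \<Rightarrow> nat \<Rightarrow> real" where
  "epsN d u0 xm N = Rwyl d u0 xm 0 / (pi * real N)"

definition kappaN :: "real \<Rightarrow> (real \<Rightarrow> real) \<Rightarrow> real \<Rightarrow> nat \<Rightarrow> nat \<Rightarrow> real" where
  "kappaN d u0 xm N n = (THE \<kappa>. \<kappa> \<in> {0 .. kmax d (u0 xm)} \<and>
       Rwyl d u0 xm \<kappa> = pi * (real n - 1/2) * epsN d u0 xm N)"

definition Vfun :: "real \<Rightarrow> (real \<Rightarrow> real) \<Rightarrow> real \<Rightarrow> real \<Rightarrow> real \<Rightarrow> real \<Rightarrow> real" where
  "Vfun d u0 xm \<kappa> x t = x * \<kappa> + t * Im ((zeta d \<kappa> - of_real (1 / (2 * d)))\<^sup>2) - thetaPlus d u0 xm \<kappa>"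

definition gfun :: "complex \<Rightarrow> complex \<Rightarrow> real" where
  "gfun z l = (if z \<noteq> l then ln (cmod ((z - cnj l) / (z - l))) else ln (cmod (z - cnj z)))"

definition ENS :: "real \<Rightarrow> (real \<Rightarrow> real) \<Rightarrow> real \<Rightarrow> nat \<Rightarrow> nat set \<Rightarrow> real \<Rightarrow> real \<Rightarrow> real" where
  "ENS d u0 xm N S x t =
     pi * epsN d u0 xm N * (\<Sum>n\<in>S. Vfun d u0 xm (kappaN d u0 xm N n) x t)
     + pi * (epsN d u0 xm N)\<^sup>2 / 2 *
       (\<Sum>n\<in>S. \<Sum>l\<in>S. gfun (zeta d (kappaN d u0 xm N n)) (zeta d (kappaN d u0 xm N l)))"

definition EminN :: "real \<Rightarrow> (real \<Rightarrow> real) \<Rightarrow> real \<Rightarrow> nat \<Rightarrow> real \<Rightarrow> real \<Rightarrow> real" where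
  "EminN d u0 xm N x t = Min ((\<lambda>S. ENS d u0 xm N S x t) ` Pow {1..N})"

definition Aset :: "real \<Rightarrow> (real \<Rightarrow> real) \<Rightarrow> real \<Rightarrow> (real \<Rightarrow> real) set" where
  "Aset d u0 xm = {\<rho>. set_borel_measurable lebesgue {0 .. kmax d (u0 xm)} \<rho> \<and>
       (AE \<kappa> in lebesgue. \<kappa> \<in> {0 .. kmax d (u0 xm)} \<longrightarrow> 0 \<le> \<rho> \<kappa> \<and> \<rho> \<kappa> \<le> rhoWyl d u0 xm \<kappa>)}"

definition Lop :: "real \<Rightarrow> (real \<Rightarrow> real) \<Rightarrow> real \<Rightarrow> (real \<Rightarrow> real) \<Rightarrow> complex \<Rightarrow> real" where
  "Lop d u0 xm \<rho> lam = (1 / pi) *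
     (LINT \<eta>:{0 .. kmax d (u0 xm)}|lebesgue.
        ln (cmod ((lam - cnj (zeta d \<eta>)) / (lam - zeta d \<eta>))) * \<rho> \<eta>)"

definition Efunc :: "real \<Rightarrow> (real \<Rightarrow> real) \<Rightarrow> real \<Rightarrow> (real \<Rightarrow> real) \<Rightarrow> real \<Rightarrow> real \<Rightarrow> real" where
  "Efunc d u0 xm \<rho> x t =
     (LINT \<kappa>:{0 .. kmax d (u0 xm)}|lebesgue.
        (Vfun d u0 xm \<kappa> x t + Lop d u0 xm \<rho> (zeta d \<kappa>) / 2) * \<rho> \<kappa>)"

definition EminInf :: "real \<Rightarrow> (real \<Rightarrow> real) \<Rightarrow> real \<Rightarrow> real \<Rightarrow> real \<Rightarrow> real" where
  "EminInf d u0 xm x t = Inf ((\<lambda>\<rho>. Efunc d u0 xm \<rho> x t) ` Aset d u0 xm)"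

end

(* Both energies have the form  I(nu) = int V dnu + (1 / 2 pi) int int g dnu dnu  for measures nu of
   mass at most R(0): nu = rho dkappa with rho <= rhoWyl in the continuum, and nu = pi eps times a sum
   of point masses at kappa_n, n in S, in the discrete case (with a modified diagonal).
   The counting function R is Hoelder continuous, because x^2 u0 is integrable; hence the logarithmic
   singularity of g is uniformly small near the diagonal against every rho <= rhoWyl, and, comparing
   sums with integrals by monotonicity, also against the discrete measures.  Up to small errors g may
   thus be replaced by a continuous kernel, and then the energy depends only on the masses of the N
   cells on which R increases by R(0) / N; each cell contains exactly one kappa_n.
   A set S is turned into the density equal to rhoWyl on the cells of S and 0 elsewhere, which has the
   same cell masses.  Conversely a density gives cell masses c_n in [0, 1] (in units of a cell), and
   since the discrete energy is affine in each c_n, some S does at least as well as c.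
   Existence of a minimizer: the distribution functions of a minimizing sequence are equicontinuous;
   a limit (Arzela-Ascoli) has a density between 0 and rhoWyl (Radon-Nikodym), and the energy
   converges because it is determined by cell masses up to uniformly small errors. *)

theory Submission
  imports Defs "HOL-Complex_Analysis.Great_Picard" "HOL-Real_Asymp.Real_Asymp"
begin

section \<open>Measures dominated by the Weyl density\<close>

text \<open>The obstacle is that \<open>rhoWyl\<close> is controlled only through the modulus of
  continuity of its integral R: no pointwise bound is at hand, so the logarithm is tamed by
  integrating by parts against R. The exponent 1/14 has no meaning of its own; it is what the square
  root at the branch point -1/e of the Lambert function leaves after interpolation with the second
  moment of \<open>u0\<close>. Two further degeneracies sit at \<kappa> = 0. There numerator and
  denominator of the kernel vanish together, and the self-energies ln(2 \<kappa>_n) of the discrete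
  problem have no uniform lower bound; the latter are harmless because the mass between 0 and a node
  is at least half a cell, so that the logarithmic potential at 0 controls them. The point (x,t)
  enters through V alone and V is affine in it; a common modulus of continuity of V over a compact
  set is all that uniformity requires. The work on Lambert's function serves to show that R is
  strictly decreasing, Hoelder continuous and differentiable inside, and that V extends continuously
  to \<kappa> = 0.\<close>

lemma nn_integral_has_integral_completion:
  fixes f :: "'a::euclidean_space \<Rightarrow> real"
  assumes "\<And>x. x \<in> A \<Longrightarrow> 0 \<le> f x" "(f has_integral I) A"
  shows "(\<integral>\<^sup>+x. ennreal (indicator A x * f x) \<partial>lebesgue) = ennreal I"
  using nn_integral_has_integral_lebesgue[OF assms] by (simp add: nn_integral_completion)

text \<open>The fundamental theorem for the gauge integral supplies the integral of
  \<open>G'\<close> without prior integrability; nonnegativity off \<open>S\<close> turns it into a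
  Lebesgue integral dominating that of \<open>f\<close>. \<open>S\<close> will be the point at which
  the logarithm is singular.\<close>

lemma nn_integral_FTC_bound:
  fixes f G G' :: "real \<Rightarrow> real"
  assumes "finite S" "a \<le> b" "continuous_on {a..b} G"
    and "\<And>x. x \<in> {a<..<b} - S \<Longrightarrow> (G has_real_derivative G' x) (at x)"
    and "\<And>x. x \<in> {a<..<b} - S \<Longrightarrow> 0 \<le> f x \<and> f x \<le> G' x"
  shows "(\<integral>\<^sup>+x. ennreal (indicator ({a<..<b} - S) x * f x) \<partial>lebesgue) \<le> ennreal (G b - G a)"
proof -
  have 1: "(G' has_integral (G b - G a)) {a..b}"
    using assms by (intro fundamental_theorem_of_calculus_interior_strong[of S])
      (auto simp: has_real_derivative_iff_has_vector_derivative)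
  have 2: "((\<lambda>x. if x \<in> {a<..<b} - S then G' x else 0) has_integral (G b - G a)) {a..b}"
    by (rule has_integral_spike_finite[OF _ _ 1, of "{a,b} \<union> S"]) (use assms in auto)
  have "(\<integral>\<^sup>+x. ennreal (indicator {a..b} x * (if x \<in> {a<..<b} - S then G' x else 0)) \<partial>lebesgue) = ennreal (G b - G a)"
    using assms(5) by (intro nn_integral_has_integral_completion[OF _ 2]) fastforce+
  moreover have "(\<integral>\<^sup>+x. ennreal (indicator ({a<..<b} - S) x * f x) \<partial>lebesgue) \<le>
     (\<integral>\<^sup>+x. ennreal (indicator {a..b} x * (if x \<in> {a<..<b} - S then G' x else 0)) \<partial>lebesgue)"
    using assms(5) by (intro nn_integral_mono ennreal_leI) (auto simp: indicator_def)
  ultimately show ?thesis by simp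
qed

text \<open>What potential theory has to know: \<open>k\<close> is the largest \<kappa>,
  \<open>R\<close> the counting function \<open>Rwyl\<close>, \<open>z\<close> the curve
  \<open>zeta\<close>. Parametrizing the curve by its height (\<open>z_Im\<close>) makes it
  injective and bounds |z a - z b| below by |a - b|, so that singularities can be measured on the
  line.\<close>

locale weyl_gas =
  fixes k :: real and R :: "real \<Rightarrow> real" and z :: "real \<Rightarrow> complex" and C \<alpha> :: real
  assumes k_pos: "0 < k"
    and R_cont: "continuous_on {0..k} R"
    and R_strict: "\<And>a b. 0 \<le> a \<Longrightarrow> a < b \<Longrightarrow> b \<le> k \<Longrightarrow> R b < R a"
    and R_end: "R k = 0"
    and R_diff: "\<And>a. 0 < a \<Longrightarrow> a < k \<Longrightarrow> R differentiable (at a)"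
    and R_hoelder: "\<And>a b. 0 \<le> a \<Longrightarrow> a \<le> b \<Longrightarrow> b \<le> k \<Longrightarrow> R a - R b \<le> C * (b - a) powr \<alpha>"
    and \<alpha>_pos: "0 < \<alpha>"
    and z_cont: "continuous_on {0..k} z"
    and z_Im: "\<And>a. a \<in> {0..k} \<Longrightarrow> Im (z a) = a"
begin

abbreviation "L \<equiv> lebesgue_on {0..k}"

text \<open>At the two end points \<open>R\<close> need not be differentiable and
  \<open>deriv\<close> would be arbitrary; 0 is put there, which changes \<open>rhoWyl\<close> on a
  null set only.\<close>

definition w :: "real \<Rightarrow> real" where
  "w a = (if 0 < a \<and> a < k then - deriv R a else 0)"

lemma R_mono: "0 \<le> a \<Longrightarrow> a \<le> b \<Longrightarrow> b \<le> k \<Longrightarrow> R b \<le> R a"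
  using R_strict[of a b] by (cases "a = b") auto

lemma R_deriv: "0 < a \<Longrightarrow> a < k \<Longrightarrow> (R has_real_derivative - w a) (at a)"
  using R_diff[of a] by (auto simp: w_def DERIV_deriv_iff_real_differentiable)

lemma w_nonneg: "0 \<le> w a"
proof (cases "0 < a \<and> a < k")
  case True
  show ?thesis
  proof (rule ccontr)
    assume "\<not> ?thesis"
    then obtain d where d: "0 < d" "\<And>h. 0 < h \<Longrightarrow> h < d \<Longrightarrow> R a < R (a + h)"
      using DERIV_pos_inc_right[OF R_deriv[of a]] True by force
    define h where "h = min (d/2) (k - a)"
    have "0 < h" "h < d" "a + h \<le> k" using d True by (auto simp: h_def min_def)
    then show False using d(2)[of h] R_mono[of a "a+h"] True by auto
  qed
qed (auto simp: w_def)

text \<open>Only continuity at the end points and differentiability inside enter, since nothing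
  bounds \<open>w\<close> near 0 and \<open>k\<close>. Being nonnegative, \<open>w\<close> is then
  Lebesgue integrable.\<close>

lemma w_has_integral:
  assumes "0 \<le> a" "a \<le> b" "b \<le> k"
  shows "(w has_integral (R a - R b)) {a..b}"
proof -
  have "(w has_integral (- R b - (- R a))) {a..b}"
  proof (rule fundamental_theorem_of_calculus_interior)
    show "continuous_on {a..b} (\<lambda>x. - R x)"
      using assms by (intro continuous_on_minus continuous_on_subset[OF R_cont]) auto
    fix x assume "x \<in> {a<..<b}"
    then have "(R has_real_derivative - w x) (at x)" using assms by (intro R_deriv) auto
    then have "((\<lambda>x. - R x) has_real_derivative - (- w x)) (at x)" by (rule DERIV_minus)
    then show "((\<lambda>x. - R x) has_vector_derivative w x) (at x)"
      by (simp add: has_real_derivative_iff_has_vector_derivative)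
  qed (use assms in auto)
  then show ?thesis by simp
qed

lemma borel_L: "f \<in> borel_measurable borel \<Longrightarrow> f \<in> borel_measurable L"
  by (simp add: measurable_restrict_space1 measurable_completion)

lemma cont_L: "continuous_on {0..k} f \<Longrightarrow> f \<in> borel_measurable L" for f :: "real \<Rightarrow> 'b::{euclidean_space}"
  by (rule continuous_imp_measurable_on_sets_lebesgue) auto

lemma w_integrable: "integrable L w"
proof -
  have "w absolutely_integrable_on {0..k}"
    using w_has_integral[of 0 k] k_pos w_nonneg
    by (intro nonnegative_absolutely_integrable_1) auto
  then show ?thesis
    by (simp add: integrable_restrict_space set_integrable_def)
qed

lemma w_meas[measurable]: "w \<in> borel_measurable L"
  using w_integrable by auto

text \<open>\<open>\<mu>\<close> is the Weyl measure that dominates all others.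
  \<open>ennreal\<close> truncates negative values, which an element of \<open>adm\<close> takes
  only on a null set.\<close>

definition \<mu> where "\<mu> = density L (\<lambda>a. ennreal (w a))"
definition \<nu> where "\<nu> \<rho> = density L (\<lambda>a. ennreal (\<rho> a))"
definition adm where "adm = {\<rho>. \<rho> \<in> borel_measurable L \<and> (AE a in L. 0 \<le> \<rho> a \<and> \<rho> a \<le> w a)}"

lemma \<mu>_eq: "\<mu> = \<nu> w" by (simp add: \<mu>_def \<nu>_def)
lemma w_adm: "w \<in> adm" using w_nonneg by (auto simp: adm_def)

lemma space_\<nu>[simp]: "space (\<nu> \<rho>) = {0..k}" by (simp add: \<nu>_def)
lemma sets_\<nu>[simp, measurable_cong]: "sets (\<nu> \<rho>) = sets L" by (simp add: \<nu>_def)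
lemma space_\<mu>[simp]: "space \<mu> = {0..k}" by (simp add: \<mu>_def)
lemma sets_\<mu>[simp, measurable_cong]: "sets \<mu> = sets L" by (simp add: \<mu>_def)

lemma L_sets: "A \<subseteq> {0..k} \<Longrightarrow> A \<in> sets borel \<Longrightarrow> A \<in> sets L"
  by (auto simp: sets_restrict_space)

lemma admD:
  assumes "\<rho> \<in> adm"
  shows "\<rho> \<in> borel_measurable L" "AE a in L. 0 \<le> \<rho> a" "AE a in L. \<rho> a \<le> w a" "integrable L \<rho>"
proof -
  show 1: "\<rho> \<in> borel_measurable L" "AE a in L. 0 \<le> \<rho> a" "AE a in L. \<rho> a \<le> w a"
    using assms by (auto simp: adm_def)
  show "integrable L \<rho>"
  proof (rule Bochner_Integration.integrable_bound[OF w_integrable 1(1)])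
    show "AE a in L. norm (\<rho> a) \<le> norm (w a)" using 1(2,3) by eventually_elim auto
  qed
qed

lemma nn_\<nu>:
  assumes "\<rho> \<in> adm" "f \<in> borel_measurable L"
  shows "(\<integral>\<^sup>+a. f a \<partial>\<nu> \<rho>) = (\<integral>\<^sup>+a. ennreal (\<rho> a) * f a \<partial>L)"
  using admD(1)[OF assms(1)] assms(2) by (simp add: \<nu>_def nn_integral_density)

lemma nn_\<nu>_le_\<mu>:
  assumes "\<rho> \<in> adm" "f \<in> borel_measurable L"
  shows "(\<integral>\<^sup>+a. f a \<partial>\<nu> \<rho>) \<le> (\<integral>\<^sup>+a. f a \<partial>\<mu>)"
  unfolding \<mu>_eq nn_\<nu>[OF assms] nn_\<nu>[OF w_adm assms(2)]
  using admD(3)[OF assms(1)]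
  by (intro nn_integral_mono_AE, eventually_elim) (auto intro: mult_right_mono ennreal_leI)

lemma emeasure_\<mu>_Icc:
  assumes "0 \<le> a" "a \<le> b" "b \<le> k"
  shows "emeasure \<mu> {a..b} = ennreal (R a - R b)"
proof -
  have sub: "{a..b} \<subseteq> {0..k}" using assms by auto
  have "emeasure \<mu> {a..b} = (\<integral>\<^sup>+x. ennreal (w x) * indicator {a..b} x \<partial>L)"
    unfolding \<mu>_def by (rule emeasure_density) (use L_sets[OF sub] in auto)
  also have "\<dots> = (\<integral>\<^sup>+x. ennreal (w x) * indicator {a..b} x * indicator {0..k} x \<partial>lebesgue)"
    by (subst nn_integral_restrict_space) auto
  also have "\<dots> = (\<integral>\<^sup>+x. ennreal (indicator {a..b} x * w x) \<partial>lebesgue)"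
    using sub by (intro nn_integral_cong) (auto simp: indicator_def)
  also have "\<dots> = ennreal (R a - R b)"
    by (rule nn_integral_has_integral_completion[OF _ w_has_integral[OF assms]]) (rule w_nonneg)
  finally show ?thesis .
qed

lemma emeasure_\<nu>_le: "\<rho> \<in> adm \<Longrightarrow> A \<in> sets L \<Longrightarrow> emeasure (\<nu> \<rho>) A \<le> emeasure \<mu> A"
  using nn_\<nu>_le_\<mu>[of \<rho> "indicator A"] by simp

lemma fin_\<nu>: "\<rho> \<in> adm \<Longrightarrow> finite_measure (\<nu> \<rho>)"
  using emeasure_\<nu>_le[of \<rho> "{0..k}"] emeasure_\<mu>_Icc[of 0 k] k_pos L_sets[of "{0..k}"]
  by (intro finite_measureI) (auto simp: top_unique)

lemma fin_\<mu>: "finite_measure \<mu>" using fin_\<nu>[OF w_adm] by (simp add: \<mu>_eq)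

lemma measure_\<nu>_le: "\<rho> \<in> adm \<Longrightarrow> A \<in> sets L \<Longrightarrow> measure (\<nu> \<rho>) A \<le> measure \<mu> A"
  using emeasure_\<nu>_le[of \<rho> A] finite_measure.emeasure_eq_measure[OF fin_\<nu>, of \<rho> A]
    finite_measure.emeasure_eq_measure[OF fin_\<mu>, of A] by simp

lemma measure_\<mu>_Icc: "0 \<le> a \<Longrightarrow> a \<le> b \<Longrightarrow> b \<le> k \<Longrightarrow> measure \<mu> {a..b} = R a - R b"
  using emeasure_\<mu>_Icc[of a b] R_mono[of a b] by (simp add: measure_def)

lemma R_pos: "0 < R 0" using R_strict[of 0 k] R_end k_pos by simp

lemma measure_\<nu>_space: "\<rho> \<in> adm \<Longrightarrow> measure (\<nu> \<rho>) {0..k} \<le> R 0"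
  using measure_\<nu>_le[of \<rho> "{0..k}"] measure_\<mu>_Icc[of 0 k] R_end k_pos L_sets[of "{0..k}"] by simp

lemma AE_\<nu>: "\<rho> \<in> adm \<Longrightarrow> AE x in L. P x \<Longrightarrow> AE x in \<nu> \<rho>. P x"
  unfolding \<nu>_def using admD(1)[of \<rho>] by (subst AE_density) auto

lemma AE_L_neq: "AE x in L. x \<noteq> a"
proof -
  have "AE x in lebesgue. x \<noteq> a"
    by (rule AE_completion) (rule AE_lborel_singleton)
  then show ?thesis by (subst AE_restrict_space_iff) auto
qed

lemma AE_L_I: "AE x in L. x \<in> {0..k}"
  by (rule AE_I2) simp

lemma integral_\<nu>:
  fixes f :: "real \<Rightarrow> real"
  assumes "\<rho> \<in> adm" "f \<in> borel_measurable L"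
  shows "(\<integral>a. f a \<partial>\<nu> \<rho>) = (\<integral>a. f a * \<rho> a \<partial>L)"
  unfolding \<nu>_def using admD[OF assms(1)] assms(2)
  by (subst integral_density) (auto simp: mult.commute)

text \<open>A bound for the numerator of the kernel, with 1 added so that C0 / t is at least 1 for 0
  < t < 1 and the logarithms below are nonnegative; the conjunct \<open>0 \<le> B\<close> in the
  choice secures this.\<close>

definition C0 :: real where
  "C0 = 1 + (SOME B. \<forall>a\<in>{0..k}. \<forall>b\<in>{0..k}. cmod (z a - cnj (z b)) \<le> B \<and> 0 \<le> B)"

lemma C0: "a \<in> {0..k} \<Longrightarrow> b \<in> {0..k} \<Longrightarrow> cmod (z a - cnj (z b)) \<le> C0" "1 \<le> C0"
proof -
  have "bounded (z ` {0..k})"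
    by (intro compact_imp_bounded compact_continuous_image z_cont) auto
  then obtain B where B: "\<And>a. a \<in> {0..k} \<Longrightarrow> cmod (z a) \<le> B"
    unfolding bounded_iff by blast
  have B0: "0 \<le> B" using order_trans[OF norm_ge_zero B[of 0]] k_pos by simp
  have "\<exists>B. \<forall>a\<in>{0..k}. \<forall>b\<in>{0..k}. cmod (z a - cnj (z b)) \<le> B \<and> 0 \<le> B"
  proof (intro exI[of _ "B+B"] ballI conjI)
    fix a b assume "a \<in> {0..k}" "b \<in> {0..k}"
    then show "cmod (z a - cnj (z b)) \<le> B + B"
      using norm_triangle_ineq4[of "z a" "cnj (z b)"] B[of a] B[of b] by simp
  qed (use B0 in auto)
  from someI_ex[OF this] have *: "\<forall>a\<in>{0..k}. \<forall>b\<in>{0..k}. cmod (z a - cnj (z b)) \<le> C0 - 1 \<and> 0 \<le> C0 - 1"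
    by (simp add: C0_def)
  show "1 \<le> C0" using * k_pos by (auto dest!: bspec[of _ _ 0])
  show "cmod (z a - cnj (z b)) \<le> C0" if "a \<in> {0..k}" "b \<in> {0..k}" using * that by fastforce
qed

text \<open>A majorant of the kernel within distance \<open>r\<close> of the diagonal that depends
  on |a - b| alone and decreases with it. On the diagonal it is
  \<open>ln (C0 / 0) = 0\<close>.\<close>

definition sing :: "real \<Rightarrow> real \<Rightarrow> real \<Rightarrow> real" where
  "sing r a b = (if \<bar>a - b\<bar> < r then ln (C0 / \<bar>a - b\<bar>) else 0)"

lemma sing_meas[measurable]: "(\<lambda>b. sing r a b) \<in> borel_measurable L"
  unfolding sing_def by (rule borel_L) measurable

lemma sing_nonneg: "r \<le> 1 \<Longrightarrow> 0 \<le> sing r a b"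
  using C0(2) by (cases "a = b") (auto simp: sing_def field_simps)

lemma C_nonneg: "0 \<le> C"
  using R_hoelder[of 0 k] R_strict[of 0 k] k_pos
  by (smt (verit) mult_nonneg_nonneg mult_neg_pos powr_gt_zero zero_less_mult_pos2)

end

section \<open>Uniform smallness of the logarithmic singularity\<close>

lemma powr_times_ln_tendsto_0:
  fixes \<alpha> c :: real
  assumes "0 < \<alpha>" "0 < c"
  shows "((\<lambda>t. t powr \<alpha> * ln (c / t)) \<longlongrightarrow> 0) (at_right 0)"
proof (rule Lim_transform_eventually)
  show "((\<lambda>t::real. t powr \<alpha> * (ln c - ln t)) \<longlongrightarrow> 0) (at_right 0)"
    using assms by real_asymp
  show "\<forall>\<^sub>F t in at_right 0. t powr \<alpha> * (ln c - ln t) = t powr \<alpha> * ln (c / t)"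
    using eventually_at_right_less[of 0] by eventually_elim (use assms in \<open>simp add: ln_div\<close>)
qed

lemma powr_tendsto_0_at_right: "0 < \<alpha> \<Longrightarrow> ((\<lambda>t::real. t powr \<alpha>) \<longlongrightarrow> 0) (at_right 0)"
  by real_asymp

lemma DERIV_ln_div_right: assumes "(a::real) < b" "0 < c" shows "((\<lambda>b. ln (c / (b - a))) has_real_derivative - 1 / (b - a)) (at b)"
proof -
  have "((\<lambda>b. ln c - ln (b - a)) has_real_derivative - 1 / (b - a)) (at b)"
    using assms by (auto intro!: derivative_eq_intros)
  then show ?thesis
    by (rule has_field_derivative_transform_within_open[of _ _ _ "{a<..}"]) (use assms in \<open>auto simp: ln_div\<close>)
qed
lemma DERIV_ln_div_left: assumes "(b::real) < a" "0 < c" shows "((\<lambda>b. ln (c / (a - b))) has_real_derivative 1 / (a - b)) (at b)"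
proof -
  have "((\<lambda>b. ln c - ln (a - b)) has_real_derivative 1 / (a - b)) (at b)"
    using assms by (auto intro!: derivative_eq_intros simp: field_simps)
  then show ?thesis
    by (rule has_field_derivative_transform_within_open[of _ _ _ "{..<a}"]) (use assms in \<open>auto simp: ln_div\<close>)
qed
context weyl_gas begin

definition Phi :: "real \<Rightarrow> real" where
  "Phi t = C * (t powr \<alpha> * ln (C0 / t)) + C / \<alpha> * t powr \<alpha>"

lemma Phi_small:
  assumes "0 < e"
  obtains r where "0 < r" "r \<le> 1" "\<And>t. 0 < t \<Longrightarrow> t \<le> r \<Longrightarrow> Phi t < e"
proof -
  have C0p: "0 < C0" using C0(2) by linarith
  have "(Phi \<longlongrightarrow> C * 0 + C / \<alpha> * 0) (at_right 0)"
    unfolding Phi_def[abs_def]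
    by (intro tendsto_intros powr_times_ln_tendsto_0 powr_tendsto_0_at_right \<alpha>_pos C0p)
  then have "eventually (\<lambda>t. Phi t < e) (at_right 0)"
    by (rule order_tendstoD(2)) (use assms in simp)
  then obtain b where b: "0 < b" "\<And>t. 0 < t \<Longrightarrow> t < b \<Longrightarrow> Phi t < e"
    by (auto simp: eventually_at_right_field)
  show thesis by (rule that[of "min 1 (b/2)"]) (use b in auto)
qed

lemma R_abs_hoelder: "a \<in> {0..k} \<Longrightarrow> b \<in> {0..k} \<Longrightarrow> \<bar>R a - R b\<bar> \<le> C * \<bar>b - a\<bar> powr \<alpha>"
  using R_hoelder[of a b] R_hoelder[of b a] R_mono[of a b] R_mono[of b a]
  by (cases "a \<le> b") (auto simp: abs_if)

text \<open>Integration by parts: \<open>Phi\<close> bounds the boundary terms \<open>\<bar>R a - R b\<bar> ln (C0 / \<bar>b - a\<bar>)\<close>, and its second summand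
  absorbs the integral of \<open>\<bar>R a - R b\<bar> / \<bar>b - a\<bar>\<close>.\<close>

lemma log_potential_bound:
  assumes a: "a \<in> {0..k}" and r: "0 < r" "r \<le> 1" "\<And>t. 0 < t \<Longrightarrow> t \<le> r \<Longrightarrow> Phi t < e"
  shows "(\<integral>\<^sup>+b. ennreal (sing r a b) \<partial>\<mu>) \<le> ennreal (2 * e)"
proof -
  define l u where "l = max 0 (a - r)" and "u = min k (a + r)"
  have lu: "0 \<le> l" "l \<le> a" "a \<le> u" "u \<le> k" "a - r \<le> l" "u \<le> a + r" "l \<le> u"
    using a r by (auto simp: l_def u_def)
  \<comment> \<open>\<open>sgn\<close> glues the antiderivatives on the two sides of
    \<open>a\<close>. Since \<open>sgn 0 = 0\<close>, the value at \<open>a\<close> is 0, which is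
    also the limit there because |G b| is at most Phi |b - a|.\<close>
  define G where "G b = sgn (b - a) * (\<bar>R a - R b\<bar> * ln (C0 / \<bar>b - a\<bar>) + C / \<alpha> * \<bar>b - a\<bar> powr \<alpha>)" for b
  \<comment> \<open>The second summand is nonnegative by the Hoelder bound; dropping it leaves the
    integrand \<open>w b * sing r a b\<close>.\<close>
  define G' where "G' b = w b * ln (C0 / \<bar>b - a\<bar>) + (C * \<bar>b - a\<bar> powr \<alpha> - \<bar>R a - R b\<bar>) / \<bar>b - a\<bar>" for b
  have C0p: "0 < C0" using C0(2) by linarith
  have ln_nn: "0 \<le> ln (C0 / \<bar>b - a\<bar>)" if "b \<in> {l..u}" for b
    using that C0(2) lu r by (cases "b = a") (auto intro!: ln_ge_zero simp: field_simps abs_if)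
  have Gle: "\<bar>G b\<bar> \<le> Phi \<bar>b - a\<bar>" if "b \<in> {l..u}" for b
  proof -
    have "\<bar>R a - R b\<bar> * ln (C0 / \<bar>b - a\<bar>) \<le> (C * \<bar>b - a\<bar> powr \<alpha>) * ln (C0 / \<bar>b - a\<bar>)"
      using that a lu by (intro mult_right_mono R_abs_hoelder ln_nn) auto
    moreover have "0 \<le> \<bar>R a - R b\<bar> * ln (C0 / \<bar>b - a\<bar>)" using ln_nn[OF that] by simp
    moreover have "0 \<le> C / \<alpha> * \<bar>b - a\<bar> powr \<alpha>" using C_nonneg \<alpha>_pos by simp
    ultimately show ?thesis by (auto simp: G_def Phi_def abs_mult sgn_if algebra_simps)
  qed
  have der: "(G has_real_derivative G' b) (at b)" if "b \<in> {l<..<u} - {a}" for b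
  proof -
    have Rb: "(R has_real_derivative - w b) (at b)" using that lu by (intro R_deriv) auto
    show ?thesis
    proof (cases "a < b")
      case True
      have P: "((\<lambda>b. C / \<alpha> * (b - a) powr \<alpha>) has_real_derivative C * (b - a) powr (\<alpha> - 1)) (at b)"
        using True \<alpha>_pos by (auto intro!: derivative_eq_intros)
      have "((\<lambda>b. (R a - R b) * ln (C0 / (b - a)) + C / \<alpha> * (b - a) powr \<alpha>) has_real_derivative
         (w b * ln (C0 / (b - a)) + (C * (b - a) powr \<alpha> - (R a - R b)) / (b - a))) (at b)"
        by (rule DERIV_cong[OF DERIV_add[OF DERIV_mult[OF DERIV_diff[OF DERIV_const Rb] DERIV_ln_div_right[OF True C0p]] P]])
          (use True in \<open>simp add: powr_diff diff_divide_distrib mult.commute\<close>)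
      moreover have "R b \<le> R a" using that lu True by (intro R_mono) auto
      ultimately have 1: "((\<lambda>b. (R a - R b) * ln (C0 / (b - a)) + C / \<alpha> * (b - a) powr \<alpha>) has_real_derivative G' b) (at b)"
        using True by (simp add: G'_def)
      show ?thesis
      proof (rule has_field_derivative_transform_within_open[OF 1, of "{a<..<u}"])
        fix x assume "x \<in> {a<..<u}"
        then show "(R a - R x) * ln (C0 / (x - a)) + C / \<alpha> * (x - a) powr \<alpha> = G x"
          using R_mono[of a x] lu by (auto simp: G_def sgn_if)
      qed (use True that in auto)
    next
      case False
      then have ba: "b < a" using that by auto
      have P: "((\<lambda>b. C / \<alpha> * (a - b) powr \<alpha>) has_real_derivative - C * (a - b) powr (\<alpha> - 1)) (at b)"
        using ba \<alpha>_pos by (auto intro!: derivative_eq_intros)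
      have "((\<lambda>b. - ((R b - R a) * ln (C0 / (a - b)) + C / \<alpha> * (a - b) powr \<alpha>)) has_real_derivative
         (w b * ln (C0 / (a - b)) + (C * (a - b) powr \<alpha> - (R b - R a)) / (a - b))) (at b)"
        by (rule DERIV_cong[OF DERIV_minus[OF DERIV_add[OF DERIV_mult[OF DERIV_diff[OF Rb DERIV_const] DERIV_ln_div_left[OF ba C0p]] P]]])
          (use ba in \<open>simp add: powr_diff diff_divide_distrib mult.commute\<close>)
      moreover have "R a \<le> R b" using that lu ba by (intro R_mono) auto
      ultimately have 1: "((\<lambda>b. - ((R b - R a) * ln (C0 / (a - b)) + C / \<alpha> * (a - b) powr \<alpha>)) has_real_derivative G' b) (at b)"
        using ba by (simp add: G'_def)
      show ?thesis
      proof (rule has_field_derivative_transform_within_open[OF 1, of "{l<..<a}"])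
        fix x assume "x \<in> {l<..<a}"
        then show "- ((R x - R a) * ln (C0 / (a - x)) + C / \<alpha> * (a - x) powr \<alpha>) = G x"
          using R_mono[of x a] lu by (auto simp: G_def sgn_if)
      qed (use ba that in auto)
    qed
  qed
  have cont: "continuous_on {l..u} G"
    unfolding continuous_on_eq_continuous_within
  proof
    fix b assume b: "b \<in> {l..u}"
    show "continuous (at b within {l..u}) G"
    proof (cases "b = a")
      case True
      have "\<exists>d>0. \<forall>x\<in>{l..u}. 0 < dist x a \<and> dist x a < d \<longrightarrow> dist (G x) 0 < e'" if e': "0 < e'" for e'
      proof -
        obtain d where d: "0 < d" "\<And>t. 0 < t \<Longrightarrow> t \<le> d \<Longrightarrow> Phi t < e'" using Phi_small[OF e'] by metis
        show ?thesis
        proof (intro exI[of _ d] conjI ballI impI)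
          fix x assume x: "x \<in> {l..u}" "0 < dist x a \<and> dist x a < d"
          then have "Phi \<bar>x - a\<bar> < e'" by (intro d) (auto simp: dist_real_def)
          then show "dist (G x) 0 < e'" using Gle[OF x(1)] by simp
        qed (rule d)
      qed
      then have "(G \<longlongrightarrow> 0) (at a within {l..u})" by (auto simp: Lim_within)
      then show ?thesis using True by (simp add: continuous_within G_def)
    next
      case False
      have cR: "continuous (at b within {l..u}) R"
        using continuous_on_subset[OF R_cont, of "{l..u}"] b lu by (auto simp: continuous_on_eq_continuous_within)
      have sg: "continuous (at b within {l..u}) (\<lambda>b. sgn (b - a))"
        using False by (intro continuous_intros) auto
      show ?thesis
        unfolding G_def[abs_def] using False C0p
        by (intro continuous_intros cR sg) (auto simp: field_simps)
    qed
  qed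
  have bnd: "0 \<le> w b * sing r a b \<and> w b * sing r a b \<le> G' b" if "b \<in> {l<..<u} - {a}" for b
  proof -
    have "\<bar>a - b\<bar> < r" using that by (auto simp: l_def u_def)
    moreover have "0 \<le> (C * \<bar>b - a\<bar> powr \<alpha> - \<bar>R a - R b\<bar>) / \<bar>b - a\<bar>"
      using R_abs_hoelder[of a b] that a lu by (intro divide_nonneg_nonneg) auto
    moreover have "0 \<le> w b * ln (C0 / \<bar>a - b\<bar>)"
      using w_nonneg[of b] ln_nn[of b] that by (simp add: abs_minus_commute)
    ultimately show ?thesis by (simp add: sing_def G'_def abs_minus_commute)
  qed
  have "(\<integral>\<^sup>+b. ennreal (sing r a b) \<partial>\<mu>) = (\<integral>\<^sup>+b. ennreal (w b) * ennreal (sing r a b) * indicator {0..k} b \<partial>lebesgue)"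
    unfolding \<mu>_eq nn_\<nu>[OF w_adm measurable_compose[OF sing_meas measurable_ennreal]]
    by (subst nn_integral_restrict_space) auto
  also have "\<dots> = (\<integral>\<^sup>+b. ennreal (indicator ({l<..<u} - {a}) b * (w b * sing r a b)) \<partial>lebesgue)"
  proof (rule nn_integral_cong)
    fix b
    show "ennreal (w b) * ennreal (sing r a b) * indicator {0..k} b =
      ennreal (indicator ({l<..<u} - {a}) b * (w b * sing r a b))"
    proof (cases "w b = 0 \<or> sing r a b = 0")
      case False
      then have "b \<in> {l<..<u} - {a}"
        by (auto simp: w_def sing_def l_def u_def split: if_splits)
      then show ?thesis using lu w_nonneg[of b] by (auto simp: ennreal_mult')
    qed (auto simp: indicator_def)
  qed
  also have "\<dots> \<le> ennreal (G u - G l)"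
    by (rule nn_integral_FTC_bound[OF _ \<open>l \<le> u\<close> cont der bnd]) auto
  also have "\<dots> \<le> ennreal (2 * e)"
  proof (rule ennreal_leI)
    have e0: "0 < e"
    proof -
      have "0 \<le> Phi r" unfolding Phi_def using C_nonneg \<alpha>_pos r C0(2)
        by (intro add_nonneg_nonneg mult_nonneg_nonneg ln_ge_zero) (auto simp: field_simps)
      then show ?thesis using r(3)[of r] r(1) by simp
    qed
    have "\<bar>G b\<bar> \<le> e" if "b \<in> {l..u}" for b
    proof (cases "b = a")
      case False
      have "\<bar>b - a\<bar> \<le> r" using that lu by auto
      then have "Phi \<bar>b - a\<bar> < e" using False by (intro r) auto
      then show ?thesis using Gle[OF that] by simp
    qed (use e0 in \<open>simp add: G_def\<close>)
    from this[of u] this[of l] lu show "G u - G l \<le> 2 * e" by auto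
  qed
  finally show ?thesis .
qed

text \<open>\<open>Phi\<close> does not depend on \<open>a\<close>, so one radius serves all
  centres. This uniformity carries every later replacement of the kernel.\<close>

lemma log_small:
  assumes "0 < e"
  obtains r where "0 < r" "r \<le> 1" "\<And>a. a \<in> {0..k} \<Longrightarrow> (\<integral>\<^sup>+b. ennreal (sing r a b) \<partial>\<mu>) \<le> ennreal e"
  using Phi_small[of "e/2"] log_potential_bound[where e="e/2"] assms
  by (metis half_gt_zero mult_2 field_sum_of_halves)

end

section \<open>Potentials and the energy\<close>

context weyl_gas begin

definition g :: "real \<Rightarrow> real \<Rightarrow> real" where
  "g a b = ln (cmod ((z a - cnj (z b)) / (z a - z b)))"

text \<open>On the diagonal \<open>g a a = ln 0 = 0\<close> is a junk value. Cutting off numerator and denominator at the same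
  height \<open>r\<close> keeps \<open>0 \<le> g_reg r \<le> g\<close> off the diagonal and makes \<open>g_reg r\<close> continuous even at the corner \<open>(0, 0)\<close>.\<close>

definition g_reg :: "real \<Rightarrow> real \<Rightarrow> real \<Rightarrow> real" where
  "g_reg r a b = ln (max (cmod (z a - cnj (z b))) r / max (cmod (z a - z b)) r)"

lemma z_dist: "a \<in> {0..k} \<Longrightarrow> b \<in> {0..k} \<Longrightarrow> \<bar>a - b\<bar> \<le> cmod (z a - z b)"
  using abs_Im_le_cmod[of "z a - z b"] z_Im by simp

text \<open>Both differences have the same real part, and |a - b| is at most a + b for nonnegative
  heights.\<close>

lemma z_dist_cnj:
  assumes "a \<in> {0..k}" "b \<in> {0..k}"
  shows "cmod (z a - z b) \<le> cmod (z a - cnj (z b))"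
proof -
  have "(Im (z a - z b))\<^sup>2 \<le> (Im (z a - cnj (z b)))\<^sup>2"
    using assms z_Im by (intro power2_le_iff_abs_le[THEN iffD2]) auto
  then show ?thesis by (auto simp: cmod_def)
qed

lemma z_inj: "a \<in> {0..k} \<Longrightarrow> b \<in> {0..k} \<Longrightarrow> z a = z b \<longleftrightarrow> a = b"
  using z_Im by metis

lemma g_nonneg: "a \<in> {0..k} \<Longrightarrow> b \<in> {0..k} \<Longrightarrow> 0 \<le> g a b"
proof (cases "a = b")
  case False
  assume ab: "a \<in> {0..k}" "b \<in> {0..k}"
  then have "0 < cmod (z a - z b)" using z_inj False by simp
  then show ?thesis using z_dist_cnj[OF ab] by (auto simp: g_def norm_divide intro!: ln_ge_zero)
qed (simp add: g_def)

lemma g_reg_nonneg: "a \<in> {0..k} \<Longrightarrow> b \<in> {0..k} \<Longrightarrow> 0 < r \<Longrightarrow> 0 \<le> g_reg r a b"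
  using z_dist_cnj[of a b] by (auto simp: g_reg_def intro!: ln_ge_zero simp: le_divide_eq)

lemma g_reg_le: "a \<in> {0..k} \<Longrightarrow> b \<in> {0..k} \<Longrightarrow> 0 < r \<Longrightarrow> r \<le> 1 \<Longrightarrow> g_reg r a b \<le> ln (C0 / r)"
  using C0(1)[of a b] C0(2) unfolding g_reg_def
  by (intro ln_mono frac_le divide_pos_pos) (auto simp: less_max_iff_disj)

text \<open>Raising numerator A and denominator B <= A to a common floor can only lower the
  quotient. For the second bound, within distance \<open>r\<close> the term \<open>sing\<close>
  majorizes all of \<open>g\<close>; farther away neither cut-off is active.\<close>

lemma g_g_reg:
  assumes ab: "a \<in> {0..k}" "b \<in> {0..k}" "a \<noteq> b" and r: "0 < r" "r \<le> 1"
  shows "g_reg r a b \<le> g a b" "g a b \<le> g_reg r a b + sing r a b"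
proof -
  define A B where "A = cmod (z a - cnj (z b))" and "B = cmod (z a - z b)"
  have AB: "0 < \<bar>a - b\<bar>" "\<bar>a - b\<bar> \<le> B" "B \<le> A" "A \<le> C0"
    using ab z_dist[of a b] z_dist_cnj[of a b] C0(1)[of a b] by (auto simp: A_def B_def)
  have g: "g a b = ln (A / B)" by (simp add: g_def A_def B_def norm_divide)
  have g_reg: "g_reg r a b = ln (max A r / max B r)" by (simp add: g_reg_def A_def B_def)
  have "max A r / max B r \<le> A / B"
    using AB r by (auto simp: max_def field_simps intro: mult_mono)
  then show "g_reg r a b \<le> g a b" unfolding g g_reg using AB r by (intro ln_mono) auto
  show "g a b \<le> g_reg r a b + sing r a b"
  proof (cases "\<bar>a - b\<bar> < r")
    case True
    have "ln (A / B) \<le> ln (C0 / \<bar>a - b\<bar>)" using AB by (intro ln_mono frac_le) auto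
    then show ?thesis using True g_reg_nonneg[of a b r] ab r by (simp add: sing_def g)
  next
    case False
    then have "r \<le> B" "r \<le> A" using AB by auto
    then show ?thesis using False by (simp add: sing_def g g_reg max_def)
  qed
qed

lemma cont_fst: "continuous_on ({0..k} \<times> {0..k}) (\<lambda>p. z (fst p))"
  by (rule continuous_on_compose2[OF z_cont]) (auto intro: continuous_intros)
lemma cont_snd: "continuous_on ({0..k} \<times> {0..k}) (\<lambda>p. z (snd p))"
  by (rule continuous_on_compose2[OF z_cont]) (auto intro: continuous_intros)

lemma g_reg_cont: "0 < r \<Longrightarrow> continuous_on ({0..k} \<times> {0..k}) (\<lambda>p. g_reg r (fst p) (snd p))"
  unfolding g_reg_def by (intro continuous_intros cont_fst cont_snd) (auto simp: max_def)

lemma z_meas[measurable]: "z \<in> borel_measurable L" by (rule cont_L[OF z_cont])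

lemma cnj_meas[measurable]: "f \<in> borel_measurable M \<Longrightarrow> (\<lambda>x. cnj (f x)) \<in> borel_measurable M"
  by (rule measurable_compose[OF _ borel_measurable_continuous_onI[OF continuous_on_cnj[OF continuous_on_id]]])

lemma g_meas[measurable]: "g a \<in> borel_measurable L"
  unfolding g_def[abs_def] norm_divide by measurable
lemma g_reg_meas[measurable]: "g_reg r a \<in> borel_measurable L"
  unfolding g_reg_def[abs_def] by measurable

definition pot :: "(real \<Rightarrow> real) \<Rightarrow> real \<Rightarrow> real" where "pot \<rho> a = (\<integral>b. g a b \<partial>\<nu> \<rho>)"
definition pot_reg :: "real \<Rightarrow> (real \<Rightarrow> real) \<Rightarrow> real \<Rightarrow> real" where "pot_reg r \<rho> a = (\<integral>b. g_reg r a b \<partial>\<nu> \<rho>)"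

lemma pot_meas[measurable]: "\<rho> \<in> adm \<Longrightarrow> pot \<rho> \<in> borel_measurable L"
proof -
  assume r: "\<rho> \<in> adm"
  interpret finite_measure "\<nu> \<rho>" by (rule fin_\<nu>[OF r])
  have [measurable]: "(\<lambda>(a, b). g a b) \<in> borel_measurable (L \<Otimes>\<^sub>M \<nu> \<rho>)"
    unfolding g_def norm_divide by measurable
  show ?thesis unfolding pot_def[abs_def] by measurable
qed

lemma pot_reg_meas[measurable]: "\<rho> \<in> adm \<Longrightarrow> pot_reg r \<rho> \<in> borel_measurable L"
proof -
  assume r: "\<rho> \<in> adm"
  interpret finite_measure "\<nu> \<rho>" by (rule fin_\<nu>[OF r])
  have [measurable]: "(\<lambda>(a, b). g_reg r a b) \<in> borel_measurable (L \<Otimes>\<^sub>M \<nu> \<rho>)"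
    unfolding g_reg_def by measurable
  show ?thesis unfolding pot_reg_def[abs_def] by measurable
qed

lemma meas_\<nu>: "f \<in> borel_measurable L \<Longrightarrow> f \<in> borel_measurable (\<nu> \<rho>)"
  by (simp add: \<nu>_def)

lemma integrable_bdd:
  fixes f :: "real \<Rightarrow> real"
  assumes "\<rho> \<in> adm" "f \<in> borel_measurable L" "\<And>a. a \<in> {0..k} \<Longrightarrow> \<bar>f a\<bar> \<le> B"
  shows "integrable (\<nu> \<rho>) f"
  using assms by (intro finite_measure.integrable_const_bound[OF fin_\<nu>, where B=B] AE_I2 meas_\<nu>) auto

lemma integrable_g_reg:
  assumes "\<rho> \<in> adm" "a \<in> {0..k}" "0 < r" "r \<le> 1"
  shows "integrable (\<nu> \<rho>) (g_reg r a)"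
  using g_reg_nonneg[of a] g_reg_le[of a] assms by (intro integrable_bdd[where B="ln (C0 / r)"]) auto

lemma integrable_sing:
  assumes "\<rho> \<in> adm" "(\<integral>\<^sup>+b. ennreal (sing r a b) \<partial>\<mu>) \<le> ennreal e" "r \<le> 1"
  shows "integrable (\<nu> \<rho>) (sing r a)" "0 \<le> e \<Longrightarrow> (\<integral>b. sing r a b \<partial>\<nu> \<rho>) \<le> e"
proof -
  have "(\<integral>\<^sup>+b. ennreal (sing r a b) \<partial>\<nu> \<rho>) \<le> (\<integral>\<^sup>+b. ennreal (sing r a b) \<partial>\<mu>)"
    by (rule nn_\<nu>_le_\<mu>[OF assms(1)]) measurable
  also note assms(2)
  finally have 1: "(\<integral>\<^sup>+b. ennreal (sing r a b) \<partial>\<nu> \<rho>) \<le> ennreal e" .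
  show 2: "integrable (\<nu> \<rho>) (sing r a)"
    using 1 sing_nonneg[OF assms(3)] meas_\<nu>[OF sing_meas[of r a]]
    by (intro integrableI_nonneg) (auto simp: le_less_trans[OF 1])
  show "(\<integral>b. sing r a b \<partial>\<nu> \<rho>) \<le> e" if "0 \<le> e"
    using 1 nn_integral_eq_integral[OF 2] sing_nonneg[OF assms(3)] that by simp
qed

lemma integrable_g:
  assumes "\<rho> \<in> adm" "a \<in> {0..k}"
  shows "integrable (\<nu> \<rho>) (g a)"
proof -
  obtain r where r: "0 < r" "r \<le> 1" "\<And>a. a \<in> {0..k} \<Longrightarrow> (\<integral>\<^sup>+b. ennreal (sing r a b) \<partial>\<mu>) \<le> ennreal 1"
    using log_small[of 1] by auto
  have "integrable (\<nu> \<rho>) (\<lambda>b. g_reg r a b + sing r a b)"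
    using integrable_g_reg[OF assms r(1,2)] integrable_sing(1)[OF assms(1) r(3)[OF assms(2)] r(2)] by auto
  then show ?thesis
  proof (rule Bochner_Integration.integrable_bound)
    show "AE b in \<nu> \<rho>. norm (g a b) \<le> norm (g_reg r a b + sing r a b)"
      using AE_\<nu>[OF assms(1) AE_L_neq[of a]] AE_\<nu>[OF assms(1) AE_L_I]
      by eventually_elim (use g_g_reg[of a _ r] g_nonneg[of a] g_reg_nonneg[of a _ r] sing_nonneg[OF r(2), of a] assms r in force)
  qed (rule meas_\<nu>[OF g_meas])
qed

lemma pot_diff:
  assumes "\<rho> \<in> adm" "a \<in> {0..k}" and r: "0 < r" "r \<le> 1" "(\<integral>\<^sup>+b. ennreal (sing r a b) \<partial>\<mu>) \<le> ennreal e" "0 \<le> e"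
  shows "pot_reg r \<rho> a \<le> pot \<rho> a" "pot \<rho> a \<le> pot_reg r \<rho> a + e"
proof -
  note ig = integrable_g[OF assms(1,2)] integrable_g_reg[OF assms(1,2) r(1,2)] integrable_sing[OF assms(1) r(3,2)]
  \<comment> \<open>The diagonal point, where \<open>g\<close> has a junk value, is null because the
    measure has a density.\<close>
  have ae: "AE b in \<nu> \<rho>. b \<noteq> a \<and> b \<in> {0..k}"
    using AE_\<nu>[OF assms(1) AE_L_neq[of a]] AE_\<nu>[OF assms(1) AE_L_I] by eventually_elim auto
  show "pot_reg r \<rho> a \<le> pot \<rho> a"
    unfolding pot_def pot_reg_def
    by (rule integral_mono_AE[OF ig(2,1)])
      (use ae in eventually_elim, use g_g_reg(1)[of a _ r] assms r in force)
  have "pot \<rho> a \<le> (\<integral>b. g_reg r a b + sing r a b \<partial>\<nu> \<rho>)"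
    unfolding pot_def using ig(1,2,3)
    by (intro integral_mono_AE) (auto, use ae in eventually_elim, use g_g_reg(2)[of a _ r] assms r in force)
  also have "\<dots> = pot_reg r \<rho> a + (\<integral>b. sing r a b \<partial>\<nu> \<rho>)" using ig by (simp add: pot_reg_def)
  finally show "pot \<rho> a \<le> pot_reg r \<rho> a + e" using ig(4) r(4) by simp
qed

lemma pot_reg_bounds:
  assumes "\<rho> \<in> adm" "a \<in> {0..k}" and r: "0 < r" "r \<le> 1"
  shows "0 \<le> pot_reg r \<rho> a" "pot_reg r \<rho> a \<le> ln (C0 / r) * R 0"
proof -
  interpret finite_measure "\<nu> \<rho>" by (rule fin_\<nu>[OF assms(1)])
  show "0 \<le> pot_reg r \<rho> a" unfolding pot_reg_def
    using g_reg_nonneg[of a _ r] assms by (intro Bochner_Integration.integral_nonneg) auto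
  have "pot_reg r \<rho> a \<le> (\<integral>b. ln (C0 / r) \<partial>\<nu> \<rho>)" unfolding pot_reg_def
    using g_reg_le[of a] assms by (intro integral_mono integrable_g_reg) auto
  also have "\<dots> = measure (\<nu> \<rho>) {0..k} * ln (C0 / r)" by simp
  also have "\<dots> \<le> R 0 * ln (C0 / r)"
    using measure_\<nu>_space[OF assms(1)] C0(2) r by (intro mult_right_mono ln_ge_zero) (auto simp: field_simps)
  finally show "pot_reg r \<rho> a \<le> ln (C0 / r) * R 0" by (simp add: mult.commute)
qed

lemma pot_bounded: "\<exists>B\<ge>0. \<forall>\<rho>\<in>adm. \<forall>a\<in>{0..k}. \<bar>pot \<rho> a\<bar> \<le> B"
proof -
  obtain r where r: "0 < r" "r \<le> 1" "\<And>a. a \<in> {0..k} \<Longrightarrow> (\<integral>\<^sup>+b. ennreal (sing r a b) \<partial>\<mu>) \<le> ennreal 1"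
    using log_small[of 1] by auto
  have l: "0 \<le> ln (C0 / r)" using C0(2) r by (intro ln_ge_zero) (auto simp: field_simps)
  show ?thesis
  proof (intro exI[of _ "ln (C0 / r) * R 0 + 1"] conjI ballI)
    fix \<rho> a assume "\<rho> \<in> adm" "a \<in> {0..k}"
    then show "\<bar>pot \<rho> a\<bar> \<le> ln (C0 / r) * R 0 + 1"
      using pot_diff[of \<rho> a r 1] pot_reg_bounds[of \<rho> a r] r by force
  qed (use l R_pos in auto)
qed

text \<open>\<open>Lop\<close> carries a factor 1/pi and enters the functional with weight 1/2;
  hence \<open>2 * pi\<close>.\<close>

definition energy :: "(real \<Rightarrow> real) \<Rightarrow> (real \<Rightarrow> real) \<Rightarrow> real" where
  "energy V \<rho> = (\<integral>a. (V a + pot \<rho> a / (2 * pi)) \<partial>\<nu> \<rho>)"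

definition energy_reg :: "real \<Rightarrow> (real \<Rightarrow> real) \<Rightarrow> (real \<Rightarrow> real) \<Rightarrow> real" where
  "energy_reg r V \<rho> = (\<integral>a. (V a + pot_reg r \<rho> a / (2 * pi)) \<partial>\<nu> \<rho>)"

lemma integrable_V: "\<rho> \<in> adm \<Longrightarrow> continuous_on {0..k} V \<Longrightarrow> integrable (\<nu> \<rho>) (V :: real \<Rightarrow> real)"
proof -
  assume *: "\<rho> \<in> adm" "continuous_on {0..k} V"
  then have "bounded (V ` {0..k})" by (intro compact_imp_bounded compact_continuous_image) auto
  then obtain B where "\<And>a. a \<in> {0..k} \<Longrightarrow> \<bar>V a\<bar> \<le> B" unfolding bounded_iff real_norm_def by blast
  then show ?thesis using * by (intro integrable_bdd cont_L) auto
qed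

lemma integrable_pot: "\<rho> \<in> adm \<Longrightarrow> integrable (\<nu> \<rho>) (pot \<rho>)"
  using pot_bounded by (metis integrable_bdd pot_meas)

lemma integrable_pot_reg: "\<rho> \<in> adm \<Longrightarrow> 0 < r \<Longrightarrow> r \<le> 1 \<Longrightarrow> integrable (\<nu> \<rho>) (pot_reg r \<rho>)"
  using pot_reg_bounds[of \<rho> _ r] by (intro integrable_bdd[where B="ln (C0 / r) * R 0"] pot_reg_meas) auto

lemma energy_energy_reg:
  assumes "\<rho> \<in> adm" "continuous_on {0..k} V" and r: "0 < r" "r \<le> 1"
    and e: "\<And>a. a \<in> {0..k} \<Longrightarrow> (\<integral>\<^sup>+b. ennreal (sing r a b) \<partial>\<mu>) \<le> ennreal e" "0 \<le> e"
  shows "\<bar>energy V \<rho> - energy_reg r V \<rho>\<bar> \<le> e * R 0"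
proof -
  interpret finite_measure "\<nu> \<rho>" by (rule fin_\<nu>[OF assms(1)])
  note i = integrable_V[OF assms(1,2)] integrable_pot[OF assms(1)] integrable_pot_reg[OF assms(1) r]
  have "energy V \<rho> - energy_reg r V \<rho> = (\<integral>a. (pot \<rho> a - pot_reg r \<rho> a) / (2 * pi) \<partial>\<nu> \<rho>)"
    unfolding energy_def energy_reg_def using i by (simp add: diff_divide_distrib)
  moreover have "0 \<le> (\<integral>a. (pot \<rho> a - pot_reg r \<rho> a) / (2 * pi) \<partial>\<nu> \<rho>)"
    using pot_diff(1)[OF assms(1) _ r e] by (intro Bochner_Integration.integral_nonneg) auto
  moreover have "(\<integral>a. (pot \<rho> a - pot_reg r \<rho> a) / (2 * pi) \<partial>\<nu> \<rho>) \<le> (\<integral>a. e \<partial>\<nu> \<rho>)"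
  proof (rule integral_mono)
    fix a assume "a \<in> space (\<nu> \<rho>)"
    then have "pot \<rho> a - pot_reg r \<rho> a \<le> e" "0 \<le> pot \<rho> a - pot_reg r \<rho> a"
      using pot_diff[OF assms(1) _ r e, of a] by auto
    then have "(pot \<rho> a - pot_reg r \<rho> a) / (2 * pi) \<le> (pot \<rho> a - pot_reg r \<rho> a) / 1"
      using pi_gt3 by (intro divide_left_mono) auto
    then show "(pot \<rho> a - pot_reg r \<rho> a) / (2 * pi) \<le> e" using \<open>pot \<rho> a - pot_reg r \<rho> a \<le> e\<close> by simp
  qed (use i in auto)
  moreover have "(\<integral>a. e \<partial>\<nu> \<rho>) \<le> e * R 0"
    using measure_\<nu>_space[OF assms(1)] e(2) by (simp add: mult.commute mult_left_mono)
  ultimately show ?thesis by linarith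
qed

end

section \<open>Cells of equal mass\<close>

lemma sum_indicator_disjoint:
  fixes v :: "'i \<Rightarrow> real"
  assumes "finite T" "disjoint_family_on A T" "l \<in> T" "b \<in> A l"
  shows "(\<Sum>i\<in>T. indicator (A i) b * v i) = v l"
proof -
  have "(\<Sum>i\<in>T. indicator (A i) b * v i) = (\<Sum>i\<in>T. if i = l then v i else 0)"
    using assms by (intro sum.cong) (auto simp: disjoint_family_on_def indicator_def)
  then show ?thesis using assms by simp
qed

context weyl_gas begin

lemma R_surj:
  assumes "0 \<le> y" "y \<le> R 0"
  obtains a where "a \<in> {0..k}" "R a = y"
  using IVT2'[of R k y 0] assms R_end R_cont k_pos by auto

lemma R_inj: "a \<in> {0..k} \<Longrightarrow> b \<in> {0..k} \<Longrightarrow> R a = R b \<longleftrightarrow> a = b"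
  using R_strict[of a b] R_strict[of b a] by (cases a b rule: linorder_cases) auto

lemma R_less_iff: "a \<in> {0..k} \<Longrightarrow> b \<in> {0..k} \<Longrightarrow> R a < R b \<longleftrightarrow> b < a"
  using R_strict[of a b] R_strict[of b a] by (cases a b rule: linorder_cases) auto

lemma R_le_iff: "a \<in> {0..k} \<Longrightarrow> b \<in> {0..k} \<Longrightarrow> R a \<le> R b \<longleftrightarrow> b \<le> a"
  using R_less_iff[of b a] by auto

text \<open>The inverse of an injective continuous function on a compact interval is uniformly
  continuous. Hence small mass forces small length, also where the derivative of \<open>R\<close>
  vanishes.\<close>

lemma R_inverse_cont:
  assumes "0 < \<tau>"
  obtains \<eta> where "0 < \<eta>"
    "\<And>a b. a \<in> {0..k} \<Longrightarrow> b \<in> {0..k} \<Longrightarrow> \<bar>R a - R b\<bar> < \<eta> \<Longrightarrow> \<bar>a - b\<bar> < \<tau>"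
proof -
  define J where "J = inv_into {0..k} R"
  have JR: "J (R a) = a" if "a \<in> {0..k}" for a
    unfolding J_def by (rule inv_into_f_f) (use that R_inj in \<open>auto simp: inj_on_def\<close>)
  have "continuous_on (R ` {0..k}) J"
    by (rule continuous_on_inv[OF R_cont]) (use JR in auto)
  then have "uniformly_continuous_on (R ` {0..k}) J"
    by (rule compact_uniformly_continuous) (intro compact_continuous_image R_cont, auto)
  then obtain \<eta> where "0 < \<eta>" and \<eta>: "\<And>x y. x \<in> R ` {0..k} \<Longrightarrow> y \<in> R ` {0..k} \<Longrightarrow> dist y x < \<eta> \<Longrightarrow> dist (J y) (J x) < \<tau>"
    using assms unfolding uniformly_continuous_on_def by metis
  show thesis
  proof (rule that[OF \<open>0 < \<eta>\<close>])
    fix a b assume ab: "a \<in> {0..k}" "b \<in> {0..k}" "\<bar>R a - R b\<bar> < \<eta>"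
    then show "\<bar>a - b\<bar> < \<tau>"
      using \<eta>[of "R b" "R a"] JR[of a] JR[of b] by (auto simp: dist_real_def)
  qed
qed

text \<open>\<open>mesh N\<close> equals pi times \<open>epsN\<close> and is the mass of one cell;
  with it \<open>node N n\<close> is \<open>kappaN\<close>.\<close>

definition mesh :: "nat \<Rightarrow> real" where "mesh N = R 0 / real N"
definition node :: "nat \<Rightarrow> nat \<Rightarrow> real" where
  "node N n = (THE a. a \<in> {0..k} \<and> R a = mesh N * (real n - 1 / 2))"
definition ridx :: "nat \<Rightarrow> real \<Rightarrow> real" where "ridx N a = R a / mesh N"
text \<open>\<open>ridx\<close> counts cells downwards, from N at 0 to 0 at \<open>k\<close>. The
  half-open choice leaves \<open>k\<close>, a null set, in no cell; the node has index n - 1/2 and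
  halves the mass of its cell.\<close>

definition cell :: "nat \<Rightarrow> nat \<Rightarrow> real set" where
  "cell N n = {a \<in> {0..k}. real n - 1 < ridx N a \<and> ridx N a \<le> real n}"

lemma mesh_pos: "1 \<le> N \<Longrightarrow> 0 < mesh N" using R_pos by (simp add: mesh_def)

lemma node:
  assumes "n \<in> {1..N}"
  shows "node N n \<in> {0..k}" "R (node N n) = mesh N * (real n - 1 / 2)"
    "ridx N (node N n) = real n - 1 / 2" "0 < node N n"
proof -
  have N: "1 \<le> N" using assms by auto
  have h: "0 < mesh N" "mesh N * real N = R 0" using mesh_pos[OF N] N by (auto simp: mesh_def)
  have 1: "0 \<le> mesh N * (real n - 1 / 2)" using h assms by (intro mult_nonneg_nonneg) auto
  have 2: "mesh N * (real n - 1 / 2) < mesh N * real N" using h assms by (intro mult_strict_left_mono) auto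
  then obtain a where a: "a \<in> {0..k}" "R a = mesh N * (real n - 1 / 2)"
    using R_surj[OF 1] h by auto
  have "node N n = a" unfolding node_def
    by (rule the_equality) (use a R_inj[of _ a] in auto)
  then show *: "node N n \<in> {0..k}" "R (node N n) = mesh N * (real n - 1 / 2)" using a by auto
  show "ridx N (node N n) = real n - 1 / 2" using *(2) h by (simp add: ridx_def)
  show "0 < node N n" using R_less_iff[of "node N n" 0] * 2 h k_pos by auto
qed

lemma ridx_bounds: "1 \<le> N \<Longrightarrow> a \<in> {0..k} \<Longrightarrow> 0 \<le> ridx N a \<and> ridx N a \<le> real N"
  using R_mono[of 0 a] R_mono[of a k] R_end mesh_pos[of N] R_pos
  by (auto simp: ridx_def mesh_def field_simps intro: mult_right_mono)

lemma ridx_le_iff: "1 \<le> N \<Longrightarrow> a \<in> {0..k} \<Longrightarrow> b \<in> {0..k} \<Longrightarrow> ridx N a \<le> ridx N b \<longleftrightarrow> b \<le> a"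
  using R_le_iff[of a b] mesh_pos[of N] by (simp add: ridx_def divide_le_cancel)

lemma ridx_meas[measurable]: "ridx N \<in> borel_measurable L"
  unfolding ridx_def[abs_def] using cont_L[OF R_cont] by measurable

lemma cell_meas[measurable]: "cell N n \<in> sets L"
proof -
  have "cell N n = {a \<in> space L. real n - 1 < ridx N a \<and> ridx N a \<le> real n}" by (simp add: cell_def)
  also have "\<dots> \<in> sets L" by measurable
  finally show ?thesis .
qed

lemma cell_sub: "cell N n \<subseteq> {0..k}" by (auto simp: cell_def)

lemma cell_disjoint: "disjoint_family_on (cell N) T"
  by (auto simp: disjoint_family_on_def cell_def)

lemma cell_cover:
  assumes "1 \<le> N" "a \<in> {0..k}" "a \<noteq> k"
  obtains n where "n \<in> {1..N}" "a \<in> cell N n"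
proof -
  have 0: "0 < ridx N a" using R_strict[of a k] assms R_end mesh_pos[of N] by (auto simp: ridx_def)
  define n where "n = nat \<lceil>ridx N a\<rceil>"
  have "real n - 1 < ridx N a" "ridx N a \<le> real n" "1 \<le> n" "n \<le> N"
    unfolding n_def using 0 ridx_bounds[OF assms(1,2)] by linarith+
  then show thesis using that assms by (auto simp: cell_def)
qed

text \<open>Points are null, so either end may be left out. Both versions are used: the cells are
  open below in \<open>ridx\<close>, and the intervals between nodes must exclude the end nearer to
  a given node, from whichever side.\<close>

lemma measure_\<mu>_level:
  assumes "1 \<le> N" "0 \<le> s" "s \<le> t" "t \<le> real N"
  shows "measure \<mu> {a \<in> {0..k}. s < ridx N a \<and> ridx N a \<le> t} = mesh N * (t - s)"
    "measure \<mu> {a \<in> {0..k}. s \<le> ridx N a \<and> ridx N a < t} = mesh N * (t - s)"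
proof -
  have h: "0 < mesh N" "mesh N * real N = R 0" using mesh_pos assms(1) by (auto simp: mesh_def)
  have "mesh N * t \<le> mesh N * real N" using assms h by (intro mult_left_mono) auto
  then obtain a where a: "a \<in> {0..k}" "R a = mesh N * t" using R_surj[of "mesh N * t"] assms h by auto
  have "mesh N * s \<le> mesh N * real N" using assms h by (intro mult_left_mono) auto
  then obtain b where b: "b \<in> {0..k}" "R b = mesh N * s" using R_surj[of "mesh N * s"] assms h by auto
  have ya: "ridx N a = t" "ridx N b = s" using a b h by (auto simp: ridx_def)
  have ab: "a \<le> b" using ridx_le_iff[OF assms(1), of b a] a b ya assms by simp
  interpret finite_measure \<mu> by (rule fin_\<mu>)
  have pt: "measure \<mu> {x} = 0" if "x \<in> {0..k}" for x
    using measure_\<mu>_Icc[of x x] that by simp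
  have s[measurable]: "{a..b} \<in> sets L" "{a} \<in> sets L" "{b} \<in> sets L" using a b by (auto intro!: L_sets)
  have m: "measure \<mu> {a..b} = mesh N * (t - s)"
    using measure_\<mu>_Icc[of a b] a b ab by (simp add: algebra_simps)
  have "{x \<in> {0..k}. s < ridx N x \<and> ridx N x \<le> t} = {a..b} - {b}"
    using ridx_le_iff[OF assms(1)] a(1) b(1) unfolding ya[symmetric] less_le_not_le by auto
  then show "measure \<mu> {a \<in> {0..k}. s < ridx N a \<and> ridx N a \<le> t} = mesh N * (t - s)"
    using finite_measure_Diff[of "{a..b}" "{b}"] pt[OF b(1)] m ab by simp
  have "{x \<in> {0..k}. s \<le> ridx N x \<and> ridx N x < t} = {a..b} - {a}"
    using ridx_le_iff[OF assms(1)] a(1) b(1) unfolding ya[symmetric] less_le_not_le by auto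
  then show "measure \<mu> {a \<in> {0..k}. s \<le> ridx N a \<and> ridx N a < t} = mesh N * (t - s)"
    using finite_measure_Diff[of "{a..b}" "{a}"] pt[OF a(1)] m ab by simp
qed

lemma measure_\<mu>_cell: "n \<in> {1..N} \<Longrightarrow> measure \<mu> (cell N n) = mesh N"
  using measure_\<mu>_level(1)[of N "real n - 1" "real n"] by (auto simp: cell_def)

definition fine_mesh :: "real \<Rightarrow> nat \<Rightarrow> bool" where
  "fine_mesh \<tau> N \<longleftrightarrow> 1 \<le> N \<and> (\<forall>n\<in>{1..N}. \<forall>a\<in>cell N n. \<bar>a - node N n\<bar> < \<tau>)"

lemma mesh_tendsto: "mesh \<longlonglongrightarrow> 0"
  unfolding mesh_def by (rule lim_const_over_n)

lemma eventually_fine: "0 < \<tau> \<Longrightarrow> eventually (fine_mesh \<tau>) sequentially"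
proof -
  assume "0 < \<tau>"
  then obtain \<eta> where \<eta>: "0 < \<eta>"
    "\<And>a b. a \<in> {0..k} \<Longrightarrow> b \<in> {0..k} \<Longrightarrow> \<bar>R a - R b\<bar> < \<eta> \<Longrightarrow> \<bar>a - b\<bar> < \<tau>"
    using R_inverse_cont by metis
  have "\<forall>\<^sub>F N in sequentially. mesh N < \<eta>"
    using order_tendstoD(2)[OF mesh_tendsto \<eta>(1)] .
  then show ?thesis using eventually_ge_at_top[of 1]
  proof eventually_elim
    case (elim N)
    show ?case unfolding fine_mesh_def
    proof (intro conjI ballI)
      fix n a assume n: "n \<in> {1..N}" and a: "a \<in> cell N n"
      have "\<bar>ridx N a - ridx N (node N n)\<bar> < 1" using node(3)[OF n] a by (auto simp: cell_def)
      moreover have "R a = mesh N * ridx N a" "R (node N n) = mesh N * ridx N (node N n)"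
        using mesh_pos[OF elim(2)] by (auto simp: ridx_def)
      then have "\<bar>R a - R (node N n)\<bar> = mesh N * \<bar>ridx N a - ridx N (node N n)\<bar>"
        using mesh_pos[OF elim(2)] by (simp add: abs_mult flip: right_diff_distrib)
      ultimately have "\<bar>R a - R (node N n)\<bar> < mesh N * 1"
        using mesh_pos[OF elim(2)] by (metis mult_strict_left_mono)
      then show "\<bar>a - node N n\<bar> < \<tau>" using \<eta>(2)[of a "node N n"] elim node(1)[OF n] a by (auto simp: cell_def)
    qed (use elim in auto)
  qed
qed

section \<open>Cell sums: the energy as a function of finitely many masses\<close>

lemma cell_sum:
  assumes "\<rho> \<in> adm" "1 \<le> N" "integrable (\<nu> \<rho>) \<phi>"
    and "\<And>n a. n \<in> {1..N} \<Longrightarrow> a \<in> cell N n \<Longrightarrow> \<bar>\<phi> a - c n\<bar> \<le> \<omega>" "0 \<le> \<omega>"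
  shows "\<bar>(\<integral>a. \<phi> a \<partial>\<nu> \<rho>) - (\<Sum>n\<in>{1..N}. c n * measure (\<nu> \<rho>) (cell N n))\<bar> \<le> \<omega> * R 0"
proof -
  interpret finite_measure "\<nu> \<rho>" by (rule fin_\<nu>[OF assms(1)])
  define s where "s a = (\<Sum>n\<in>{1..N}. indicator (cell N n) a * c n)" for a
  have i: "integrable (\<nu> \<rho>) (\<lambda>a. indicator (cell N n) a * c n)" for n
    by (intro integrable_mult_left impI integrable_real_indicator) (auto simp: less_top[symmetric])
  have ints: "integrable (\<nu> \<rho>) s" unfolding s_def[abs_def] by (intro Bochner_Integration.integrable_sum i)
  have "(\<integral>a. s a \<partial>\<nu> \<rho>) = (\<Sum>n\<in>{1..N}. \<integral>a. indicator (cell N n) a * c n \<partial>\<nu> \<rho>)"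
    unfolding s_def by (rule Bochner_Integration.integral_sum) (rule i)
  also have "\<dots> = (\<Sum>n\<in>{1..N}. c n * measure (\<nu> \<rho>) (cell N n))"
    using cell_sub by (intro sum.cong) (auto simp: Int_absorb2)
  finally have eq: "(\<integral>a. s a \<partial>\<nu> \<rho>) = \<dots>" .
  have "\<bar>(\<integral>a. \<phi> a \<partial>\<nu> \<rho>) - (\<integral>a. s a \<partial>\<nu> \<rho>)\<bar> = \<bar>\<integral>a. \<phi> a - s a \<partial>\<nu> \<rho>\<bar>"
    using assms(3) ints by simp
  also have "\<dots> \<le> (\<integral>a. \<bar>\<phi> a - s a\<bar> \<partial>\<nu> \<rho>)" by (rule integral_abs_bound)
  also have "\<dots> \<le> (\<integral>a. \<omega> \<partial>\<nu> \<rho>)"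
  proof (rule integral_mono_AE)
    show "AE a in \<nu> \<rho>. \<bar>\<phi> a - s a\<bar> \<le> \<omega>"
      using AE_\<nu>[OF assms(1) AE_L_neq[of k]] AE_\<nu>[OF assms(1) AE_L_I]
    proof eventually_elim
      case (elim a)
      obtain n where n: "n \<in> {1..N}" "a \<in> cell N n" using cell_cover[OF assms(2), of a] elim by auto
      then have "s a = c n" unfolding s_def by (intro sum_indicator_disjoint cell_disjoint) auto
      then show ?case using assms(4) n by simp
    qed
  qed (use assms(3) ints in auto)
  also have "\<dots> \<le> \<omega> * R 0"
    using measure_\<nu>_space[OF assms(1)] assms(5) by (simp add: mult.commute mult_left_mono)
  finally show ?thesis by (simp add: eq)
qed

text \<open>The regularized energy with every cell collapsed to its node, diagonal included.
  Continuum and discrete energies are compared only through this quadratic function of the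
  masses.\<close>

definition cell_energy :: "real \<Rightarrow> nat \<Rightarrow> (real \<Rightarrow> real) \<Rightarrow> (nat \<Rightarrow> real) \<Rightarrow> real" where
  "cell_energy r N V m = (\<Sum>n\<in>{1..N}. V (node N n) * m n)
     + (\<Sum>n\<in>{1..N}. \<Sum>l\<in>{1..N}. g_reg r (node N n) (node N l) * m l * m n) / (2 * pi)"

definition mass :: "(real \<Rightarrow> real) \<Rightarrow> nat \<Rightarrow> nat \<Rightarrow> real" where
  "mass \<rho> N n = measure (\<nu> \<rho>) (cell N n)"

text \<open>The cell sum is applied twice: to the inner potential, with error
  \<open>\<omega> * R 0\<close>, and to the outer integral, whose integrand is then off by
  \<open>\<omega> + \<omega> * R 0\<close>.\<close>

lemma energy_reg_cell_energy:
  assumes "\<rho> \<in> adm" "fine_mesh \<tau> N" "continuous_on {0..k} V" "0 < r" "r \<le> 1" "0 \<le> \<omega>"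
    and V: "\<And>a b. a \<in> {0..k} \<Longrightarrow> b \<in> {0..k} \<Longrightarrow> \<bar>a - b\<bar> < \<tau> \<Longrightarrow> \<bar>V a - V b\<bar> \<le> \<omega>"
    and g_reg: "\<And>a b c d. a \<in> {0..k} \<Longrightarrow> b \<in> {0..k} \<Longrightarrow> c \<in> {0..k} \<Longrightarrow> d \<in> {0..k} \<Longrightarrow>
       \<bar>a - c\<bar> < \<tau> \<Longrightarrow> \<bar>b - d\<bar> < \<tau> \<Longrightarrow> \<bar>g_reg r a b - g_reg r c d\<bar> \<le> \<omega>"
  shows "\<bar>energy_reg r V \<rho> - cell_energy r N V (mass \<rho> N)\<bar> \<le> (\<omega> + \<omega> * R 0) * R 0"
proof -
  have N: "1 \<le> N" using assms(2) by (simp add: fine_mesh_def)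
  note f = assms(2)[unfolded fine_mesh_def, THEN conjunct2, rule_format]
  define c where "c n = V (node N n) + (\<Sum>l\<in>{1..N}. g_reg r (node N n) (node N l) * mass \<rho> N l) / (2 * pi)" for n
  have "\<bar>energy_reg r V \<rho> - (\<Sum>n\<in>{1..N}. c n * measure (\<nu> \<rho>) (cell N n))\<bar> \<le> (\<omega> + \<omega> * R 0) * R 0"
    unfolding energy_reg_def
  proof (rule cell_sum[OF assms(1) N])
    show "integrable (\<nu> \<rho>) (\<lambda>a. V a + pot_reg r \<rho> a / (2 * pi))"
      using integrable_V[OF assms(1,3)] integrable_pot_reg[OF assms(1,4,5)] by auto
    fix n a assume n: "n \<in> {1..N}" and a: "a \<in> cell N n"
    have aI: "a \<in> {0..k}" using a cell_sub[of N n] by auto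
    have "\<bar>pot_reg r \<rho> a - (\<Sum>l\<in>{1..N}. g_reg r (node N n) (node N l) * mass \<rho> N l)\<bar> \<le> \<omega> * R 0"
      unfolding pot_reg_def mass_def
    proof (rule cell_sum[OF assms(1) N])
      show "integrable (\<nu> \<rho>) (g_reg r a)" by (rule integrable_g_reg) (use assms aI in auto)
      fix l b assume l: "l \<in> {1..N}" and b: "b \<in> cell N l"
      show "\<bar>g_reg r a b - g_reg r (node N n) (node N l)\<bar> \<le> \<omega>"
        using f[OF n a] f[OF l b] node(1)[OF n] node(1)[OF l] aI b cell_sub[of N l] by (intro g_reg) auto
    qed (rule assms)
    then have "\<bar>(pot_reg r \<rho> a - (\<Sum>l\<in>{1..N}. g_reg r (node N n) (node N l) * mass \<rho> N l)) / (2 * pi)\<bar> \<le> \<omega> * R 0 / 1"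
      unfolding abs_divide using pi_gt3 by (intro frac_le) auto
    moreover have "\<bar>V a - V (node N n)\<bar> \<le> \<omega>" using f[OF n a] node(1)[OF n] aI by (intro V) auto
    moreover have "V a + pot_reg r \<rho> a / (2 * pi) - c n = (V a - V (node N n)) +
       (pot_reg r \<rho> a - (\<Sum>l\<in>{1..N}. g_reg r (node N n) (node N l) * mass \<rho> N l)) / (2 * pi)"
      by (simp add: c_def diff_divide_distrib)
    ultimately show "\<bar>V a + pot_reg r \<rho> a / (2 * pi) - c n\<bar> \<le> \<omega> + \<omega> * R 0"
      by (simp only: div_by_1)
  qed (use assms R_pos in auto)
  moreover have "(\<Sum>n\<in>{1..N}. c n * measure (\<nu> \<rho>) (cell N n)) = cell_energy r N V (mass \<rho> N)"
    by (simp add: cell_energy_def c_def mass_def[symmetric] distrib_right sum.distrib sum_divide_distrib sum_distrib_right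
        flip: times_divide_eq_left)
  ultimately show ?thesis by simp
qed

text \<open>In units of e: \<open>(1 + R 0) * R 0\<close> from the two cell sums and
  \<open>R 0\<close> from the regularization of the kernel.\<close>

definition err_const :: real where "err_const = (2 + R 0) * R 0"

text \<open>Stated with explicit \<open>\<tau>\<close> and \<open>e\<close>, so that one pair can
  serve a whole family of external fields.\<close>

definition equi :: "real \<Rightarrow> real \<Rightarrow> (real \<Rightarrow> real) \<Rightarrow> bool" where
  "equi \<tau> e V \<longleftrightarrow> continuous_on {0..k} V \<and> (\<forall>a\<in>{0..k}. \<forall>b\<in>{0..k}. \<bar>a - b\<bar> < \<tau> \<longrightarrow> \<bar>V a - V b\<bar> \<le> e)"

text \<open>\<open>r\<close> and \<open>\<tau>\<close> come from the kernel and \<open>e\<close>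
  alone, before \<open>V\<close>, \<open>\<rho>\<close> and \<open>N\<close> are chosen;
  \<open>\<tau>'\<close> leaves room to shrink to the modulus of continuity of
  \<open>V\<close>.\<close>

lemma energy_cell_energy:
  assumes "0 < e"
  obtains r \<tau> where "0 < r" "r \<le> 1" "0 < \<tau>"
    "\<And>a. a \<in> {0..k} \<Longrightarrow> (\<integral>\<^sup>+b. ennreal (sing r a b) \<partial>\<mu>) \<le> ennreal e"
    "\<And>V \<rho> N \<tau>'. \<tau>' \<le> \<tau> \<Longrightarrow> equi \<tau>' e V \<Longrightarrow> \<rho> \<in> adm \<Longrightarrow> fine_mesh \<tau>' N \<Longrightarrow> \<bar>energy V \<rho> - cell_energy r N V (mass \<rho> N)\<bar> \<le> e * err_const"
proof -
  obtain r where r: "0 < r" "r \<le> 1" "\<And>a. a \<in> {0..k} \<Longrightarrow> (\<integral>\<^sup>+b. ennreal (sing r a b) \<partial>\<mu>) \<le> ennreal e"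
    using log_small[OF assms] by metis
  have "uniformly_continuous_on ({0..k} \<times> {0..k}) (\<lambda>p. g_reg r (fst p) (snd p))"
    by (intro compact_uniformly_continuous g_reg_cont r compact_Times) auto
  then obtain d where d: "0 < d" "\<And>p q. p \<in> {0..k} \<times> {0..k} \<Longrightarrow> q \<in> {0..k} \<times> {0..k} \<Longrightarrow> dist q p < d \<Longrightarrow>
     dist (g_reg r (fst q) (snd q)) (g_reg r (fst p) (snd p)) < e"
    using assms unfolding uniformly_continuous_on_def by metis
  show thesis
  proof (rule that[OF r(1,2) _ r(3)])
    \<comment> \<open>Half, because both coordinates contribute to the distance in the
      product.\<close>
    show "0 < d / 2" using d by simp
    fix V \<rho> N \<tau>' assume \<tau>': "\<tau>' \<le> d / 2" and V: "equi \<tau>' e V" and \<rho>: "\<rho> \<in> adm" and N: "fine_mesh \<tau>' N"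
    have cV: "continuous_on {0..k} V" using V by (simp add: equi_def)
    have "\<bar>energy_reg r V \<rho> - cell_energy r N V (mass \<rho> N)\<bar> \<le> (e + e * R 0) * R 0"
    proof (rule energy_reg_cell_energy[OF \<rho> N cV r(1,2)])
      fix a b c d' assume *: "a \<in> {0..k}" "b \<in> {0..k}" "c \<in> {0..k}" "d' \<in> {0..k}"
         "\<bar>a - c\<bar> < \<tau>'" "\<bar>b - d'\<bar> < \<tau>'"
      have "dist (a, b) (c, d') \<le> \<bar>a - c\<bar> + \<bar>b - d'\<bar>"
        unfolding dist_Pair_Pair by (rule order_trans[OF sqrt_sum_squares_le_sum_abs]) (simp add: dist_real_def)
      then show "\<bar>g_reg r a b - g_reg r c d'\<bar> \<le> e"
        using d(2)[of "(c, d')" "(a, b)"] * \<tau>' by (auto simp: dist_real_def)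
    qed (use assms V in \<open>auto simp: equi_def\<close>)
    moreover have "\<bar>energy V \<rho> - energy_reg r V \<rho>\<bar> \<le> e * R 0"
      using energy_energy_reg[OF \<rho> cV r(1,2) r(3)] assms by simp
    ultimately show "\<bar>energy V \<rho> - cell_energy r N V (mass \<rho> N)\<bar> \<le> e * err_const"
      unfolding err_const_def by (simp add: algebra_simps)
  qed
qed

end

section \<open>Comparison with the discrete energy\<close>

definition multiaffine :: "((nat \<Rightarrow> real) \<Rightarrow> real) \<Rightarrow> bool" where
  "multiaffine P \<longleftrightarrow> (\<forall>c n. P c = (1 - c n) * P (c(n := 0)) + c n * P (c(n := 1)))"

text \<open>In one coordinate the value is a convex combination of the values at 0 and 1, so one of
  these is no larger. The coordinates in \<open>U\<close> are rounded in turn; keeping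
  \<open>c\<close> outside \<open>U\<close> makes the induction go through.\<close>

lemma multiaffine_vertex:
  assumes P: "multiaffine P" and "finite U" "\<And>n. n \<in> U \<Longrightarrow> 0 \<le> c n \<and> c n \<le> 1"
  shows "\<exists>S\<subseteq>U. P (\<lambda>n. if n \<in> U then of_bool (n \<in> S) else c n) \<le> P c"
  using assms(2,3)
proof (induction U arbitrary: c)
  case empty
  then show ?case by simp
next
  case (insert m U)
  have t: "0 \<le> c m" "c m \<le> 1" using insert.prems by auto
  have "P c = (1 - c m) * P (c(m := 0)) + c m * P (c(m := 1))"
    using P by (auto simp: multiaffine_def)
  moreover have "min (P (c(m := 0))) (P (c(m := 1))) * (1 - c m) + min (P (c(m := 0))) (P (c(m := 1))) * c m
     \<le> P (c(m := 0)) * (1 - c m) + P (c(m := 1)) * c m"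
    using t by (intro add_mono mult_right_mono) auto
  ultimately have "min (P (c(m := 0))) (P (c(m := 1))) \<le> P c" by (simp add: algebra_simps)
  then have "P (c(m := 0)) \<le> P c \<or> P (c(m := 1)) \<le> P c" by (auto simp: min_def split: if_splits)
  then have "\<exists>v::bool. P (c(m := of_bool v)) \<le> P c"
  proof
    assume "P (c(m := 0)) \<le> P c"
    then show ?thesis by (intro exI[of _ False]) simp
  next
    assume "P (c(m := 1)) \<le> P c"
    then show ?thesis by (intro exI[of _ True]) simp
  qed
  then obtain v :: bool where v: "P (c(m := of_bool v)) \<le> P c" ..
  have "\<exists>S\<subseteq>U. P (\<lambda>n. if n \<in> U then of_bool (n \<in> S) else (c(m := of_bool v)) n) \<le> P (c(m := of_bool v))"
    by (rule insert.IH) (use insert.prems in auto)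
  then obtain S where S: "S \<subseteq> U" "P (\<lambda>n. if n \<in> U then of_bool (n \<in> S) else (c(m := of_bool v)) n) \<le> P (c(m := of_bool v))"
    by (elim exE conjE) (rule that)
  define S' where "S' = (if v then insert m S else S)"
  have "(\<lambda>n. if n \<in> U then of_bool (n \<in> S) else (c(m := of_bool v)) n) =
        (\<lambda>n. if n \<in> insert m U then of_bool (n \<in> S') else c n)"
    using insert.hyps S(1) by (auto simp: S'_def fun_eq_iff)
  with S(2) v have "P (\<lambda>n. if n \<in> insert m U then of_bool (n \<in> S') else c n) \<le> P c" by simp
  moreover have "S' \<subseteq> insert m U" using S(1) by (auto simp: S'_def)
  ultimately show ?case by (intro exI[of _ S'] conjI)
qed

lemma multiaffine_sum: "(\<And>i. i \<in> A \<Longrightarrow> multiaffine (P i)) \<Longrightarrow> multiaffine (\<lambda>c. \<Sum>i\<in>A. P i c)"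
proof -
  assume *: "\<And>i. i \<in> A \<Longrightarrow> multiaffine (P i)"
  show ?thesis unfolding multiaffine_def
  proof (intro allI)
    fix c n
    have "(\<Sum>i\<in>A. P i c) = (\<Sum>i\<in>A. (1 - c n) * P i (c(n := 0)) + c n * P i (c(n := 1)))"
      using * by (intro sum.cong) (auto simp: multiaffine_def)
    then show "(\<Sum>i\<in>A. P i c) = (1 - c n) * (\<Sum>i\<in>A. P i (c(n := 0))) + c n * (\<Sum>i\<in>A. P i (c(n := 1)))"
      by (simp add: sum.distrib sum_distrib_left)
  qed
qed

lemma multiaffine_add:
  assumes "multiaffine P" "multiaffine Q"
  shows "multiaffine (\<lambda>c. P c + Q c)"
  unfolding multiaffine_def
proof (intro allI)
  fix c n
  have "P c = (1 - c n) * P (c(n := 0)) + c n * P (c(n := 1))"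
    "Q c = (1 - c n) * Q (c(n := 0)) + c n * Q (c(n := 1))"
    using assms unfolding multiaffine_def by blast+
  then show "P c + Q c = (1 - c n) * (P (c(n := 0)) + Q (c(n := 0))) + c n * (P (c(n := 1)) + Q (c(n := 1)))"
    by (simp only: distrib_left add_ac)
qed

lemma multiaffine_cmult:
  assumes "multiaffine P"
  shows "multiaffine (\<lambda>c. a * P c)"
  unfolding multiaffine_def
proof (intro allI)
  fix c n
  have "P c = (1 - c n) * P (c(n := 0)) + c n * P (c(n := 1))"
    using assms unfolding multiaffine_def by blast
  then show "a * P c = (1 - c n) * (a * P (c(n := 0))) + c n * (a * P (c(n := 1)))"
    by (simp only: distrib_left mult_ac)
qed

lemma multiaffine_proj: "multiaffine (\<lambda>c. c m)"
  by (auto simp: multiaffine_def algebra_simps)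

text \<open>For \<open>m = l\<close> the product would be quadratic; this forces the separate
  treatment of the diagonal in \<open>relaxed\<close>.\<close>

lemma multiaffine_prod: "m \<noteq> l \<Longrightarrow> multiaffine (\<lambda>c. c m * c l)"
  by (auto simp: multiaffine_def algebra_simps)

context weyl_gas begin

text \<open>The singularity is monotone in the distance, so its value at a node is bounded by its average over the
  interval \<open>Q l\<close> of the same mass on the side of the node \<open>n\<close>.\<close>

lemma discrete_log_bound:
  assumes "n \<in> {1..N}" "r \<le> 1" "(\<integral>\<^sup>+b. ennreal (sing r (node N n) b) \<partial>\<mu>) \<le> ennreal e" "0 \<le> e"
  shows "(\<Sum>l\<in>{1..N} - {n}. sing r (node N n) (node N l) * mesh N) \<le> e"
proof -
  have N: "1 \<le> N" using assms by auto
  \<comment> \<open>The node \<open>l\<close> has index l - 1/2. \<open>Q l\<close> extends one unit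
    from there towards n - 1/2, containing the end at node \<open>l\<close> but not the other one,
    which may be the node \<open>n\<close> itself.\<close>
  define Q where "Q l = (if l < n then {b \<in> {0..k}. real l - 1/2 \<le> ridx N b \<and> ridx N b < real l + 1/2}
     else {b \<in> {0..k}. real l - 3/2 < ridx N b \<and> ridx N b \<le> real l - 1/2})" for l
  have Q_meas[measurable]: "Q l \<in> sets L" for l
  proof -
    have "{b \<in> space L. real l - 1/2 \<le> ridx N b \<and> ridx N b < real l + 1/2} \<in> sets L"
      "{b \<in> space L. real l - 3/2 < ridx N b \<and> ridx N b \<le> real l - 1/2} \<in> sets L" by measurable
    then show ?thesis by (simp add: Q_def)
  qed
  have mQ: "measure \<mu> (Q l) = mesh N" if "l \<in> {1..N} - {n}" for l
  proof (cases "l < n")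
    case True
    then have "real l + 1 \<le> real n" "real n \<le> real N" "1 \<le> real l" using that assms(1) by auto
    then show ?thesis using True measure_\<mu>_level(2)[OF N, of "real l - 1/2" "real l + 1/2"]
      by (auto simp: Q_def)
  next
    case False
    then have "real n + 1 \<le> real l" "1 \<le> real n" "real l \<le> real N" using that assms(1) by auto
    then show ?thesis using False measure_\<mu>_level(1)[OF N, of "real l - 3/2" "real l - 1/2"]
      by (auto simp: Q_def)
  qed
  have disj: "disjoint_family_on Q ({1..N} - {n})"
    unfolding disjoint_family_on_def
  proof (intro ballI impI equals0I)
    fix i j b assume ij: "i \<in> {1..N} - {n}" "j \<in> {1..N} - {n}" "i \<noteq> j" and b: "b \<in> Q i \<inter> Q j"
    show False
      using ij b by (cases "i < n"; cases "j < n") (auto simp: Q_def)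
  qed
  have le: "sing r (node N n) (node N l) \<le> sing r (node N n) b" if l: "l \<in> {1..N} - {n}" and b: "b \<in> Q l" for l b
  proof (cases "\<bar>node N n - node N l\<bar> < r")
    case True
    have ln: "l \<in> {1..N}" "l \<noteq> n" using l by auto
    have bI: "b \<in> {0..k}" using b by (auto simp: Q_def split: if_splits)
    note K = node[OF ln(1)] node[OF assms(1)]
    have "0 < \<bar>node N n - b\<bar> \<and> \<bar>node N n - b\<bar> \<le> \<bar>node N n - node N l\<bar>"
    proof (cases "l < n")
      case True
      then have ln': "real l + 1 \<le> real n" by simp
      then have y: "ridx N (node N l) \<le> ridx N b" "ridx N b < ridx N (node N n)" using b True K by (auto simp: Q_def)
      then show ?thesis using ridx_le_iff[OF N K(1) bI] ridx_le_iff[OF N K(5) bI] by auto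
    next
      case False
      then have ln': "real n + 1 \<le> real l" using ln by simp
      then have y: "ridx N b \<le> ridx N (node N l)" "ridx N (node N n) < ridx N b" using b False K by (auto simp: Q_def)
      then show ?thesis using ridx_le_iff[OF N bI K(1)] ridx_le_iff[OF N bI K(5)] by auto
    qed
    moreover have "0 < C0" using C0(2) by linarith
    ultimately have "ln (C0 / \<bar>node N n - node N l\<bar>) \<le> ln (C0 / \<bar>node N n - b\<bar>)"
      by (intro ln_mono frac_le divide_pos_pos) auto
    moreover have "\<bar>node N n - b\<bar> < r" using True \<open>0 < _ \<and> _\<close> by linarith
    ultimately show ?thesis using True by (simp add: sing_def)
  next
    case False
    then have "sing r (node N n) (node N l) = 0" by (simp add: sing_def)
    then show ?thesis using sing_nonneg[OF assms(2)] by simp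
  qed
  define s where "s b = (\<Sum>l\<in>{1..N} - {n}. indicator (Q l) b * sing r (node N n) (node N l))" for b
  interpret finite_measure \<mu> by (rule fin_\<mu>)
  have i: "integrable \<mu> (\<lambda>b. indicator (Q l) b * sing r (node N n) (node N l))" for l
    by (intro integrable_mult_left impI integrable_real_indicator) (auto simp: less_top[symmetric])
  note isk = integrable_sing[OF w_adm assms(3,2), folded \<mu>_eq]
  have Qs: "Q l \<subseteq> {0..k}" for l by (auto simp: Q_def)
  have "(\<Sum>l\<in>{1..N} - {n}. sing r (node N n) (node N l) * mesh N) = (\<Sum>l\<in>{1..N} - {n}. \<integral>b. indicator (Q l) b * sing r (node N n) (node N l) \<partial>\<mu>)"
    using mQ Qs by (intro sum.cong) (auto simp: Int_absorb2)
  also have "\<dots> = (\<integral>b. s b \<partial>\<mu>)"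
    unfolding s_def by (rule Bochner_Integration.integral_sum[symmetric]) (rule i)
  also have "\<dots> \<le> (\<integral>b. sing r (node N n) b \<partial>\<mu>)"
  proof (rule integral_mono)
    show "integrable \<mu> s" unfolding s_def[abs_def] by (intro Bochner_Integration.integrable_sum i)
    fix b
    show "s b \<le> sing r (node N n) b"
    proof (cases "\<exists>l\<in>{1..N} - {n}. b \<in> Q l")
      case True
      then obtain l where l: "l \<in> {1..N} - {n}" "b \<in> Q l" by blast
      have "s b = sing r (node N n) (node N l)"
        unfolding s_def by (rule sum_indicator_disjoint[OF _ disj l]) simp
      then show ?thesis using le[OF l] by simp
    next
      case False
      then have "s b = 0" unfolding s_def by (intro sum.neutral) auto
      then show ?thesis using sing_nonneg[OF assms(2)] by simp
    qed
  qed (rule isk)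
  also have "\<dots> \<le> e" by (rule isk(2)[OF assms(4)])
  finally show ?thesis .
qed

text \<open>A node far from 0 has a moderate logarithm. If it is close to 0, the interval from 0 to
  it has mass at least \<open>mesh N / 2\<close>, and on that interval \<open>sing r 0\<close> is at
  least \<open>ln (C0 / node N n)\<close>; the smallness of the logarithmic potential at 0 then
  bounds the product.\<close>

lemma diag_lower:
  assumes n: "n \<in> {1..N}" and r: "0 < r" "r \<le> 1" and e: "(\<integral>\<^sup>+b. ennreal (sing r 0 b) \<partial>\<mu>) \<le> ennreal e" "0 \<le> e"
    and small: "mesh N * ln (C0 / r) \<le> e"
  shows "mesh N * - ln (2 * node N n) \<le> 2 * e"
proof -
  have N: "1 \<le> N" using n by auto
  note K = node[OF n]
  have h: "0 < mesh N" "mesh N * real N = R 0" using mesh_pos N by (auto simp: mesh_def)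
  show ?thesis
  proof (cases "node N n < r")
    case False
    have "- ln (2 * node N n) = ln (1 / (2 * node N n))" using K by (simp add: ln_div)
    also have "\<dots> \<le> ln (C0 / r)" using False K r C0(2) by (intro ln_mono frac_le) auto
    finally have "mesh N * - ln (2 * node N n) \<le> mesh N * ln (C0 / r)" using h by (intro mult_left_mono) auto
    then show ?thesis using small e by simp
  next
    case True
    interpret finite_measure \<mu> by (rule fin_\<mu>)
    note isk = integrable_sing[OF w_adm e(1) r(2), folded \<mu>_eq]
    define A where "A = {0..node N n}"
    have A[measurable]: "A \<in> sets L" unfolding A_def using K by (intro L_sets) auto
    \<comment> \<open>The extreme case is n = N, with exactly half a cell between the node and
      0.\<close>
    have *: "mesh N * (real n - 1 / 2) \<le> mesh N * (real N - 1 / 2)" using h n by (intro mult_left_mono) auto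
    have mA: "mesh N / 2 \<le> measure \<mu> A"
    proof -
      have "mesh N * (real N - 1 / 2) = R 0 - mesh N / 2" using h(2) by (simp add: right_diff_distrib)
      moreover have "measure \<mu> A = R 0 - R (node N n)"
        using measure_\<mu>_Icc[of 0 "node N n"] K by (simp add: A_def)
      ultimately show ?thesis using * K(2) by linarith
    qed
    have l0: "0 \<le> ln (C0 / node N n)" using K True r C0(2) by (intro ln_ge_zero) (auto simp: field_simps)
    have "mesh N / 2 * ln (C0 / node N n) \<le> measure \<mu> A * ln (C0 / node N n)"
      by (intro mult_right_mono mA l0)
    also have "\<dots> = (\<integral>b. indicator A b * ln (C0 / node N n) \<partial>\<mu>)"
      using K by (simp add: A_def Int_absorb2)
    also have "\<dots> \<le> (\<integral>b. sing r 0 b \<partial>\<mu>)"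
    proof (rule integral_mono_AE)
      show "integrable \<mu> (\<lambda>b. indicator A b * ln (C0 / node N n))"
        by (intro integrable_mult_left impI integrable_real_indicator) (auto simp: less_top[symmetric])
      show "AE b in \<mu>. indicator A b * ln (C0 / node N n) \<le> sing r 0 b"
        using AE_\<nu>[OF w_adm AE_L_neq[of 0], folded \<mu>_eq]
      proof eventually_elim
        case (elim b)
        show ?case
        proof (cases "b \<in> A")
          case bA: True
          then have "ln (C0 / node N n) \<le> ln (C0 / b)"
            using elim C0(2) by (intro ln_mono frac_le divide_pos_pos) (auto simp: A_def)
          then show ?thesis using bA True elim by (simp add: sing_def A_def)
        qed (use sing_nonneg[OF r(2)] in simp)
      qed
    qed (rule isk)
    also have "\<dots> \<le> e" by (rule isk(2)[OF e(2)])
    finally have 1: "mesh N * ln (C0 / node N n) \<le> 2 * e" by simp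
    have "- ln (2 * node N n) = ln (1 / (2 * node N n))" using K by (simp add: ln_div)
    also have "\<dots> \<le> ln (C0 / node N n)" using K C0(2) by (intro ln_mono frac_le) auto
    finally have "mesh N * - ln (2 * node N n) \<le> mesh N * ln (C0 / node N n)" using h by (intro mult_left_mono) auto
    then show ?thesis using 1 by simp
  qed
qed

text \<open>The diagonal is |z - cnj z| = 2 Im z, as prescribed by \<open>gfun\<close>; the value
  \<open>g a a\<close> would be junk.\<close>

definition node_kernel :: "nat \<Rightarrow> nat \<Rightarrow> nat \<Rightarrow> real" where
  "node_kernel N n l = (if n = l then ln (2 * node N n) else g (node N n) (node N l))"

text \<open>This is \<open>ENS\<close> rewritten with \<open>mesh N\<close> = pi * eps, since pi *
  eps^2 / 2 = (pi * eps)^2 / (2 pi).\<close>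

definition node_energy :: "nat \<Rightarrow> (real \<Rightarrow> real) \<Rightarrow> nat set \<Rightarrow> real" where
  "node_energy N V S = mesh N * (\<Sum>n\<in>S. V (node N n)) + (mesh N)\<^sup>2 / (2 * pi) * (\<Sum>n\<in>S. \<Sum>l\<in>S. node_kernel N n l)"

text \<open>The discrete energy for fractional occupations. The self-energy carries c_n in place of
  c_n^2: the two agree on {0,1}, and only the former is affine in each coordinate.\<close>

definition relaxed :: "nat \<Rightarrow> (real \<Rightarrow> real) \<Rightarrow> (nat \<Rightarrow> real) \<Rightarrow> real" where
  "relaxed N V c = mesh N * (\<Sum>n\<in>{1..N}. V (node N n) * c n) + (mesh N)\<^sup>2 / (2 * pi) *
     ((\<Sum>n\<in>{1..N}. \<Sum>l\<in>{1..N} - {n}. node_kernel N n l * (c n * c l)) + (\<Sum>n\<in>{1..N}. node_kernel N n n * c n))"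

lemma relaxed_multiaffine: "multiaffine (relaxed N V)"
  unfolding relaxed_def[abs_def]
  by (intro multiaffine_add multiaffine_cmult multiaffine_sum multiaffine_proj multiaffine_prod) auto

lemma relaxed_vertex:
  assumes "S \<subseteq> {1..N}" "\<And>n. n \<in> {1..N} \<Longrightarrow> c n = of_bool (n \<in> S)"
  shows "relaxed N V c = node_energy N V S"
proof -
  have fin: "finite S" using assms(1) finite_subset by blast
  have S: "{n \<in> {1..N}. n \<in> S} = S" using assms(1) by auto
  have 1: "(\<Sum>n\<in>{1..N}. f n * c n) = (\<Sum>n\<in>S. f n)" for f
  proof -
    have "(\<Sum>n\<in>{1..N}. f n * c n) = (\<Sum>n\<in>{1..N}. if n \<in> S then f n else 0)"
      using assms(2) by (intro sum.cong) auto
    then show ?thesis using S by (simp add: sum.inter_filter[symmetric])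
  qed
  have 2: "(\<Sum>n\<in>{1..N}. \<Sum>l\<in>{1..N} - {n}. node_kernel N n l * (c n * c l)) = (\<Sum>n\<in>S. \<Sum>l\<in>S - {n}. node_kernel N n l)"
  proof -
    have "(\<Sum>l\<in>{1..N} - {n}. node_kernel N n l * (c n * c l)) = (\<Sum>l\<in>S - {n}. node_kernel N n l) * c n" if "n \<in> {1..N}" for n
    proof -
      have "(\<Sum>l\<in>{1..N} - {n}. node_kernel N n l * (c n * c l)) = (\<Sum>l\<in>{1..N}. (if l = n then 0 else node_kernel N n l * c n) * c l)"
        by (subst sum.remove[of "{1..N}" n]) (use that in \<open>auto intro!: sum.cong\<close>)
      also have "\<dots> = (\<Sum>l\<in>S. if l = n then 0 else node_kernel N n l * c n)" by (rule 1)
      also have "\<dots> = (\<Sum>l\<in>S - {n}. node_kernel N n l * c n)"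
        by (rule sum.mono_neutral_cong_right) (use fin in auto)
      finally show ?thesis by (simp add: sum_distrib_right)
    qed
    then have "(\<Sum>n\<in>{1..N}. \<Sum>l\<in>{1..N} - {n}. node_kernel N n l * (c n * c l)) = (\<Sum>n\<in>{1..N}. (\<Sum>l\<in>S - {n}. node_kernel N n l) * c n)"
      by (rule sum.cong[OF refl])
    also have "\<dots> = (\<Sum>n\<in>S. \<Sum>l\<in>S - {n}. node_kernel N n l)" by (rule 1)
    finally show ?thesis .
  qed
  have 3: "(\<Sum>n\<in>S. \<Sum>l\<in>S - {n}. node_kernel N n l) + (\<Sum>n\<in>S. node_kernel N n n) = (\<Sum>n\<in>S. \<Sum>l\<in>S. node_kernel N n l)"
    unfolding sum.distrib[symmetric] using fin by (intro sum.cong) (auto simp: sum.remove)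
  show ?thesis unfolding relaxed_def node_energy_def 1 2 3 ..
qed

lemma mass_bounds: "\<rho> \<in> adm \<Longrightarrow> n \<in> {1..N} \<Longrightarrow> 0 \<le> mass \<rho> N n \<and> mass \<rho> N n \<le> mesh N"
  using measure_\<nu>_le[of \<rho> "cell N n"] measure_\<mu>_cell[of n N] by (simp add: mass_def)

lemma sum_mesh: "1 \<le> N \<Longrightarrow> (\<Sum>n\<in>{1..N}. mesh N) = R 0"
  by (simp add: mesh_def)

text \<open>Rounding costs nothing, so only kernels are compared, at fractional occupations. Off the
  diagonal \<open>node_kernel\<close> exceeds \<open>g_reg\<close> by at most \<open>sing\<close>,
  which sums to \<open>e\<close> per node by \<open>discrete_log_bound\<close>; on the diagonal the
  self-energy times \<open>mesh N\<close> is at most \<open>e\<close>. Both errors are weighted by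
  the masses, hence \<open>e * R 0\<close> twice.\<close>

lemma upper_discrete:
  assumes "\<rho> \<in> adm" "1 \<le> N" and r: "0 < r" "r \<le> 1"
    and e: "\<And>a. a \<in> {0..k} \<Longrightarrow> (\<integral>\<^sup>+b. ennreal (sing r a b) \<partial>\<mu>) \<le> ennreal e" "0 \<le> e"
    and small: "mesh N * ln (C0 / r) \<le> e" "mesh N * ln (2 * k + 1) \<le> e"
  obtains S where "S \<subseteq> {1..N}" "node_energy N V S \<le> cell_energy r N V (mass \<rho> N) + 2 * e * R 0"
proof -
  have h: "0 < mesh N" using mesh_pos assms by auto
  define m where "m = mass \<rho> N"
  define c where "c n = m n / mesh N" for n
  have m: "0 \<le> m n" "m n \<le> mesh N" if "n \<in> {1..N}" for n using mass_bounds[OF assms(1) that] by (auto simp: m_def)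
  have cm: "m n = mesh N * c n" for n using h by (simp add: c_def)
  obtain S where S: "S \<subseteq> {1..N}" "relaxed N V (\<lambda>n. if n \<in> {1..N} then of_bool (n \<in> S) else c n) \<le> relaxed N V c"
    using multiaffine_vertex[OF relaxed_multiaffine, of "{1..N}" c N V] m h by (auto simp: c_def)
  have "node_energy N V S \<le> relaxed N V c"
    using S(2) relaxed_vertex[OF S(1), of "\<lambda>n. if n \<in> {1..N} then of_bool (n \<in> S) else c n" V] by simp
  also have "\<dots> = (\<Sum>n\<in>{1..N}. V (node N n) * m n) +
     ((\<Sum>n\<in>{1..N}. \<Sum>l\<in>{1..N} - {n}. node_kernel N n l * m l * m n) + (\<Sum>n\<in>{1..N}. mesh N * ln (2 * node N n) * m n)) / (2 * pi)"
    unfolding relaxed_def cm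
    by (simp add: sum_distrib_left sum_divide_distrib power2_eq_square node_kernel_def algebra_simps add_divide_distrib)
  also have "\<dots> \<le> (\<Sum>n\<in>{1..N}. V (node N n) * m n) +
     ((\<Sum>n\<in>{1..N}. \<Sum>l\<in>{1..N}. g_reg r (node N n) (node N l) * m l * m n) + 2 * e * R 0) / (2 * pi)"
  proof (intro add_left_mono divide_right_mono)
    have "(\<Sum>n\<in>{1..N}. \<Sum>l\<in>{1..N} - {n}. node_kernel N n l * m l * m n) \<le>
       (\<Sum>n\<in>{1..N}. (\<Sum>l\<in>{1..N}. g_reg r (node N n) (node N l) * m l * m n) + e * m n)"
    proof (rule sum_mono)
      fix n assume n: "n \<in> {1..N}"
      note K = node[OF n]
      have "(\<Sum>l\<in>{1..N} - {n}. node_kernel N n l * m l) \<le> (\<Sum>l\<in>{1..N} - {n}. g_reg r (node N n) (node N l) * m l + sing r (node N n) (node N l) * mesh N)"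
      proof (rule sum_mono)
        fix l assume l: "l \<in> {1..N} - {n}"
        then have l': "l \<in> {1..N}" "l \<noteq> n" by auto
        have ne: "node N n \<noteq> node N l" using node(3)[OF l'(1)] K(3) l'(2) by auto
        have "node_kernel N n l * m l \<le> (g_reg r (node N n) (node N l) + sing r (node N n) (node N l)) * m l"
          using l' g_g_reg(2)[OF K(1) node(1)[OF l'(1)] ne r] m[OF l'(1)] by (intro mult_right_mono) (auto simp: node_kernel_def)
        also have "\<dots> \<le> g_reg r (node N n) (node N l) * m l + sing r (node N n) (node N l) * mesh N"
          using m[OF l'(1)] sing_nonneg[OF r(2)] by (simp add: distrib_right mult_left_mono)
        finally show "node_kernel N n l * m l \<le> g_reg r (node N n) (node N l) * m l + sing r (node N n) (node N l) * mesh N" .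
      qed
      also have "\<dots> \<le> (\<Sum>l\<in>{1..N} - {n}. g_reg r (node N n) (node N l) * m l) + e"
        unfolding sum.distrib using discrete_log_bound[OF n r(2) e(1)[OF K(1)] e(2)] by simp
      \<comment> \<open>The diagonal summand of \<open>cell_energy\<close> may be added because
        \<open>g_reg\<close> is nonnegative.\<close>
      also have "(\<Sum>l\<in>{1..N} - {n}. g_reg r (node N n) (node N l) * m l) \<le> (\<Sum>l\<in>{1..N}. g_reg r (node N n) (node N l) * m l)"
      proof (rule sum_mono2)
        fix l assume "l \<in> {1..N} - ({1..N} - {n})"
        then show "0 \<le> g_reg r (node N n) (node N l) * m l"
          using g_reg_nonneg[OF K(1) node(1) r(1)] m by auto
      qed auto
      finally have "(\<Sum>l\<in>{1..N} - {n}. node_kernel N n l * m l) * m n \<le> ((\<Sum>l\<in>{1..N}. g_reg r (node N n) (node N l) * m l) + e) * m n"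
        using m[OF n] by (intro mult_right_mono) auto
      then show "(\<Sum>l\<in>{1..N} - {n}. node_kernel N n l * m l * m n) \<le> (\<Sum>l\<in>{1..N}. g_reg r (node N n) (node N l) * m l * m n) + e * m n"
        by (simp add: sum_distrib_right distrib_right)
    qed
    moreover have "(\<Sum>n\<in>{1..N}. mesh N * ln (2 * node N n) * m n) \<le> (\<Sum>n\<in>{1..N}. e * m n)"
    proof (rule sum_mono)
      fix n assume n: "n \<in> {1..N}"
      have "ln (2 * node N n) \<le> ln (2 * k + 1)" using node[OF n] by (intro ln_mono) auto
      then have "mesh N * ln (2 * node N n) \<le> mesh N * ln (2 * k + 1)" using h by (intro mult_left_mono) auto
      then show "mesh N * ln (2 * node N n) * m n \<le> e * m n" using small(2) m[OF n] by (intro mult_right_mono) auto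
    qed
    moreover have "(\<Sum>n\<in>{1..N}. e * m n) \<le> e * R 0"
      unfolding sum_distrib_left[symmetric] sum_mesh[OF assms(2), symmetric]
      using m e(2) by (intro mult_left_mono sum_mono) auto
    ultimately show "(\<Sum>n\<in>{1..N}. \<Sum>l\<in>{1..N} - {n}. node_kernel N n l * m l * m n) + (\<Sum>n\<in>{1..N}. mesh N * ln (2 * node N n) * m n)
       \<le> (\<Sum>n\<in>{1..N}. \<Sum>l\<in>{1..N}. g_reg r (node N n) (node N l) * m l * m n) + 2 * e * R 0"
      by (simp add: sum.distrib)
  qed (use pi_gt_zero in auto)
  also have "\<dots> = cell_energy r N V m + 2 * e * R 0 / (2 * pi)" by (simp add: cell_energy_def add_divide_distrib)
  also have "2 * e * R 0 / (2 * pi) \<le> 2 * e * R 0 / 1"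
    using e(2) R_pos pi_gt3 by (intro divide_left_mono) auto
  finally show thesis using that[OF S(1)] by (simp add: m_def)
qed

text \<open>Off the diagonal \<open>g_reg\<close> lies below the true kernel and nothing is lost.
  The loss is at the diagonal, at most \<open>3 * e\<close> per node: one from
  \<open>ln (C0 / r)\<close> and two from \<open>diag_lower\<close>. There are at most N nodes of
  mass \<open>mesh N\<close>, hence \<open>3 * e * R 0\<close>.\<close>

lemma lower_discrete:
  assumes "S \<subseteq> {1..N}" "1 \<le> N" and r: "0 < r" "r \<le> 1"
    and e: "\<And>a. a \<in> {0..k} \<Longrightarrow> (\<integral>\<^sup>+b. ennreal (sing r a b) \<partial>\<mu>) \<le> ennreal e" "0 \<le> e"
    and small: "mesh N * ln (C0 / r) \<le> e"
  obtains \<rho> where "\<rho> \<in> adm" "cell_energy r N V (mass \<rho> N) \<le> node_energy N V S + 3 * e * R 0"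
proof -
  have h: "0 < mesh N" using mesh_pos assms by auto
  have fin: "finite S" using assms(1) finite_subset by blast
  define A where "A = (\<Union>n\<in>S. cell N n)"
  have A[measurable]: "A \<in> sets L" unfolding A_def using fin by (intro sets.finite_UN) auto
  define \<rho> where "\<rho> a = indicator A a * w a" for a
  have \<rho>: "\<rho> \<in> adm" unfolding adm_def \<rho>_def[abs_def] using w_nonneg by (auto simp: indicator_def)
  have mass: "mass \<rho> N n = mesh N * of_bool (n \<in> S)" if n: "n \<in> {1..N}" for n
  proof -
    have e1: "emeasure (\<nu> \<rho>) (cell N n) = (\<integral>\<^sup>+a. ennreal (\<rho> a) * indicator (cell N n) a \<partial>L)"
      using nn_\<nu>[OF \<rho>, of "indicator (cell N n)"] by simp
    have e2: "emeasure \<mu> (cell N n) = (\<integral>\<^sup>+a. ennreal (w a) * indicator (cell N n) a \<partial>L)"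
      using nn_\<nu>[OF w_adm, of "indicator (cell N n)"] by (simp add: \<mu>_eq)
    show ?thesis
    proof (cases "n \<in> S")
      case True
      have "emeasure (\<nu> \<rho>) (cell N n) = emeasure \<mu> (cell N n)"
        unfolding e1 e2 using True by (intro nn_integral_cong) (auto simp: \<rho>_def A_def indicator_def)
      then show ?thesis using True measure_\<mu>_cell[OF n] by (simp add: mass_def measure_def)
    next
      case False
      have "a \<notin> A" if "a \<in> cell N n" for a
      proof
        assume "a \<in> A"
        then obtain m where m: "m \<in> S" "a \<in> cell N m" by (auto simp: A_def)
        then have "m = n" using that by (auto simp: cell_def)
        then show False using m False by simp
      qed
      then have "emeasure (\<nu> \<rho>) (cell N n) = (\<integral>\<^sup>+a. 0 \<partial>L)"
        unfolding e1 by (intro nn_integral_cong) (auto simp: \<rho>_def indicator_def)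
      then show ?thesis using False by (simp add: mass_def measure_def)
    qed
  qed
  have 1: "(\<Sum>n\<in>{1..N}. f n * mass \<rho> N n) = mesh N * (\<Sum>n\<in>S. f n)" for f
  proof -
    have "(\<Sum>n\<in>{1..N}. f n * mass \<rho> N n) = (\<Sum>n\<in>S. f n * mesh N)"
      using assms(1) mass by (intro sum.mono_neutral_cong_right) auto
    then show ?thesis by (simp add: sum_distrib_left[symmetric] sum_distrib_right[symmetric] mult.commute)
  qed
  have "cell_energy r N V (mass \<rho> N) = mesh N * (\<Sum>n\<in>S. V (node N n)) + (mesh N)\<^sup>2 / (2 * pi) * (\<Sum>n\<in>S. \<Sum>l\<in>S. g_reg r (node N n) (node N l))"
    unfolding cell_energy_def sum_distrib_right[symmetric] 1 by (simp add: power2_eq_square sum_distrib_left[symmetric])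
  also have "\<dots> \<le> mesh N * (\<Sum>n\<in>S. V (node N n)) + ((mesh N)\<^sup>2 * (\<Sum>n\<in>S. \<Sum>l\<in>S. node_kernel N n l) + 3 * e * R 0) / (2 * pi)"
  proof -
    have "(\<Sum>n\<in>S. \<Sum>l\<in>S. g_reg r (node N n) (node N l)) * mesh N \<le> (\<Sum>n\<in>S. (\<Sum>l\<in>S. node_kernel N n l) * mesh N + 3 * e)"
      unfolding sum_distrib_right
    proof (rule sum_mono)
      fix n assume nS: "n \<in> S"
      then have n: "n \<in> {1..N}" using assms(1) by auto
      note K = node[OF n]
      have "(\<Sum>l\<in>S - {n}. g_reg r (node N n) (node N l)) \<le> (\<Sum>l\<in>S - {n}. node_kernel N n l)"
      proof (rule sum_mono)
        fix l assume "l \<in> S - {n}"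
        then have l: "l \<in> {1..N}" "l \<noteq> n" using assms(1) by auto
        then have "node N n \<noteq> node N l" using node(3)[OF l(1)] K(3) by auto
        then show "g_reg r (node N n) (node N l) \<le> node_kernel N n l" using g_g_reg(1)[OF K(1) node(1)[OF l(1)] _ r] l by (simp add: node_kernel_def)
      qed
      then have "(\<Sum>l\<in>S - {n}. g_reg r (node N n) (node N l)) * mesh N \<le> (\<Sum>l\<in>S - {n}. node_kernel N n l) * mesh N"
        using h by (intro mult_right_mono) auto
      moreover have "g_reg r (node N n) (node N n) * mesh N \<le> node_kernel N n n * mesh N + 3 * e"
      proof -
        have "mesh N * g_reg r (node N n) (node N n) \<le> mesh N * ln (C0 / r)"
          using g_reg_le[OF K(1) K(1) r] h by (intro mult_left_mono) auto
        moreover have "mesh N * - ln (2 * node N n) \<le> 2 * e"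
          using k_pos by (intro diag_lower[OF n r e(1) e(2) small]) auto
        ultimately show ?thesis using small by (simp add: node_kernel_def algebra_simps)
      qed
      ultimately have "(\<Sum>l\<in>S. g_reg r (node N n) (node N l)) * mesh N \<le> (\<Sum>l\<in>S. node_kernel N n l) * mesh N + 3 * e"
        using fin nS by (simp add: sum.remove distrib_right)
      then show "(\<Sum>l\<in>S. g_reg r (node N n) (node N l) * mesh N) \<le> (\<Sum>l\<in>S. node_kernel N n l * mesh N) + 3 * e"
        by (simp add: sum_distrib_right)
    qed
    also have "\<dots> = (\<Sum>n\<in>S. \<Sum>l\<in>S. node_kernel N n l) * mesh N + 3 * e * real (card S)"
      by (simp add: sum.distrib sum_distrib_right)
    finally have "((\<Sum>n\<in>S. \<Sum>l\<in>S. g_reg r (node N n) (node N l)) * mesh N) * mesh N \<le>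
       ((\<Sum>n\<in>S. \<Sum>l\<in>S. node_kernel N n l) * mesh N + 3 * e * real (card S)) * mesh N"
      using h by (intro mult_right_mono) auto
    moreover have "3 * e * real (card S) * mesh N \<le> 3 * e * real N * mesh N"
      using e(2) h card_mono[OF _ assms(1)] by (intro mult_right_mono mult_left_mono) auto
    moreover have "real N * mesh N = R 0" using assms(2) by (simp add: mesh_def)
    ultimately have "(mesh N)\<^sup>2 * (\<Sum>n\<in>S. \<Sum>l\<in>S. g_reg r (node N n) (node N l)) \<le>
       (mesh N)\<^sup>2 * (\<Sum>n\<in>S. \<Sum>l\<in>S. node_kernel N n l) + 3 * e * R 0"
      by (simp add: power2_eq_square algebra_simps)
    then have "(mesh N)\<^sup>2 * (\<Sum>n\<in>S. \<Sum>l\<in>S. g_reg r (node N n) (node N l)) / (2 * pi) \<le>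
       ((mesh N)\<^sup>2 * (\<Sum>n\<in>S. \<Sum>l\<in>S. node_kernel N n l) + 3 * e * R 0) / (2 * pi)"
      by (intro divide_right_mono) auto
    then show ?thesis by simp
  qed
  also have "\<dots> = node_energy N V S + 3 * e * R 0 / (2 * pi)" by (simp add: node_energy_def add_divide_distrib)
  also have "3 * e * R 0 / (2 * pi) \<le> 3 * e * R 0 / 1"
    using e(2) R_pos pi_gt3 by (intro divide_left_mono) auto
  finally show thesis using that[OF \<rho>] by simp
qed

end

section \<open>Compactness and the continuum limit\<close>

lemma measure_eqI_Ioc:
  fixes M N :: "real measure"
  assumes "sets M = sets borel" "sets N = sets borel"
    and eq: "\<And>a b. a \<le> b \<Longrightarrow> emeasure M {a<..b} = emeasure N {a<..b}"
    and fin: "\<And>a b. a \<le> b \<Longrightarrow> emeasure M {a<..b} \<noteq> \<infinity>"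
  shows "M = N"
proof (rule measure_eqI_generator_eq[where \<Omega>=UNIV and E="range (\<lambda>(a, b). {a<..b})" and A="\<lambda>i::nat. {- real i<..real i}"])
  show "Int_stable (range (\<lambda>(a, b). {a<..b::real}))"
    unfolding Int_stable_def
  proof (intro ballI)
    fix X Y assume "X \<in> range (\<lambda>(a, b). {a<..b::real})" "Y \<in> range (\<lambda>(a, b). {a<..b::real})"
    then obtain a b c d where "X = {a<..b}" "Y = {c<..d}" by auto
    then have "X \<inter> Y = {max a c<..min b d}" by auto
    then show "X \<inter> Y \<in> range (\<lambda>(a, b). {a<..b::real})"
      by (intro range_eqI[of _ _ "(max a c, min b d)"]) simp
  qed
  show "sets M = sigma_sets UNIV (range (\<lambda>(a, b). {a<..b}))" "sets N = sigma_sets UNIV (range (\<lambda>(a, b). {a<..b}))"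
    unfolding assms(1,2) by (subst borel_sigma_sets_Ioc, simp)+
  show "(\<Union>i. {- real i<..real i}) = UNIV"
  proof safe
    fix x :: real
    obtain n :: nat where "\<bar>x\<bar> < real n" using reals_Archimedean2 by blast
    then show "x \<in> (\<Union>i. {- real i<..real i})" by (intro UN_I[of n]) auto
  qed simp
  fix X assume "X \<in> range (\<lambda>(a, b). {a<..b::real})"
  then obtain a b where "X = {a<..b}" by auto
  then show "emeasure M X = emeasure N X" using eq[of a b] by (cases "a \<le> b") auto
qed (use fin in auto)

text \<open>The Stieltjes measure of \<open>F1\<close> is absolutely continuous because adding that of \<open>F2\<close> gives the measure with density \<open>v\<close>.\<close>

lemma density_decomposition:
  fixes F1 F2 :: "real \<Rightarrow> real" and v :: "real \<Rightarrow> ennreal"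
  assumes mono: "mono F1" "mono F2"
    and cont: "continuous_on UNIV F1" "continuous_on UNIV F2"
    and v: "v \<in> borel_measurable borel"
      "\<And>a b. a \<le> b \<Longrightarrow> (\<integral>\<^sup>+t. v t * indicator {a<..b} t \<partial>lborel) = ennreal (F1 b - F1 a + (F2 b - F2 a))"
  obtains f where "f \<in> borel_measurable borel" "AE x in lborel. f x \<le> v x"
    "\<And>a b. a \<le> b \<Longrightarrow> (\<integral>\<^sup>+x. f x * indicator {a<..b} x \<partial>lborel) = ennreal (F1 b - F1 a)"
proof -
  define M1 where "M1 = interval_measure F1"
  define M2 where "M2 = interval_measure F2"
  have rc: "continuous (at_right a) F1" "continuous (at_right a) F2" for a
    using cont by (auto simp: continuous_on_eq_continuous_at intro: continuous_within_subset)
  have m: "F1 x \<le> F1 y" "F2 x \<le> F2 y" if "x \<le> y" for x y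
    using mono that by (auto simp: mono_def)
  have e1: "emeasure M1 {a<..b} = F1 b - F1 a" and e2: "emeasure M2 {a<..b} = F2 b - F2 a" if "a \<le> b" for a b
    unfolding M1_def M2_def using that by (intro emeasure_interval_measure_Ioc m rc; simp)+
  have s1[simp]: "sets M1 = sets borel" "sets M2 = sets borel" by (auto simp: M1_def M2_def)
  define M where "M = measure_of UNIV (sets borel) (\<lambda>A. emeasure M1 A + emeasure M2 A)"
  have sM[simp]: "sets M = sets borel"
    unfolding M_def by (metis sets.sigma_sets_eq sets_measure_of_conv space_borel top_greatest Pow_UNIV)
  have eM: "emeasure M A = emeasure M1 A + emeasure M2 A" if "A \<in> sets borel" for A
  proof (rule emeasure_measure_of[OF M_def])
    show "countably_additive (sets M) (\<lambda>A. emeasure M1 A + emeasure M2 A)"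
      unfolding countably_additive_def
    proof (intro allI impI)
      fix A :: "nat \<Rightarrow> real set" assume A: "range A \<subseteq> sets M" "disjoint_family A"
      then show "(\<Sum>i. emeasure M1 (A i) + emeasure M2 (A i)) = emeasure M1 (\<Union> (range A)) + emeasure M2 (\<Union> (range A))"
        by (subst suminf_add[symmetric]) (auto simp: suminf_emeasure)
    qed
  qed (use that in \<open>auto simp: positive_def\<close>)
  have T: "M = density lborel v"
  proof (rule measure_eqI_Ioc)
    fix a b :: real assume ab: "a \<le> b"
    have "emeasure (density lborel v) {a<..b} = ennreal (F1 b - F1 a + (F2 b - F2 a))"
      using v ab by (simp add: emeasure_density)
    then show "emeasure M {a<..b} = emeasure (density lborel v) {a<..b}"
      using m[OF ab] by (simp add: eM e1[OF ab] e2[OF ab])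
    show "emeasure M {a<..b} \<noteq> \<infinity>" by (simp add: eM e1[OF ab] e2[OF ab])
  qed auto
  have ac: "absolutely_continuous lborel M1" "absolutely_continuous lborel M2"
  proof -
    have "emeasure M1 A = 0 \<and> emeasure M2 A = 0" if "A \<in> null_sets lborel" for A
    proof -
      have "emeasure M A = 0" unfolding T
        using absolutely_continuousI_density[of v lborel] that v(1) by (auto simp: absolutely_continuous_def)
      then show ?thesis using eM[of A] that by auto
    qed
    then show "absolutely_continuous lborel M1" "absolutely_continuous lborel M2"
      by (auto simp: absolutely_continuous_def null_sets_def)
  qed
  obtain f1 where f1: "f1 \<in> borel_measurable lborel" "density lborel f1 = M1"
    using sigma_finite_measure.Radon_Nikodym[OF sigma_finite_lborel ac(1)] by auto
  obtain f2 where f2: "f2 \<in> borel_measurable lborel" "density lborel f2 = M2"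
    using sigma_finite_measure.Radon_Nikodym[OF sigma_finite_lborel ac(2)] by auto
  have fm[measurable]: "f1 \<in> borel_measurable borel" "f2 \<in> borel_measurable borel" "v \<in> borel_measurable borel"
    using f1 f2 v by auto
  have "density lborel (\<lambda>x. f1 x + f2 x) = M"
  proof (rule measure_eqI)
    fix A assume "A \<in> sets (density lborel (\<lambda>x. f1 x + f2 x))"
    then have A[measurable]: "A \<in> sets borel" by simp
    have "emeasure (density lborel (\<lambda>x. f1 x + f2 x)) A = emeasure (density lborel f1) A + emeasure (density lborel f2) A"
      by (simp add: emeasure_density distrib_right nn_integral_add)
    then show "emeasure (density lborel (\<lambda>x. f1 x + f2 x)) A = emeasure M A" by (simp add: f1 f2 eM)
  qed auto
  then have "density lborel (\<lambda>x. f1 x + f2 x) = density lborel v" by (simp add: T)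
  then have ae: "AE x in lborel. f1 x + f2 x = v x"
    by (subst (asm) sigma_finite_measure.density_unique_iff[OF sigma_finite_lborel]) auto
  show thesis
  proof (rule that[of f1])
    show "AE x in lborel. f1 x \<le> v x" using ae by eventually_elim (metis le_iff_add)
    fix a b :: real assume ab: "a \<le> b"
    have "(\<integral>\<^sup>+x. f1 x * indicator {a<..b} x \<partial>lborel) = emeasure M1 {a<..b}"
      unfolding f1(2)[symmetric] by (simp add: emeasure_density)
    then show "(\<integral>\<^sup>+x. f1 x * indicator {a<..b} x \<partial>lborel) = ennreal (F1 b - F1 a)"
      unfolding M1_def using emeasure_interval_measure_Ioc[OF ab, of F1] m rc by simp
  qed simp
qed

context weyl_gas begin

section \<open>Distribution functions and compactness of the admissible set\<close>

lemma no_atom: "\<rho> \<in> adm \<Longrightarrow> x \<in> {0..k} \<Longrightarrow> measure (\<nu> \<rho>) {x} = 0"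
  using measure_\<nu>_le[of \<rho> "{x}"] measure_\<mu>_Icc[of x x] L_sets[of "{x}"] by (simp add: antisym)

definition dist_fun :: "(real \<Rightarrow> real) \<Rightarrow> real \<Rightarrow> real" where
  "dist_fun \<rho> a = measure (\<nu> \<rho>) {0..a}"

lemma dist_fun_diff:
  assumes "\<rho> \<in> adm" "0 \<le> a" "a \<le> b" "b \<le> k"
  shows "dist_fun \<rho> b - dist_fun \<rho> a = measure (\<nu> \<rho>) {a<..b}"
proof -
  interpret finite_measure "\<nu> \<rho>" by (rule fin_\<nu>[OF assms(1)])
  have "{0..b} - {0..a} = {a<..b}" using assms by auto
  moreover have "{0..b} \<in> sets L" "{0..a} \<in> sets L" using assms by (auto intro!: L_sets)
  ultimately show ?thesis
    using finite_measure_Diff[of "{0..b}" "{0..a}"] assms by (simp add: dist_fun_def)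
qed

lemma dist_fun_increment:
  assumes "\<rho> \<in> adm" "0 \<le> a" "a \<le> b" "b \<le> k"
  shows "0 \<le> dist_fun \<rho> b - dist_fun \<rho> a" "dist_fun \<rho> b - dist_fun \<rho> a \<le> R a - R b"
proof -
  show "0 \<le> dist_fun \<rho> b - dist_fun \<rho> a" by (simp add: dist_fun_diff[OF assms])
  interpret finite_measure \<mu> by (rule fin_\<mu>)
  have s: "{a<..b} \<in> sets L" "{a..b} \<in> sets L" using assms by (auto intro!: L_sets)
  have "measure (\<nu> \<rho>) {a<..b} \<le> measure \<mu> {a<..b}" by (rule measure_\<nu>_le[OF assms(1) s(1)])
  also have "\<dots> \<le> measure \<mu> {a..b}" using s by (intro finite_measure_mono) auto
  finally show "dist_fun \<rho> b - dist_fun \<rho> a \<le> R a - R b"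
    using measure_\<mu>_Icc[of a b] assms by (simp add: dist_fun_diff[OF assms])
qed

lemma dist_fun_0: "\<rho> \<in> adm \<Longrightarrow> dist_fun \<rho> 0 = 0"
  using no_atom[of \<rho> 0] k_pos by (simp add: dist_fun_def)

text \<open>Besides \<open>H\<close>, the complementary function R 0 - R - H is increasing, because
  \<open>H\<close> grows no faster than -R. Both are extended by constants beyond [0,k]; their sum
  is the distribution function of \<open>w\<close>, which is the situation of
  \<open>density_decomposition\<close>.\<close>

lemma adm_of_dist_fun:
  assumes inc: "\<And>a b. 0 \<le> a \<Longrightarrow> a \<le> b \<Longrightarrow> b \<le> k \<Longrightarrow> 0 \<le> H b - H a \<and> H b - H a \<le> R a - R b"
    and H0: "H 0 = 0" and Hc: "continuous_on {0..k} H"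
  obtains \<rho> where "\<rho> \<in> adm" "\<And>a. a \<in> {0..k} \<Longrightarrow> dist_fun \<rho> a = H a"
proof -
  define cl where "cl x = max 0 (min k x)" for x :: real
  have cl: "cl x \<in> {0..k}" "x \<in> {0..k} \<Longrightarrow> cl x = x" "x \<le> y \<Longrightarrow> cl x \<le> cl y" "x \<le> 0 \<Longrightarrow> cl x = 0" for x y
    using k_pos by (auto simp: cl_def)
  have clc: "continuous_on UNIV cl" unfolding cl_def by (intro continuous_intros)
  define F1 where "F1 x = H (cl x)" for x
  define F2 where "F2 x = R 0 - R (cl x) - H (cl x)" for x
  \<comment> \<open>\<open>w\<close> is only Lebesgue measurable; \<open>v\<close> is a Borel
    version of it.\<close>
  have "(\<lambda>x. indicator {0..k} x * w x) \<in> borel_measurable lebesgue"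
    using w_meas by (subst (asm) borel_measurable_restrict_space_iff) (auto simp: mult.commute)
  then have "(\<lambda>x. ennreal (indicator {0..k} x * w x)) \<in> borel_measurable (completion lborel)" by measurable
  from completion_ex_borel_measurable[OF this] obtain v
    where v: "v \<in> borel_measurable lborel" "AE x in lborel. ennreal (indicator {0..k} x * w x) = v x" by blast
  have vb[measurable]: "v \<in> borel_measurable borel" using v(1) by simp
  have vi: "(\<integral>\<^sup>+t. v t * indicator {a<..b} t \<partial>lborel) = ennreal (F1 b - F1 a + (F2 b - F2 a))" if ab: "a \<le> b" for a b
  proof -
    have "(\<integral>\<^sup>+t. v t * indicator {a<..b} t \<partial>lborel) = (\<integral>\<^sup>+t. ennreal (indicator {cl a..cl b} t * w t) \<partial>lborel)"
    proof (rule nn_integral_cong_AE)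
      show "AE t in lborel. v t * indicator {a<..b} t = ennreal (indicator {cl a..cl b} t * w t)"
        using v(2) AE_lborel_singleton[of "cl a"]
      proof eventually_elim
        case (elim t)
        have "indicator {0..k} t * w t * indicator {a<..b} t = indicator {cl a..cl b} t * w t"
        proof (cases "0 < t \<and> t < k")
          case True
          then have "t \<in> {a<..b} \<longleftrightarrow> t \<in> {cl a..cl b}"
            using elim(2) ab unfolding cl_def by (auto simp: max_def min_def split: if_splits)
          then show ?thesis using True by (auto simp: indicator_def)
        qed (auto simp: w_def)
        then show ?case unfolding elim(1)[symmetric]
          by (metis (no_types) ennreal_indicator ennreal_mult'' indicator_pos_le)
      qed
    qed
    also have "\<dots> = (\<integral>\<^sup>+t. ennreal (indicator {cl a..cl b} t * w t) \<partial>lebesgue)"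
      by (simp add: nn_integral_completion)
    also have "\<dots> = ennreal (R (cl a) - R (cl b))"
      using cl(1)[of a] cl(1)[of b] cl(3)[OF ab] w_nonneg
      by (intro nn_integral_has_integral_completion w_has_integral) auto
    finally show ?thesis by (simp add: F1_def F2_def)
  qed
  obtain f where f: "f \<in> borel_measurable borel" "AE x in lborel. f x \<le> v x"
    "\<And>a b. a \<le> b \<Longrightarrow> (\<integral>\<^sup>+x. f x * indicator {a<..b} x \<partial>lborel) = ennreal (F1 b - F1 a)"
  proof (rule density_decomposition[of F1 F2 v])
    show "mono F1" unfolding F1_def using inc cl by (intro monoI) (smt (verit) atLeastAtMost_iff)
    show "mono F2" unfolding F2_def using inc cl by (intro monoI) (smt (verit) atLeastAtMost_iff)
    have 1: "continuous_on UNIV (\<lambda>x. H (cl x))" "continuous_on UNIV (\<lambda>x. R (cl x))"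
      using cl(1) by (auto intro!: continuous_on_compose2[OF Hc clc] continuous_on_compose2[OF R_cont clc])
    show "continuous_on UNIV F1" "continuous_on UNIV F2"
      unfolding F1_def F2_def by (intro continuous_intros 1)+
  qed (use vi in auto)
  have fb[measurable]: "f \<in> borel_measurable borel" by (rule f)
  \<comment> \<open>\<open>f\<close> is at most \<open>w\<close> almost everywhere on [0,k], hence
    finite there, and \<open>enn2real\<close> loses nothing.\<close>
  define \<rho> where "\<rho> x = enn2real (f x)" for x
  have ae: "AE x in lborel. x \<in> {0..k} \<longrightarrow> f x \<le> ennreal (w x)"
    using f(2) v(2) by eventually_elim (auto simp: indicator_def split: if_splits)
  have aeL: "AE x in L. f x \<le> ennreal (w x)"
    using AE_completion[OF ae] by (subst AE_restrict_space_iff) auto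
  have \<rho>m: "\<rho> \<in> borel_measurable borel" unfolding \<rho>_def[abs_def] by measurable
  have \<rho>: "\<rho> \<in> adm"
    unfolding adm_def
  proof (intro CollectI conjI borel_L[OF \<rho>m])
    show "AE a in L. 0 \<le> \<rho> a \<and> \<rho> a \<le> w a"
      using aeL by eventually_elim (auto simp: \<rho>_def w_nonneg intro: enn2real_leI)
  qed
  show thesis
  proof (rule that[OF \<rho>])
    fix a assume a: "a \<in> {0..k}"
    have [measurable]: "{0<..a} \<in> sets L" using a by (intro L_sets) auto
    have "emeasure (\<nu> \<rho>) {0<..a} = (\<integral>\<^sup>+x. ennreal (\<rho> x) * indicator {0<..a} x \<partial>L)"
      using nn_\<nu>[OF \<rho>, of "indicator {0<..a}"] by simp
    also have "\<dots> = (\<integral>\<^sup>+x. f x * indicator {0<..a} x \<partial>L)"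
      using aeL by (intro nn_integral_cong_AE, eventually_elim) (auto simp: \<rho>_def ennreal_enn2real_if top_unique)
    also have "\<dots> = (\<integral>\<^sup>+x. f x * indicator {0<..a} x * indicator {0..k} x \<partial>lebesgue)"
      by (subst nn_integral_restrict_space) auto
    also have "\<dots> = (\<integral>\<^sup>+x. f x * indicator {0<..a} x \<partial>lborel)"
      unfolding nn_integral_completion using a by (intro nn_integral_cong) (auto simp: indicator_def)
    also have "\<dots> = ennreal (F1 a - F1 0)" using a by (intro f) auto
    also have "\<dots> = ennreal (H a)" using a by (simp add: F1_def cl H0)
    finally have "measure (\<nu> \<rho>) {0<..a} = H a"
      using inc[of 0 a] a H0 by (simp add: measure_def)
    then show "dist_fun \<rho> a = H a"
      using dist_fun_diff[OF \<rho>, of 0 a] dist_fun_0[OF \<rho>] a by simp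
  qed
qed

lemma adm_compact:
  assumes "\<And>j::nat. \<rho> j \<in> adm"
  obtains \<sigma> s where "\<sigma> \<in> adm" "strict_mono (s :: nat \<Rightarrow> nat)"
    "\<And>a. a \<in> {0..k} \<Longrightarrow> (\<lambda>j. dist_fun (\<rho> (s j)) a) \<longlonglongrightarrow> dist_fun \<sigma> a"
proof -
  have bd: "norm (dist_fun (\<rho> n) x) \<le> R 0" if "x \<in> {0..k}" for n x
    using dist_fun_increment[OF assms, of 0 x n] dist_fun_0[OF assms, of n] that R_mono[of x k] R_end by simp
  have lip: "\<bar>dist_fun (\<rho> n) x - dist_fun (\<rho> n) y\<bar> \<le> \<bar>R x - R y\<bar>" if "x \<in> {0..k}" "y \<in> {0..k}" for n x y
    using dist_fun_increment[OF assms, of x y n] dist_fun_increment[OF assms, of y x n] that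
    by (cases "x \<le> y") auto
  obtain H s where H: "continuous_on {0..k} H" "strict_mono (s :: nat \<Rightarrow> nat)"
    "\<And>e. 0 < e \<Longrightarrow> \<exists>N. \<forall>n x. n \<ge> N \<and> x \<in> {0..k} \<longrightarrow> norm (dist_fun (\<rho> (s n)) x - H x) < e"
  proof (rule Arzela_Ascoli[of "{0..k}" "\<lambda>n. dist_fun (\<rho> n)" "R 0"])
    fix x e :: real assume x: "x \<in> {0..k}" and e: "0 < e"
    obtain d where d: "0 < d" "\<And>y. y \<in> {0..k} \<Longrightarrow> dist y x < d \<Longrightarrow> dist (R y) (R x) < e"
      using R_cont x e unfolding continuous_on_iff by metis
    show "\<exists>d>0. \<forall>n y. y \<in> {0..k} \<and> norm (x - y) < d \<longrightarrow> norm (dist_fun (\<rho> n) x - dist_fun (\<rho> n) y) < e"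
    proof (intro exI[of _ d] conjI allI impI d(1))
      fix n y assume "y \<in> {0..k} \<and> norm (x - y) < d"
      then have y: "y \<in> {0..k}" "\<bar>R x - R y\<bar> < e"
        using d(2)[of y] by (auto simp: dist_real_def abs_minus_commute)
      then show "norm (dist_fun (\<rho> n) x - dist_fun (\<rho> n) y) < e" using lip[OF x y(1), of n] by simp
    qed
  qed (use bd in auto)
  have lim: "(\<lambda>j. dist_fun (\<rho> (s j)) a) \<longlonglongrightarrow> H a" if "a \<in> {0..k}" for a
    unfolding LIMSEQ_iff using H(3) that by blast
  have inc: "0 \<le> H b - H a \<and> H b - H a \<le> R a - R b" if "0 \<le> a" "a \<le> b" "b \<le> k" for a b
  proof -
    have l: "(\<lambda>j. dist_fun (\<rho> (s j)) b - dist_fun (\<rho> (s j)) a) \<longlonglongrightarrow> H b - H a"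
      using that by (intro tendsto_diff lim) auto
    show ?thesis
      using dist_fun_increment[OF assms that]
      by (intro conjI LIMSEQ_le_const[OF l] LIMSEQ_le_const2[OF l]) auto
  qed
  have "(\<lambda>j. dist_fun (\<rho> (s j)) 0) \<longlonglongrightarrow> H 0" using k_pos by (intro lim) auto
  then have H0: "H 0 = 0" using LIMSEQ_unique[OF _ tendsto_const] by (simp add: dist_fun_0[OF assms])
  obtain \<sigma> where "\<sigma> \<in> adm" "\<And>a. a \<in> {0..k} \<Longrightarrow> dist_fun \<sigma> a = H a"
    using adm_of_dist_fun[OF inc H0 H(1)] by metis
  then show thesis using that[of \<sigma> s] H(2) lim by simp
qed

section \<open>Convergence of cell masses and existence of a minimizer\<close>

lemma cell_interval:
  assumes "n \<in> {1..N}"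
  obtains a b where "0 \<le> a" "a \<le> b" "b \<le> k" "cell N n = {a..<b}"
proof -
  have N: "1 \<le> N" using assms by auto
  have h: "0 < mesh N" "mesh N * real N = R 0" using mesh_pos N by (auto simp: mesh_def)
  have "mesh N * real n \<le> mesh N * real N" using assms h by (intro mult_left_mono) auto
  then obtain a where a: "a \<in> {0..k}" "R a = mesh N * real n" using R_surj[of "mesh N * real n"] assms h by auto
  have "mesh N * (real n - 1) \<le> mesh N * real N" using assms h by (intro mult_left_mono) auto
  then obtain b where b: "b \<in> {0..k}" "R b = mesh N * (real n - 1)"
    using R_surj[of "mesh N * (real n - 1)"] assms h by auto
  have ya: "ridx N a = real n" "ridx N b = real n - 1" using a b h by (auto simp: ridx_def)
  have "a \<le> b" using ridx_le_iff[OF N, of b a] a b ya by simp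
  moreover have "cell N n = {a..<b}"
  proof (intro set_eqI)
    fix x
    show "x \<in> cell N n \<longleftrightarrow> x \<in> {a..<b}"
      using ridx_le_iff[OF N _ a(1), of x] ridx_le_iff[OF N _ b(1), of x] a(1) b(1) ya
      by (auto simp: cell_def not_le[symmetric])
  qed
  ultimately show thesis using that a b by auto
qed

text \<open>The end points depend on the cell and not on the density, so pointwise convergence of
  distribution functions gives convergence of masses. A cell is closed on the left while differences
  of \<open>dist_fun\<close> are closed on the right; points being null reconciles the two.\<close>

lemma mass_dist_fun:
  assumes "n \<in> {1..N}"
  obtains a b where "a \<in> {0..k}" "b \<in> {0..k}" "\<And>\<rho>. \<rho> \<in> adm \<Longrightarrow> mass \<rho> N n = dist_fun \<rho> b - dist_fun \<rho> a"
proof -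
  obtain a b where ab: "0 \<le> a" "a \<le> b" "b \<le> k" "cell N n = {a..<b}" using cell_interval[OF assms] by metis
  show thesis
  proof (rule that[of a b])
    fix \<rho> assume \<rho>: "\<rho> \<in> adm"
    interpret finite_measure "\<nu> \<rho>" by (rule fin_\<nu>[OF \<rho>])
    have "measure (\<nu> \<rho>) {a..<b} = measure (\<nu> \<rho>) {a<..b}"
    proof (rule finite_measure_eq_AE)
      show "AE x in \<nu> \<rho>. (x \<in> {a..<b}) = (x \<in> {a<..b})"
        using AE_\<nu>[OF \<rho> AE_L_neq[of a]] AE_\<nu>[OF \<rho> AE_L_neq[of b]] by eventually_elim auto
    qed (use ab in \<open>auto intro!: L_sets\<close>)
    then show "mass \<rho> N n = dist_fun \<rho> b - dist_fun \<rho> a"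
      using dist_fun_diff[OF \<rho> ab(1-3)] ab(4) by (simp add: mass_def)
  qed (use ab in auto)
qed

lemma equi_exists: "continuous_on {0..k} V \<Longrightarrow> 0 < e \<Longrightarrow> \<exists>\<tau>>0. equi \<tau> e V"
proof -
  assume V: "continuous_on {0..k} V" and e: "0 < e"
  then have "uniformly_continuous_on {0..k} V" by (intro compact_uniformly_continuous) auto
  then obtain d where d: "0 < d" "\<And>a b. a \<in> {0..k} \<Longrightarrow> b \<in> {0..k} \<Longrightarrow> dist b a < d \<Longrightarrow> dist (V b) (V a) < e"
    using e unfolding uniformly_continuous_on_def by metis
  have "\<bar>V a - V b\<bar> \<le> e" if "a \<in> {0..k}" "b \<in> {0..k}" "\<bar>a - b\<bar> < d" for a b
    using d(2)[of b a] that by (simp add: dist_real_def)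
  then show ?thesis using d V by (auto simp: equi_def)
qed

lemma energy_bounded: "continuous_on {0..k} V \<Longrightarrow> \<exists>B. \<forall>\<rho>\<in>adm. \<bar>energy V \<rho>\<bar> \<le> B"
proof -
  assume V: "continuous_on {0..k} V"
  then have "bounded (V ` {0..k})" by (intro compact_imp_bounded compact_continuous_image) auto
  then obtain B where B: "\<And>a. a \<in> {0..k} \<Longrightarrow> \<bar>V a\<bar> \<le> B" unfolding bounded_iff real_norm_def by blast
  obtain P where P: "0 \<le> P" "\<And>\<rho> a. \<rho> \<in> adm \<Longrightarrow> a \<in> {0..k} \<Longrightarrow> \<bar>pot \<rho> a\<bar> \<le> P" using pot_bounded by metis
  have B0: "0 \<le> B" using B[of 0] k_pos by simp
  have "\<bar>energy V \<rho>\<bar> \<le> (B + P) * R 0" if \<rho>: "\<rho> \<in> adm" for \<rho>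
  proof -
    interpret finite_measure "\<nu> \<rho>" by (rule fin_\<nu>[OF \<rho>])
    have "\<bar>energy V \<rho>\<bar> \<le> (\<integral>a. \<bar>V a + pot \<rho> a / (2 * pi)\<bar> \<partial>\<nu> \<rho>)"
      unfolding energy_def by (rule integral_abs_bound)
    also have "\<dots> \<le> (\<integral>a. B + P \<partial>\<nu> \<rho>)"
    proof (rule integral_mono)
      fix a assume "a \<in> space (\<nu> \<rho>)"
      then have a: "a \<in> {0..k}" by simp
      have "\<bar>pot \<rho> a\<bar> / \<bar>2 * pi\<bar> \<le> P / 1"
        using P(2)[OF \<rho> a] P(1) pi_gt3 by (intro frac_le) auto
      then have "\<bar>pot \<rho> a / (2 * pi)\<bar> \<le> P" by (simp only: abs_divide div_by_1)
      then show "\<bar>V a + pot \<rho> a / (2 * pi)\<bar> \<le> B + P" using B[OF a] by linarith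
    qed (use integrable_V[OF \<rho> V] integrable_pot[OF \<rho>] in auto)
    also have "\<dots> = (B + P) * measure (\<nu> \<rho>) {0..k}" by simp
    also have "\<dots> \<le> (B + P) * R 0"
      using measure_\<nu>_space[OF \<rho>] B0 P(1) by (intro mult_left_mono) auto
    finally show ?thesis .
  qed
  then show ?thesis by blast
qed

theorem energy_minimizer:
  assumes V: "continuous_on {0..k} V"
  shows "\<exists>\<rho>\<in>adm. \<forall>\<sigma>\<in>adm. energy V \<rho> \<le> energy V \<sigma>"
proof -
  define m where "m = Inf (energy V ` adm)"
  obtain B where B: "\<And>\<rho>. \<rho> \<in> adm \<Longrightarrow> \<bar>energy V \<rho>\<bar> \<le> B" using energy_bounded[OF V] by metis
  have "bdd_below (energy V ` adm)"
    using B by (intro bdd_belowI2[of _ "-B"]) (force simp: abs_le_iff)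
  then have m: "m \<le> energy V \<sigma>" if "\<sigma> \<in> adm" for \<sigma>
    unfolding m_def using that by (intro cInf_lower) auto
  have "\<exists>\<rho>. \<rho> \<in> adm \<and> energy V \<rho> < m + 1 / real (Suc j)" for j
    using cInf_lessD[of "energy V ` adm" "m + 1 / real (Suc j)"] w_adm by (auto simp: m_def)
  then obtain \<rho> where \<rho>: "\<And>j. \<rho> j \<in> adm" "\<And>j. energy V (\<rho> j) < m + 1 / real (Suc j)" by metis
  obtain \<sigma> s where \<sigma>: "\<sigma> \<in> adm" "strict_mono (s :: nat \<Rightarrow> nat)"
    "\<And>a. a \<in> {0..k} \<Longrightarrow> (\<lambda>j. dist_fun (\<rho> (s j)) a) \<longlonglongrightarrow> dist_fun \<sigma> a"
    by (rule adm_compact[of \<rho>, OF \<rho>(1)]) (rule that)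
  have elim: "(\<lambda>j. m + 1 / real (Suc (s j))) \<longlonglongrightarrow> m + 0"
    using LIMSEQ_subseq_LIMSEQ[OF lim_1_over_n[THEN LIMSEQ_Suc] \<sigma>(2)]
    by (intro tendsto_add tendsto_const) (simp add: o_def)
  have Kp: "0 < err_const" using R_pos by (simp add: err_const_def)
  have "energy V \<sigma> \<le> m + e" if e: "0 < e" for e
  proof -
    \<comment> \<open>Half of e for each of two approximations by cell energies: along the
      minimizing sequence and at its limit.\<close>
    define e' where "e' = e / (2 * err_const)"
    have e': "0 < e'" "2 * (e' * err_const) = e" using e Kp by (auto simp: e'_def)
    obtain r \<tau> where r: "0 < \<tau>"
      "\<And>V \<rho> N \<tau>'. \<tau>' \<le> \<tau> \<Longrightarrow> equi \<tau>' e' V \<Longrightarrow> \<rho> \<in> adm \<Longrightarrow> fine_mesh \<tau>' N \<Longrightarrow> \<bar>energy V \<rho> - cell_energy r N V (mass \<rho> N)\<bar> \<le> e' * err_const"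
      by (rule energy_cell_energy[OF e'(1)]) blast
    obtain \<tau>' where t': "0 < \<tau>'" "equi \<tau>' e' V" using equi_exists[OF V e'(1)] by auto
    define \<tau>0 where "\<tau>0 = min \<tau> \<tau>'"
    have t0: "0 < \<tau>0" "\<tau>0 \<le> \<tau>" "equi \<tau>0 e' V" using r(1) t' by (auto simp: \<tau>0_def equi_def)
    obtain N where N: "fine_mesh \<tau>0 N"
      using eventually_happens'[OF sequentially_bot eventually_fine[OF t0(1)]] by blast
    note approx = r(2)[OF t0(2,3) _ N]
    have mlim: "(\<lambda>j. mass (\<rho> (s j)) N n) \<longlonglongrightarrow> mass \<sigma> N n" if n: "n \<in> {1..N}" for n
    proof -
      obtain a b where ab: "a \<in> {0..k}" "b \<in> {0..k}" "\<And>\<rho>. \<rho> \<in> adm \<Longrightarrow> mass \<rho> N n = dist_fun \<rho> b - dist_fun \<rho> a"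
        by (rule mass_dist_fun[OF n]) (rule that)
      show ?thesis unfolding ab(3)[OF \<rho>(1)] ab(3)[OF \<sigma>(1)] by (intro tendsto_diff \<sigma>(3) ab)
    qed
    \<comment> \<open>\<open>N\<close> and \<open>r\<close> are fixed before j tends to infinity, so
      this is continuity of a polynomial in finitely many masses.\<close>
    have "(\<lambda>j. cell_energy r N V (mass (\<rho> (s j)) N)) \<longlonglongrightarrow> cell_energy r N V (mass \<sigma> N)"
      unfolding cell_energy_def
      by (intro tendsto_add tendsto_divide tendsto_sum tendsto_mult tendsto_const mlim; simp)
    then have "cell_energy r N V (mass \<sigma> N) \<le> (m + 0) + e' * err_const"
    proof (rule LIMSEQ_le[OF _ tendsto_add[OF elim tendsto_const]])
      have "cell_energy r N V (mass (\<rho> (s j)) N) \<le> m + 1 / real (Suc (s j)) + e' * err_const" for j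
        using approx[OF \<rho>(1)[of "s j"]] \<rho>(2)[of "s j"] by linarith
      then show "\<exists>M. \<forall>j\<ge>M. cell_energy r N V (mass (\<rho> (s j)) N) \<le> m + 1 / real (Suc (s j)) + e' * err_const" by blast
    qed
    then show ?thesis using approx[OF \<sigma>(1)] e'(2) by linarith
  qed
  then have "energy V \<sigma> \<le> m" by (rule field_le_epsilon)
  then show ?thesis using \<sigma>(1) m by (intro bexI[of _ \<sigma>]) (auto intro: order_trans)
qed

theorem discrete_uniform_limit:
  assumes V: "\<And>e. 0 < e \<Longrightarrow> \<exists>\<tau>>0. \<forall>p\<in>K. equi \<tau> e (V p)"
  shows "uniform_limit K (\<lambda>N p. Min (node_energy N (V p) ` Pow {1..N})) (\<lambda>p. Inf (energy (V p) ` adm)) sequentially"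
proof (rule uniform_limitI)
  fix \<epsilon> :: real assume \<epsilon>: "0 < \<epsilon>"
  \<comment> \<open>\<open>err_const\<close> pays for the passage to cell energies, and
    \<open>3 * R 0\<close> for the larger of the losses in \<open>upper_discrete\<close> and
    \<open>lower_discrete\<close>.\<close>
  define e where "e = \<epsilon> / (2 * (err_const + 3 * R 0))"
  have Kp: "0 < err_const" using R_pos by (simp add: err_const_def)
  then have e: "0 < e" "e * (err_const + 3 * R 0) = \<epsilon> / 2" using \<epsilon> R_pos by (auto simp: e_def field_simps)
  obtain r \<tau> where r: "0 < r" "r \<le> 1" "0 < \<tau>"
    "\<And>a. a \<in> {0..k} \<Longrightarrow> (\<integral>\<^sup>+b. ennreal (sing r a b) \<partial>\<mu>) \<le> ennreal e"
    "\<And>V \<rho> N \<tau>'. \<tau>' \<le> \<tau> \<Longrightarrow> equi \<tau>' e V \<Longrightarrow> \<rho> \<in> adm \<Longrightarrow> fine_mesh \<tau>' N \<Longrightarrow> \<bar>energy V \<rho> - cell_energy r N V (mass \<rho> N)\<bar> \<le> e * err_const"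
    by (rule energy_cell_energy[OF e(1)]) blast
  obtain \<tau>' where t': "0 < \<tau>'" "\<And>p. p \<in> K \<Longrightarrow> equi \<tau>' e (V p)" using V[OF e(1)] by blast
  define \<tau>0 where "\<tau>0 = min \<tau> \<tau>'"
  have t0: "0 < \<tau>0" "\<tau>0 \<le> \<tau>" "\<And>p. p \<in> K \<Longrightarrow> equi \<tau>0 e (V p)"
    using r(3) t' by (auto simp: \<tau>0_def equi_def)
  have small: "\<forall>\<^sub>F N in sequentially. mesh N * c \<le> e" for c
  proof -
    have "(\<lambda>N. mesh N * c) \<longlonglongrightarrow> 0 * c" by (intro tendsto_mult mesh_tendsto tendsto_const)
    then have "\<forall>\<^sub>F N in sequentially. mesh N * c < e" by (rule order_tendstoD(2)) (use e in simp)
    then show ?thesis by eventually_elim simp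
  qed
  show "\<forall>\<^sub>F N in sequentially. \<forall>p\<in>K. dist (Min (node_energy N (V p) ` Pow {1..N})) (Inf (energy (V p) ` adm)) < \<epsilon>"
    using eventually_fine[OF t0(1)] small[of "ln (C0 / r)"] small[of "ln (2 * k + 1)"]
  proof eventually_elim
    case (elim N)
    have N: "1 \<le> N" using elim(1) by (simp add: fine_mesh_def)
    show ?case
    proof
      fix p assume p: "p \<in> K"
      have cV: "continuous_on {0..k} (V p)" using t0(3)[OF p] by (simp add: equi_def)
      note approx = r(5)[OF t0(2) t0(3)[OF p] _ elim(1)]
      obtain \<rho> where \<rho>: "\<rho> \<in> adm" "\<And>\<sigma>. \<sigma> \<in> adm \<Longrightarrow> energy (V p) \<rho> \<le> energy (V p) \<sigma>"
        using energy_minimizer[OF cV] by blast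
      have inf: "Inf (energy (V p) ` adm) = energy (V p) \<rho>"
        using \<rho> by (intro cInf_eq_minimum) auto
      have fin: "finite (node_energy N (V p) ` Pow {1..N})" by simp
      obtain S where S: "S \<subseteq> {1..N}" "node_energy N (V p) S \<le> cell_energy r N (V p) (mass \<rho> N) + 2 * e * R 0"
        using upper_discrete[OF \<rho>(1) N r(1,2,4) less_imp_le[OF e(1)] elim(2,3)] by blast
      have "Min (node_energy N (V p) ` Pow {1..N}) \<le> node_energy N (V p) S" using S(1) by (intro Min_le fin) auto
      then have up: "Min (node_energy N (V p) ` Pow {1..N}) \<le> energy (V p) \<rho> + e * err_const + 2 * e * R 0"
        using S(2) approx[OF \<rho>(1)] by linarith
      have "Min (node_energy N (V p) ` Pow {1..N}) \<in> node_energy N (V p) ` Pow {1..N}" by (intro Min_in fin) auto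
      then obtain S' where S': "S' \<subseteq> {1..N}" "Min (node_energy N (V p) ` Pow {1..N}) = node_energy N (V p) S'" by auto
      obtain \<sigma> where \<sigma>: "\<sigma> \<in> adm" "cell_energy r N (V p) (mass \<sigma> N) \<le> node_energy N (V p) S' + 3 * e * R 0"
        using lower_discrete[OF S'(1) N r(1,2,4) less_imp_le[OF e(1)] elim(2)] by blast
      have low: "energy (V p) \<rho> \<le> Min (node_energy N (V p) ` Pow {1..N}) + e * err_const + 3 * e * R 0"
        using \<sigma>(2) approx[OF \<sigma>(1)] \<rho>(2)[OF \<sigma>(1)] S'(2) by linarith
      have "e * err_const + 3 * e * R 0 = \<epsilon> / 2" using e(2) by (simp add: algebra_simps)
      moreover have "0 \<le> e * R 0" using e(1) R_pos by simp
      ultimately show "dist (Min (node_energy N (V p) ` Pow {1..N})) (Inf (energy (V p) ` adm)) < \<epsilon>"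
        using up low \<epsilon> unfolding inf dist_real_def by linarith
    qed
  qed
qed

end

section \<open>The complex branches of the Lambert function\<close>

text \<open>On the curve w = -\<theta> cot \<theta> + i \<theta>, 0 < \<theta> < pi, the product w
  exp w is real below -1/e and equals \<open>- exp (level \<theta> - 1)\<close>. The value at
  \<theta> = 0 is the limit, reached at the branch point -1/e.\<close>

definition level :: "real \<Rightarrow> real" where
  "level \<theta> = (if \<theta> = 0 then 0 else ln (\<theta> / sin \<theta>) - \<theta> * cot \<theta> + 1)"

lemma level_0: "level 0 = 0" by (simp add: level_def)

lemma level_deriv:
  assumes "0 < \<theta>" "\<theta> < pi"
  shows "(level has_real_derivative ((1 - \<theta> * cot \<theta>)\<^sup>2 + \<theta>\<^sup>2) / \<theta>) (at \<theta>)"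
proof -
  have s: "0 < sin \<theta>" using assms by (rule sin_gt_zero)
  have "((\<lambda>\<theta>. ln (\<theta> / sin \<theta>) - \<theta> * cot \<theta> + 1) has_real_derivative
      (1 / (\<theta> / sin \<theta>)) * ((1 * sin \<theta> - \<theta> * cos \<theta>) / (sin \<theta> * sin \<theta>)) - (1 * cot \<theta> + - inverse ((sin \<theta>)\<^sup>2) * \<theta>) + 0) (at \<theta>)"
    using s assms by (intro derivative_intros DERIV_cot) auto
  moreover have "(1 / (\<theta> / sin \<theta>)) * ((1 * sin \<theta> - \<theta> * cos \<theta>) / (sin \<theta> * sin \<theta>)) - (1 * cot \<theta> + - inverse ((sin \<theta>)\<^sup>2) * \<theta>) + 0
     = ((1 - \<theta> * cot \<theta>)\<^sup>2 + \<theta>\<^sup>2) / \<theta>"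
  proof -
    have "((1 - \<theta> * c / s)\<^sup>2 + \<theta>\<^sup>2) / \<theta> = 1 / \<theta> - 2 * (c / s) + \<theta> * (c\<^sup>2 + s\<^sup>2) / s\<^sup>2" if "s \<noteq> 0" for c s
      using that assms by (simp add: field_simps power2_eq_square)
    from this[of "sin \<theta>" "cos \<theta>"] show ?thesis
      using s assms by (simp add: cot_def field_simps power2_eq_square)
  qed
  ultimately have "((\<lambda>\<theta>. ln (\<theta> / sin \<theta>) - \<theta> * cot \<theta> + 1) has_real_derivative ((1 - \<theta> * cot \<theta>)\<^sup>2 + \<theta>\<^sup>2) / \<theta>) (at \<theta>)"
    by simp
  then show ?thesis
    by (rule has_field_derivative_transform_within_open[of _ _ _ "{0<..}"]) (use assms in \<open>auto simp: level_def\<close>)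
qed

lemma level_cont: "b < pi \<Longrightarrow> continuous_on {0..b} level"
  unfolding continuous_on_eq_continuous_within
proof
  fix x assume b: "b < pi" and x: "x \<in> {0..b}"
  show "continuous (at x within {0..b}) level"
  proof (cases "x = 0")
    case True
    have "((\<lambda>\<theta>::real. ln (\<theta> / sin \<theta>) - \<theta> * (cos \<theta> / sin \<theta>) + 1) \<longlongrightarrow> 0) (at_right 0)" by real_asymp
    then have "(level \<longlongrightarrow> 0) (at_right 0)"
      by (rule Lim_transform_eventually) (auto simp: eventually_at_filter level_def cot_def)
    then have "(level \<longlongrightarrow> 0) (at 0 within {0..})" by (simp add: at_within_Ici_at_right)
    then have "(level \<longlongrightarrow> 0) (at 0 within {0..b})" by (rule tendsto_within_subset) auto
    then show ?thesis using True by (simp add: continuous_within level_def)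
  next
    case False
    then show ?thesis
      using x b level_deriv[of x] by (auto intro!: continuous_at_imp_continuous_at_within DERIV_isCont)
  qed
qed

text \<open>The derivative of \<open>level\<close> exceeds \<theta> by (1 - \<theta> cot \<theta>)^2
  / \<theta>. Quadratic growth of \<open>level\<close> becomes the square-root modulus of its
  inverse \<open>angle\<close>.\<close>

lemma level_increase:
  assumes "0 \<le> a" "a \<le> b" "b < pi"
  shows "(b\<^sup>2 - a\<^sup>2) / 2 \<le> level b - level a"
proof -
  have "level a - a\<^sup>2 / 2 \<le> level b - b\<^sup>2 / 2"
  proof (rule DERIV_nonneg_imp_increasing_open[OF assms(2)])
    fix x assume x: "a < x" "x < b"
    have "((\<lambda>x. level x - x\<^sup>2 / 2) has_real_derivative ((1 - x * cot x)\<^sup>2 + x\<^sup>2) / x - x) (at x)"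
      using x assms by (auto intro!: derivative_eq_intros level_deriv)
    moreover have "((1 - x * cot x)\<^sup>2 + x\<^sup>2) / x - x = (1 - x * cot x)\<^sup>2 / x"
      using x assms by (simp add: field_simps power2_eq_square)
    ultimately show "\<exists>y. ((\<lambda>x. level x - x\<^sup>2 / 2) has_real_derivative y) (at x) \<and> 0 \<le> y"
      using x assms by auto
  next
    show "continuous_on {a..b} (\<lambda>x. level x - x\<^sup>2 / 2)"
      using assms by (intro continuous_intros continuous_on_subset[OF level_cont[of b]]) auto
  qed
  then show ?thesis by (simp add: diff_divide_distrib)
qed

lemma level_strict: "0 \<le> a \<Longrightarrow> a < b \<Longrightarrow> b < pi \<Longrightarrow> level a < level b"
  using level_increase[of a b] power_strict_mono[of a b 2] by auto

lemma level_inj: "0 \<le> a \<Longrightarrow> a < pi \<Longrightarrow> 0 \<le> b \<Longrightarrow> b < pi \<Longrightarrow> level a = level b \<longleftrightarrow> a = b"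
  using level_strict[of a b] level_strict[of b a] by (cases a b rule: linorder_cases) auto

lemma level_surj:
  assumes "0 \<le> s"
  obtains \<theta> where "0 \<le> \<theta>" "\<theta> < pi" "level \<theta> = s"
proof -
  \<comment> \<open>Here x = pi - \<theta>, which moves the divergence at \<theta> = pi to x = 0;
    the cotangent changes sign, hence the plus.\<close>
  have "filterlim (\<lambda>x::real. ln ((pi - x) / sin x) + (pi - x) * (cos x / sin x) + 1) at_top (at_right 0)"
    by real_asymp
  then have "\<forall>\<^sub>F x in at_right 0. s \<le> ln ((pi - x) / sin x) + (pi - x) * (cos x / sin x) + 1"
    by (auto simp: filterlim_at_top)
  moreover have "\<forall>\<^sub>F x::real in at_right 0. x < pi" "\<forall>\<^sub>F x::real in at_right 0. 0 < x"
    by real_asymp+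
  ultimately have "\<forall>\<^sub>F x in at_right 0. s \<le> level (pi - x) \<and> 0 < x \<and> x < pi"
    by eventually_elim (simp add: level_def cot_def)
  from eventually_happens'[OF trivial_limit_at_right_real this]
  obtain x where x: "s \<le> level (pi - x)" "0 < x" "x < pi" by blast
  obtain \<theta> where "0 \<le> \<theta>" "\<theta> \<le> pi - x" "level \<theta> = s"
    using IVT'[of level 0 s "pi - x"] x assms level_cont[of "pi - x"] by (auto simp: level_def)
  then show thesis using that x by auto
qed

lemma Complex_cot: "sin \<theta> \<noteq> 0 \<Longrightarrow> Complex (- \<theta> * cot \<theta>) \<theta> = - of_real (\<theta> / sin \<theta>) * cis (- \<theta>)"
  by (simp add: complex_eq_iff cot_def)

text \<open>In polar form the point is -(\<theta> / sin \<theta>) exp(-i \<theta>), whose phase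
  cancels that of its exponential.\<close>

lemma lambert_point:
  assumes "0 < \<theta>" "\<theta> < pi"
  shows "Complex (- \<theta> * cot \<theta>) \<theta> * exp (Complex (- \<theta> * cot \<theta>) \<theta>) = complex_of_real (- exp (level \<theta> - 1))"
proof -
  have s: "0 < sin \<theta>" using assms by (rule sin_gt_zero)
  have "exp (Complex (- \<theta> * cot \<theta>) \<theta>) = of_real (exp (- \<theta> * cot \<theta>)) * cis \<theta>"
    by (simp add: exp_eq_polar)
  then have "Complex (- \<theta> * cot \<theta>) \<theta> * exp (Complex (- \<theta> * cot \<theta>) \<theta>) =
     - of_real (\<theta> / sin \<theta>) * of_real (exp (- \<theta> * cot \<theta>)) * (cis (- \<theta>) * cis \<theta>)"
    using s by (subst Complex_cot) auto
  also have "\<dots> = of_real (- (\<theta> / sin \<theta>) * exp (- \<theta> * cot \<theta>))" by (simp add: cis_mult)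
  also have "- (\<theta> / sin \<theta>) * exp (- \<theta> * cot \<theta>) = - exp (level \<theta> - 1)"
    using assms s by (simp add: level_def exp_diff exp_minus field_simps)
  finally show ?thesis .
qed

text \<open>For uniqueness, vanishing of Im (w exp w) forces Re w = - Im w cot (Im w), which puts w
  on the curve; injectivity of \<open>level\<close> then fixes its height.\<close>

lemma lambertW0_level:
  assumes "0 < \<theta>" "\<theta> < pi"
  shows "lambertW0 (- exp (level \<theta> - 1)) = Complex (- \<theta> * cot \<theta>) \<theta>"
proof -
  have "0 < level \<theta>" using level_strict[of 0 \<theta>] assms by (simp add: level_def)
  then have "\<not> (- exp (-1) \<le> - exp (level \<theta> - 1))" by simp
  then have "lambertW0 (- exp (level \<theta> - 1)) =
     (THE w. w * exp w = complex_of_real (- exp (level \<theta> - 1)) \<and> 0 < Im w \<and> Im w < pi)"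
    by (simp only: lambertW0_def if_False)
  also have "\<dots> = Complex (- \<theta> * cot \<theta>) \<theta>"
  proof (rule the_equality)
    show "Complex (- \<theta> * cot \<theta>) \<theta> * exp (Complex (- \<theta> * cot \<theta>) \<theta>) = complex_of_real (- exp (level \<theta> - 1)) \<and>
      0 < Im (Complex (- \<theta> * cot \<theta>) \<theta>) \<and> Im (Complex (- \<theta> * cot \<theta>) \<theta>) < pi"
      using lambert_point[OF assms] assms by simp
    fix w assume w: "w * exp w = complex_of_real (- exp (level \<theta> - 1)) \<and> 0 < Im w \<and> Im w < pi"
    define a b where "a = Re w" and "b = Im w"
    have b: "0 < b" "b < pi" using w by (auto simp: b_def)
    then have s: "0 < sin b" by (rule sin_gt_zero)
    have "Im (w * exp w) = 0" using w by simp
    then have "exp a * (a * sin b + b * cos b) = 0"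
      by (simp add: a_def b_def Im_exp Re_exp algebra_simps)
    then have "a * sin b + b * cos b = 0" by simp
    then have ab: "a = - b * cot b" using s by (simp add: cot_def field_simps)
    then have wb: "w = Complex (- b * cot b) b" by (simp add: complex_eq_iff a_def b_def)
    have "complex_of_real (- exp (level b - 1)) = complex_of_real (- exp (level \<theta> - 1))"
      using w lambert_point[OF b] unfolding wb[symmetric] by simp
    then have "level b = level \<theta>" by (simp only: of_real_eq_iff neg_equal_iff_equal exp_inj_iff)
    then have "b = \<theta>" using level_inj[of b \<theta>] b assms by simp
    then show "w = Complex (- \<theta> * cot \<theta>) \<theta>" using wb by simp
  qed
  finally show ?thesis .
qed

text \<open>By \<open>lambertW0_level\<close> this is the inverse of \<open>level\<close> on \<open>{0..}\<close>, and it vanishes on the real branches.\<close>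

definition angle :: "real \<Rightarrow> real" where "angle s = - Im (lambertWm1 (- exp (s - 1)))"

lemma angle_nonpos: "s \<le> 0 \<Longrightarrow> angle s = 0"
  by (simp add: angle_def lambertWm1_def)

lemma angle_level:
  assumes "0 \<le> \<theta>" "\<theta> < pi"
  shows "angle (level \<theta>) = \<theta>"
proof (cases "\<theta> = 0")
  case False
  then have "0 < level \<theta>" using level_strict[of 0 \<theta>] assms by (simp add: level_def)
  then show ?thesis using False assms lambertW0_level[of \<theta>] by (simp add: angle_def lambertWm1_def)
qed (simp add: level_def angle_nonpos)

lemma angle:
  assumes "0 \<le> s"
  shows "0 \<le> angle s" "angle s < pi" "level (angle s) = s"
proof -
  obtain \<theta> where "0 \<le> \<theta>" "\<theta> < pi" "level \<theta> = s" using level_surj[OF assms] by metis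
  then show "0 \<le> angle s" "angle s < pi" "level (angle s) = s" using angle_level[of \<theta>] by auto
qed

lemma angle_strict: "0 \<le> s \<Longrightarrow> s < t \<Longrightarrow> angle s < angle t"
  using angle[of s] angle[of t] level_strict[of "angle t" "angle s"] by (cases "angle s" "angle t" rule: linorder_cases) auto

text \<open>For 0 <= a <= b one has (b - a)^2 <= b^2 - a^2, and \<open>level_increase\<close> bounds
  the latter by twice the difference of levels. Negative arguments reduce to 0, where
  \<open>angle\<close> starts to grow.\<close>

lemma angle_increment:
  assumes "s \<le> t"
  shows "0 \<le> angle t - angle s" "angle t - angle s \<le> sqrt (2 * (t - s))"
proof -
  have *: "0 \<le> angle t - angle s \<and> angle t - angle s \<le> sqrt (2 * (t - s))" if "0 \<le> s" "s \<le> t" for s t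
  proof -
    have t: "0 \<le> t" using that by simp
    have m: "angle s \<le> angle t" using angle_strict[of s t] that by (cases "s = t") auto
    have "(angle t - angle s)\<^sup>2 \<le> (angle t)\<^sup>2 - (angle s)\<^sup>2"
    proof -
      have "angle s * angle s \<le> angle s * angle t" using m angle(1)[OF that(1)] by (intro mult_left_mono) auto
      then show ?thesis by (simp add: power2_eq_square algebra_simps)
    qed
    also have "\<dots> \<le> 2 * (level (angle t) - level (angle s))"
      using level_increase[of "angle s" "angle t"] m angle[OF that(1)] angle[OF t] by simp
    finally have "(angle t - angle s)\<^sup>2 \<le> 2 * (t - s)" using angle[OF that(1)] angle[OF t] by simp
    then have "angle t - angle s \<le> sqrt (2 * (t - s))" by (rule real_le_rsqrt)
    then show ?thesis using m by simp
  qed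
  show "0 \<le> angle t - angle s" "angle t - angle s \<le> sqrt (2 * (t - s))"
  proof -
    consider "t \<le> 0" | "s \<le> 0" "0 \<le> t" | "0 \<le> s" using assms by linarith
    then have "0 \<le> angle t - angle s \<and> angle t - angle s \<le> sqrt (2 * (t - s))"
    proof cases
      case 2
      have "sqrt (2 * (t - 0)) \<le> sqrt (2 * (t - s))" using 2 by (intro real_sqrt_le_mono) auto
      moreover have "angle s = 0" "angle 0 = 0" using 2 by (auto intro: angle_nonpos)
      ultimately show ?thesis using *[OF order_refl 2(2)] by (intro conjI; linarith)
    qed (use * assms in \<open>auto simp: angle_nonpos\<close>)
    then show "0 \<le> angle t - angle s" "angle t - angle s \<le> sqrt (2 * (t - s))" by auto
  qed
qed

lemma angle_cont: "continuous_on UNIV angle"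
  unfolding continuous_on_iff
proof (intro ballI allI impI)
  fix x e :: real assume e: "0 < e"
  have "\<bar>angle y - angle x\<bar> < e" if "\<bar>y - x\<bar> < e\<^sup>2 / 2" for y
  proof -
    have "\<bar>angle y - angle x\<bar> \<le> sqrt (2 * \<bar>y - x\<bar>)"
      using angle_increment[of x y] angle_increment[of y x] by (cases "x \<le> y") auto
    also have "\<dots> < sqrt (e\<^sup>2)" using that by (intro real_sqrt_less_mono) auto
    finally show ?thesis using e by simp
  qed
  then show "\<exists>d>0. \<forall>x'\<in>UNIV. dist x' x < d \<longrightarrow> dist (angle x') (angle x) < e"
    using e by (intro exI[of _ "e\<^sup>2 / 2"]) (auto simp: dist_real_def)
qed

section \<open>The curve zeta, its level and the argument a in real form\<close>

lemma zeta_scaled: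
  assumes "0 < d"
  shows "2 * of_real d * zeta d \<kappa> = (if \<kappa> = 0 then 1 else Complex (2 * d * \<kappa> * cot (2 * d * \<kappa>)) (2 * d * \<kappa>))"
  using assms by (auto simp: zeta_def complex_eq_iff)

text \<open>The real form of E(zeta(\<kappa>)); the turning points are where \<open>u0\<close> takes
  this value.\<close>

definition height :: "real \<Rightarrow> real \<Rightarrow> real" where "height d \<kappa> = level (2 * d * \<kappa>) / (2 * d)"

lemma Re_Efun:
  assumes "0 < d" "0 \<le> \<kappa>" "2 * d * \<kappa> < pi"
  shows "Re (Efun d (zeta d \<kappa>)) = height d \<kappa>"
proof (cases "\<kappa> = 0")
  case True
  have "Efun d (zeta d 0) = 0"
    using assms zeta_scaled[of d 0] by (simp add: Efun_def zeta_def)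
  then show ?thesis using True by (simp add: height_def level_def)
next
  case False
  define \<theta> where "\<theta> = 2 * d * \<kappa>"
  have \<theta>: "0 < \<theta>" "\<theta> < pi" using assms False by (auto simp: \<theta>_def)
  then have s: "0 < sin \<theta>" by (intro sin_gt_zero)
  have z: "2 * of_real d * zeta d \<kappa> = - cnj (Complex (- \<theta> * cot \<theta>) \<theta>)"
    using False zeta_scaled[OF assms(1), of \<kappa>] by (simp add: \<theta>_def complex_eq_iff)
  have "cmod (2 * of_real d * zeta d \<kappa>) = \<theta> / sin \<theta>"
    unfolding z using s \<theta> by (subst Complex_cot) (auto simp: norm_mult norm_divide)
  moreover have "2 * of_real d * zeta d \<kappa> \<noteq> 0" unfolding z using \<theta> by (simp add: complex_eq_iff)
  ultimately have "Re (Ln (2 * of_real d * zeta d \<kappa>)) = ln (\<theta> / sin \<theta>)" by (simp add: Re_Ln)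
  moreover have "Re ((1 + Ln (2 * of_real d * zeta d \<kappa>)) / (2 * of_real d)) = (1 + Re (Ln (2 * of_real d * zeta d \<kappa>))) / (2 * d)"
    using Re_divide_of_real[of "1 + Ln (2 * of_real d * zeta d \<kappa>)" "2 * d"] by simp
  ultimately show ?thesis
    using False assms \<theta> by (simp add: Efun_def height_def level_def zeta_def \<theta>_def field_simps)
qed

text \<open>With W = 2 d zeta, the factor -W exp(-W) is the conjugate of the product in
  \<open>lambert_point\<close>, hence real. The sign of \<open>height d \<kappa> - u\<close> decides
  on which side of -1/e the argument lies: complex branches below the level of the turning points,
  real ones above.\<close>

lemma Re_aa:
  assumes "0 < d" "0 \<le> \<kappa>" "2 * d * \<kappa> < pi"
  shows "Re (aa d \<kappa> u) = - exp (2 * d * (height d \<kappa> - u) - 1)"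
proof -
  define W where "W = 2 * of_real d * zeta d \<kappa>"
  have "aa d \<kappa> u = - W * exp (- W) * exp (of_real (- 2 * d * u))"
    by (simp add: aa_def W_def distrib_left mult_exp_exp)
  moreover have "- W * exp (- W) = of_real (- exp (level (2 * d * \<kappa>) - 1))"
  proof (cases "\<kappa> = 0")
    case True
    then have "W = 1" using zeta_scaled[OF assms(1), of 0] by (simp add: W_def)
    then show ?thesis using True by (simp add: level_def flip: exp_of_real)
  next
    case False
    define \<theta> where "\<theta> = 2 * d * \<kappa>"
    have \<theta>: "0 < \<theta>" "\<theta> < pi" using assms False by (auto simp: \<theta>_def)
    have "- W = cnj (Complex (- \<theta> * cot \<theta>) \<theta>)"
      using False zeta_scaled[OF assms(1), of \<kappa>] by (simp add: \<theta>_def W_def complex_eq_iff)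
    then have "- W * exp (- W) = cnj (Complex (- \<theta> * cot \<theta>) \<theta> * exp (Complex (- \<theta> * cot \<theta>) \<theta>))"
      by (simp add: exp_cnj)
    also have "\<dots> = of_real (- exp (level \<theta> - 1))" unfolding lambert_point[OF \<theta>] by simp
    finally show ?thesis by (simp add: \<theta>_def)
  qed
  ultimately have "aa d \<kappa> u = of_real (- exp (level (2 * d * \<kappa>) - 1) * exp (- 2 * d * u))"
    by (simp only: exp_of_real of_real_mult[symmetric])
  then have "Re (aa d \<kappa> u) = - exp (level (2 * d * \<kappa>) - 1) * exp (- 2 * d * u)" by (simp only: Re_complex_of_real)
  also have "\<dots> = - exp (2 * d * (height d \<kappa> - u) - 1)"
    using assms(1) by (simp add: height_def mult_exp_exp right_diff_distrib)
  finally show ?thesis .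
qed

lemma kmax_angle: "kmax d u = angle (2 * d * u) / (2 * d)"
proof -
  have "(- (1 / (2 * of_real d)) * X) = of_real (- 1 / (2 * d)) * X" for X :: complex by simp
  then show ?thesis unfolding kmax_def angle_def by (simp only: times_complex.sel Re_complex_of_real Im_complex_of_real) simp
qed

section \<open>The real branches of the Lambert function\<close>

text \<open>With w = -y, the equation w exp w = - exp (- 1 - s) becomes \<open>excess y = s\<close>
  for y > 0. The function falls to 0 at y = 1 and then rises; its two inverses are the real
  branches.\<close>

definition excess :: "real \<Rightarrow> real" where "excess y = y - 1 - ln y"

lemma excess_deriv: "0 < y \<Longrightarrow> (excess has_real_derivative (1 - 1 / y)) (at y)"
  unfolding excess_def[abs_def] by (auto intro!: derivative_eq_intros)

lemma excess_1: "excess 1 = 0" by (simp add: excess_def)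

lemma excess_cont: "0 < a \<Longrightarrow> continuous_on {a..b} excess"
  unfolding excess_def[abs_def] by (intro continuous_intros) auto

lemma excess_strict_dec:
  assumes "0 < a" "a < b" "b \<le> 1"
  shows "excess b < excess a"
proof (rule DERIV_neg_imp_decreasing_open[OF assms(2)])
  fix x assume "a < x" "x < b"
  then show "\<exists>y. (excess has_real_derivative y) (at x) \<and> y < 0"
    using assms by (intro exI[of _ "1 - 1 / x"] conjI excess_deriv) (auto simp: field_simps)
qed (rule excess_cont[OF assms(1)])

lemma excess_strict_inc:
  assumes "1 \<le> a" "a < b"
  shows "excess a < excess b"
proof (rule DERIV_pos_imp_increasing_open[OF assms(2)])
  fix x assume "a < x" "x < b"
  then show "\<exists>y. (excess has_real_derivative y) (at x) \<and> 0 < y"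
    using assms by (intro exI[of _ "1 - 1 / x"] conjI excess_deriv) (auto simp: field_simps)
qed (rule excess_cont, use assms in auto)

lemma excess_inj_lower: "0 < a \<Longrightarrow> a \<le> 1 \<Longrightarrow> 0 < b \<Longrightarrow> b \<le> 1 \<Longrightarrow> excess a = excess b \<Longrightarrow> a = b"
  using excess_strict_dec[of a b] excess_strict_dec[of b a] by (cases a b rule: linorder_cases) auto

lemma excess_inj_upper: "1 \<le> a \<Longrightarrow> 1 \<le> b \<Longrightarrow> excess a = excess b \<Longrightarrow> a = b"
  using excess_strict_inc[of a b] excess_strict_inc[of b a] by (cases a b rule: linorder_cases) auto

text \<open>\<open>f\<close> and \<open>h\<close> vanish at 1 and decrease, their derivatives being
  minus a square up to a positive factor. The bounds make the square-root behaviour of the branches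
  at -1/e explicit.\<close>

lemma excess_square_bounds:
  assumes "0 < y"
  shows "y \<le> 1 \<Longrightarrow> (1 - y)\<^sup>2 / 2 \<le> excess y" "1 \<le> y \<Longrightarrow> excess y \<le> (y - 1)\<^sup>2 / 2"
    "y \<le> 1 \<Longrightarrow> excess y \<le> (1 - y)\<^sup>2 / (2 * y)" "1 \<le> y \<Longrightarrow> (y - 1)\<^sup>2 / (2 * y) \<le> excess y"
proof -
  define f where "f y = excess y - (1 - y)\<^sup>2 / 2" for y
  define h where "h y = 1 / (2 * y) - y / 2 + ln y" for y :: real
  have f: "f b \<le> f a" if "0 < a" "a \<le> b" for a b
  proof (rule DERIV_nonpos_imp_decreasing_open[OF that(2)])
    fix x assume x: "a < x" "x < b"
    have "(f has_real_derivative (1 - 1 / x + (1 - x))) (at x)"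
      unfolding f_def[abs_def] using x that by (auto intro!: derivative_eq_intros excess_deriv simp: field_simps)
    moreover have "1 - 1 / x + (1 - x) = - (1 - x)\<^sup>2 / x"
      using x that by (simp add: field_simps power2_eq_square)
    ultimately show "\<exists>y. (f has_real_derivative y) (at x) \<and> y \<le> 0"
      using x that by (intro exI[of _ "1 - 1 / x + (1 - x)"]) auto
  next
    show "continuous_on {a..b} f" unfolding f_def[abs_def] by (intro continuous_intros excess_cont that) auto
  qed
  have h: "h b \<le> h a" if "0 < a" "a \<le> b" for a b
  proof (rule DERIV_nonpos_imp_decreasing_open[OF that(2)])
    fix x assume x: "a < x" "x < b"
    have "(h has_real_derivative (- 1 / (2 * x\<^sup>2) - 1 / 2 + 1 / x)) (at x)"
      unfolding h_def[abs_def] using x that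
      by (auto intro!: derivative_eq_intros simp: field_simps power2_eq_square)
    moreover have "- 1 / (2 * x\<^sup>2) - 1 / 2 + 1 / x = - (1 / x - 1)\<^sup>2 / 2"
      using x that by (simp add: field_simps power2_eq_square)
    ultimately show "\<exists>y. (h has_real_derivative y) (at x) \<and> y \<le> 0"
      by (intro exI[of _ "- 1 / (2 * x\<^sup>2) - 1 / 2 + 1 / x"]) auto
  next
    show "continuous_on {a..b} h" unfolding h_def[abs_def] using that by (intro continuous_intros) auto
  qed
  have f1: "f 1 = 0" and h1: "h 1 = 0" by (auto simp: f_def h_def excess_1)
  have hp: "h y = (1 - y)\<^sup>2 / (2 * y) - excess y"
    using assms by (simp add: h_def excess_def field_simps power2_eq_square)
  show "y \<le> 1 \<Longrightarrow> (1 - y)\<^sup>2 / 2 \<le> excess y" using f[OF assms, of 1] f1 by (simp add: f_def)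
  show "1 \<le> y \<Longrightarrow> excess y \<le> (y - 1)\<^sup>2 / 2" using f[of 1 y] f1 by (simp add: f_def power2_commute)
  show "y \<le> 1 \<Longrightarrow> excess y \<le> (1 - y)\<^sup>2 / (2 * y)" using h[OF assms, of 1] h1 hp by simp
  show "1 \<le> y \<Longrightarrow> (y - 1)\<^sup>2 / (2 * y) \<le> excess y" using h[of 1 y] h1 hp by (simp add: power2_commute)
qed

lemma excess_nonneg: "0 < y \<Longrightarrow> 0 \<le> excess y"
  by (cases "y \<le> 1")
    (auto intro: order_trans[OF _ excess_square_bounds(1)] order_trans[OF _ excess_square_bounds(4)])

lemma exp_excess: "0 < y \<Longrightarrow> y * exp (- y) = exp (- 1 - excess y)"
  by (simp add: excess_def exp_diff exp_minus field_simps)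

lemma lambert_real_root:
  assumes "0 < y" "w * exp w = - exp (- 1 - excess y)"
  shows "w < 0" "excess (- w) = excess y"
proof -
  have "w * exp w < 0" using assms(2) by simp
  then show w: "w < 0" by (simp add: mult_less_0_iff)
  have "exp (- 1 - excess (- w)) = exp (- 1 - excess y)" using exp_excess[of "- w"] w assms(2) by simp
  then show "excess (- w) = excess y" by simp
qed

lemma lambertW0_excess:
  assumes "0 < y" "y \<le> 1"
  shows "lambertW0 (- exp (- 1 - excess y)) = of_real (- y)"
proof -
  have c: "- exp (-1) \<le> - exp (- 1 - excess y)" using excess_nonneg[OF assms(1)] by simp
  have "(THE w::real. w * exp w = - exp (- 1 - excess y) \<and> -1 \<le> w) = - y"
  proof (rule the_equality)
    show "- y * exp (- y) = - exp (- 1 - excess y) \<and> - 1 \<le> - y" using exp_excess assms by simp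
    fix w assume w: "w * exp w = - exp (- 1 - excess y) \<and> - 1 \<le> w"
    then show "w = - y" using lambert_real_root[OF assms(1)] excess_inj_lower[of "- w" y] assms by force
  qed
  then show ?thesis using c by (simp add: lambertW0_def)
qed

lemma lambertWm1_excess:
  assumes "1 \<le> y"
  shows "lambertWm1 (- exp (- 1 - excess y)) = of_real (- y)"
proof -
  have c: "- exp (-1) \<le> - exp (- 1 - excess y)" using excess_nonneg[of y] assms by simp
  have y: "0 < y" using assms by simp
  have "(THE w::real. w * exp w = - exp (- 1 - excess y) \<and> w \<le> -1) = - y"
  proof (rule the_equality)
    show "- y * exp (- y) = - exp (- 1 - excess y) \<and> - y \<le> - 1" using exp_excess[OF y] assms by simp
    fix w assume w: "w * exp w = - exp (- 1 - excess y) \<and> w \<le> - 1"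
    then show "w = - y" using lambert_real_root[OF y] excess_inj_upper[of "- w" y] assms by force
  qed
  then show ?thesis using c by (simp add: lambertWm1_def)
qed

lemma excess_surj_lower:
  assumes "0 \<le> s"
  obtains y where "0 < y" "y \<le> 1" "excess y = s"
proof -
  have l: "s \<le> excess (exp (- 1 - s))" by (simp add: excess_def)
  have e: "exp (- 1 - s) \<le> exp 0" using assms by (subst exp_le_cancel_iff) simp
  have "\<exists>y\<ge>exp (- 1 - s). y \<le> 1 \<and> excess y = s"
    by (rule IVT2'[of excess 1 s "exp (- 1 - s)"]) (use l assms e excess_1 in \<open>auto intro: excess_cont\<close>)
  then show thesis using that by (metis exp_gt_zero less_le_trans)
qed

lemma excess_surj_upper:
  assumes "0 \<le> s"
  obtains y where "1 \<le> y" "excess y = s"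
proof -
  have "ln (1 + s) \<le> s" using assms by (intro ln_add_one_self_le_self)
  moreover have "ln (2 * (1 + s)) = ln 2 + ln (1 + s)" using assms by (intro ln_mult_pos) auto
  moreover have "ln (2::real) \<le> 1" using ln_le_minus_one[of 2] by simp
  ultimately have l: "s \<le> excess (2 * (1 + s))" by (simp add: excess_def)
  have "\<exists>y\<ge>1. y \<le> 2 * (1 + s) \<and> excess y = s"
    by (rule IVT'[of excess 1 s "2 * (1 + s)"]) (use l assms excess_1 in \<open>auto intro: excess_cont\<close>)
  then show thesis using that by blast
qed

text \<open>The signs make both functions positive for s >= 0, where they are the solutions of
  \<open>excess y = s\<close> below and above 1. The branch point is s = 0.\<close>

definition low_root :: "real \<Rightarrow> real" where "low_root s = - Re (lambertW0 (- exp (- 1 - s)))"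
definition up_root :: "real \<Rightarrow> real" where "up_root s = - Re (lambertWm1 (- exp (- 1 - s)))"
text \<open>For \<open>s < 0\<close> the two branches are conjugate and the real part vanishes, so integrals of \<open>Wgap\<close> over
  \<open>[x_-, x_+]\<close> extend to the whole line.\<close>

definition Wgap :: "real \<Rightarrow> real" where
  "Wgap s = Re (lambertW0 (- exp (- 1 - s)) - lambertWm1 (- exp (- 1 - s)))"

lemma Wgap_eq: "Wgap s = up_root s - low_root s" by (simp add: Wgap_def up_root_def low_root_def)

lemma low_root_excess: "0 < y \<Longrightarrow> y \<le> 1 \<Longrightarrow> low_root (excess y) = y"
  by (simp add: low_root_def lambertW0_excess)

lemma up_root_excess: "1 \<le> y \<Longrightarrow> up_root (excess y) = y"
  by (simp add: up_root_def lambertWm1_excess)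

lemma low_root: "0 \<le> s \<Longrightarrow> 0 < low_root s \<and> low_root s \<le> 1 \<and> excess (low_root s) = s"
  by (rule excess_surj_lower[of s]) (auto simp: low_root_excess)

lemma up_root: "0 \<le> s \<Longrightarrow> 1 \<le> up_root s \<and> excess (up_root s) = s"
  by (rule excess_surj_upper[of s]) (auto simp: up_root_excess)

lemma Wgap_neg: "s < 0 \<Longrightarrow> Wgap s = 0"
  by (simp add: Wgap_def lambertWm1_def)

lemma Wgap_0: "Wgap 0 = 0"
  using low_root_excess[of 1] up_root_excess[of 1] by (simp add: Wgap_eq excess_1)

lemma low_root_strict: "0 < s \<Longrightarrow> low_root s < 1"
  using low_root[of s] excess_1 by (cases "low_root s = 1") auto
lemma up_root_strict: "0 < s \<Longrightarrow> 1 < up_root s"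
  using up_root[of s] excess_1 by (cases "up_root s = 1") auto

lemma low_root_deriv:
  assumes "0 < s"
  shows "(low_root has_real_derivative inverse (1 - 1 / low_root s)) (at s)"
proof -
  note m = low_root[of s] low_root_strict[OF assms]
  show ?thesis
  proof (rule DERIV_inverse_function[where f=excess and a=0 and b="s+1"])
    show "(excess has_real_derivative 1 - 1 / low_root s) (at (low_root s))" using m assms by (intro excess_deriv) auto
    have "isCont low_root (excess (low_root s))"
    proof (rule isCont_inverse_function2[where f=excess and g=low_root and x="low_root s" and a="low_root s / 2" and b="(low_root s + 1) / 2"])
      fix z assume "low_root s / 2 \<le> z" "z \<le> (low_root s + 1) / 2"
      then have z: "0 < z" "z \<le> 1" using m assms by auto
      show "low_root (excess z) = z" by (rule low_root_excess[OF z])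
      show "isCont excess z" by (rule DERIV_isCont[OF excess_deriv[OF z(1)]])
    qed (use m assms in auto)
    then show "isCont low_root s" using m assms by simp
  qed (use m assms low_root in auto)
qed

lemma up_root_deriv:
  assumes "0 < s"
  shows "(up_root has_real_derivative inverse (1 - 1 / up_root s)) (at s)"
proof -
  note m = up_root[of s] up_root_strict[OF assms]
  show ?thesis
  proof (rule DERIV_inverse_function[where f=excess and a=0 and b="s+1"])
    show "(excess has_real_derivative 1 - 1 / up_root s) (at (up_root s))" using m assms by (intro excess_deriv) auto
    have "isCont up_root (excess (up_root s))"
    proof (rule isCont_inverse_function2[where f=excess and g=up_root and x="up_root s" and a="(up_root s + 1) / 2" and b="up_root s + 1"])
      fix z assume "(up_root s + 1) / 2 \<le> z" "z \<le> up_root s + 1"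
      then have z: "1 \<le> z" using m assms by auto
      show "up_root (excess z) = z" by (rule up_root_excess[OF z])
      show "isCont excess z" by (rule DERIV_isCont[OF excess_deriv]) (use z in auto)
    qed (use m assms in auto)
    then show "isCont up_root s" using m assms by simp
  qed (use m assms up_root in auto)
qed

text \<open>With v = up_root s - 1, the square bounds read v^2 / (2 (1 + v)) <= s <= v^2 / 2. The
  linear term in the second conclusion accounts for large s, where v grows like s.\<close>

lemma up_root_bounds:
  assumes "0 < s"
  shows "sqrt (2 * s) \<le> up_root s - 1" "up_root s - 1 \<le> 2 * s + sqrt (2 * s)"
proof -
  define v where "v = up_root s - 1"
  have v: "0 < v" "excess (1 + v) = s" using up_root[of s] up_root_strict[OF assms] assms by (auto simp: v_def)
  have "s \<le> v\<^sup>2 / 2" using excess_square_bounds(2)[of "1 + v"] v by simp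
  then have "2 * s \<le> v\<^sup>2" by simp
  then show "sqrt (2 * s) \<le> up_root s - 1" unfolding v_def[symmetric] using v by (intro real_le_lsqrt) auto
  have "v\<^sup>2 / (2 * (1 + v)) \<le> s" using excess_square_bounds(4)[of "1 + v"] v by simp
  then have q: "v\<^sup>2 \<le> 2 * s * (1 + v)" using v by (simp add: field_simps)
  show "up_root s - 1 \<le> 2 * s + sqrt (2 * s)"
  proof (rule ccontr)
    assume "\<not> ?thesis"
    then have l: "2 * s + sqrt (2 * s) < v" by (simp add: v_def)
    have q0: "0 < sqrt (2 * s)" using assms by simp
    have "sqrt (2 * s) * sqrt (2 * s) < v * (v - 2 * s)"
      by (intro mult_strict_mono) (use l q0 assms in linarith)+
    then show False using q assms by (simp add: power2_eq_square algebra_simps)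
  qed
qed

lemma low_root_bounds:
  assumes "0 < s"
  shows "1 - low_root s \<le> sqrt (2 * s)" "low_root s / (1 - low_root s) \<le> 1 / sqrt (2 * s)"
proof -
  define v where "v = 1 - low_root s"
  have v: "0 < v" "v < 1" "excess (1 - v) = s" using low_root[of s] low_root_strict[OF assms] assms by (auto simp: v_def)
  have "v\<^sup>2 \<le> 2 * s" using excess_square_bounds(1)[of "1 - v"] v by simp
  then show 1: "1 - low_root s \<le> sqrt (2 * s)" unfolding v_def[symmetric] by (rule real_le_rsqrt)
  have "s \<le> v\<^sup>2 / (2 * (1 - v))" using excess_square_bounds(3)[of "1 - v"] v by simp
  then have "2 * s * (1 - v) \<le> v * v" using v by (simp add: field_simps power2_eq_square)
  then have "(1 - v) / v \<le> v / (2 * s)" using v assms by (simp add: field_simps)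
  also have "\<dots> \<le> sqrt (2 * s) / (2 * s)" using 1 assms by (intro divide_right_mono) (auto simp: v_def)
  also have "\<dots> = 1 / sqrt (2 * s)" using assms by (simp add: real_div_sqrt field_simps)
  finally show "low_root s / (1 - low_root s) \<le> 1 / sqrt (2 * s)" by (simp add: v_def)
qed

text \<open>At s = 0 the value is a dummy: \<open>Wgap\<close> starts there like a square root and
  has no derivative.\<close>

definition dWgap :: "real \<Rightarrow> real" where
  "dWgap s = (if s \<le> 0 then 0 else inverse (1 - 1 / up_root s) - inverse (1 - 1 / low_root s))"

lemma Wgap_deriv:
  assumes "s \<noteq> 0"
  shows "(Wgap has_real_derivative dWgap s) (at s)"
proof (cases "0 < s")
  case True
  then show ?thesis unfolding Wgap_eq[abs_def] dWgap_def
    using DERIV_diff[OF up_root_deriv[OF True] low_root_deriv[OF True]] by simp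
next
  case False
  have "((\<lambda>s. 0) has_real_derivative dWgap s) (at s)" using False by (simp add: dWgap_def)
  then show ?thesis
    by (rule has_field_derivative_transform_within_open[of _ _ _ "{..<0}"]) (use assms False in \<open>auto simp: Wgap_neg\<close>)
qed

text \<open>The upper bound is the derivative of s + 2 sqrt (2 s), the comparison function in
  \<open>Wgap_increment\<close>.\<close>

lemma dWgap_bounds:
  assumes "0 < s"
  shows "0 \<le> dWgap s" "dWgap s \<le> 1 + 2 / sqrt (2 * s)"
proof -
  note m = low_root[of s] low_root_strict[OF assms] and p = up_root[of s] up_root_strict[OF assms]
  have 1: "inverse (1 - 1 / up_root s) = 1 + 1 / (up_root s - 1)" using p assms by (simp add: field_simps)
  have 2: "inverse (1 - 1 / low_root s) = - (low_root s / (1 - low_root s))" using m assms by (simp add: field_simps)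
  have "0 < sqrt (2 * s)" using assms by simp
  then have "1 / (up_root s - 1) \<le> 1 / sqrt (2 * s)" using up_root_bounds(1)[OF assms] p by (intro divide_left_mono mult_pos_pos) auto
  moreover have "0 \<le> low_root s / (1 - low_root s)" "0 \<le> 1 / (up_root s - 1)" using m p assms by auto
  moreover have "2 / sqrt (2 * s) = 1 / sqrt (2 * s) + 1 / sqrt (2 * s)" by simp
  ultimately show "0 \<le> dWgap s" "dWgap s \<le> 1 + 2 / sqrt (2 * s)"
    using low_root_bounds(2)[OF assms] assms unfolding dWgap_def 1 2 by (auto simp del: divide_le_eq_1 le_divide_eq_1)
qed

lemma Wgap_cont_nonneg: "continuous_on {0..b} Wgap"
  unfolding continuous_on_eq_continuous_within
proof
  fix x assume x: "x \<in> {0..b}"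
  show "continuous (at x within {0..b}) Wgap"
  proof (cases "x = 0")
    case True
    have "((\<lambda>s. 2 * s + 2 * sqrt (2 * s)) \<longlongrightarrow> 2 * 0 + 2 * sqrt (2 * 0)) (at 0 within {0..b})"
      by (intro tendsto_intros)
    then have l: "((\<lambda>s. 2 * s + 2 * sqrt (2 * s)) \<longlongrightarrow> 0) (at 0 within {0..b})" by simp
    have "(Wgap \<longlongrightarrow> 0) (at 0 within {0..b})"
    proof (rule tendsto_sandwich[OF _ _ tendsto_const l])
      show "\<forall>\<^sub>F s in at 0 within {0..b}. 0 \<le> Wgap s"
        unfolding eventually_at_filter
        using low_root_strict up_root_strict by (auto intro!: always_eventually simp: Wgap_eq less_imp_le) (smt (verit))
      show "\<forall>\<^sub>F s in at 0 within {0..b}. Wgap s \<le> 2 * s + 2 * sqrt (2 * s)"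
        unfolding eventually_at_filter
        using low_root_bounds(1) up_root_bounds(2) by (auto intro!: always_eventually simp: Wgap_eq) (smt (verit))
    qed
    then show ?thesis using True by (simp add: continuous_within Wgap_0)
  next
    case False
    show ?thesis
      by (rule continuous_at_imp_continuous_at_within[OF DERIV_isCont[OF Wgap_deriv[OF False]]])
  qed
qed

text \<open>The bound on \<open>dWgap\<close> is integrated by monotonicity of s + 2 sqrt (2 s) -
  Wgap s, and subadditivity of the square root turns the result into a modulus in t - s. Below 0,
  where \<open>Wgap\<close> vanishes, s is replaced by 0.\<close>

lemma Wgap_increment:
  assumes "s \<le> t"
  shows "0 \<le> Wgap t - Wgap s" "Wgap t - Wgap s \<le> (t - s) + 2 * sqrt (2 * (t - s))"
proof -
  have *: "0 \<le> Wgap t - Wgap s \<and> Wgap t - Wgap s \<le> (t - s) + 2 * sqrt (2 * (t - s))" if "0 \<le> s" "s \<le> t" for s t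
  proof
    have c: "continuous_on {s..t} Wgap" by (rule continuous_on_subset[OF Wgap_cont_nonneg[of t]]) (use that in auto)
    have "Wgap s \<le> Wgap t"
    proof (rule DERIV_nonneg_imp_increasing_open[OF that(2) _ c])
      fix x assume "s < x" "x < t"
      then show "\<exists>y. (Wgap has_real_derivative y) (at x) \<and> 0 \<le> y"
        using that by (intro exI[of _ "dWgap x"] conjI Wgap_deriv dWgap_bounds) auto
    qed
    then show "0 \<le> Wgap t - Wgap s" by simp
    have "s + 2 * sqrt (2 * s) - Wgap s \<le> t + 2 * sqrt (2 * t) - Wgap t"
    proof (rule DERIV_nonneg_imp_increasing_open[OF that(2)])
      fix x assume x: "s < x" "x < t"
      then have x0: "0 < x" using that by simp
      have "((\<lambda>x. x + 2 * sqrt (2 * x) - Wgap x) has_real_derivative (1 + 2 * (2 * (inverse (sqrt (2 * x)) / 2)) - dWgap x)) (at x)"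
        using x0 by (auto intro!: derivative_eq_intros Wgap_deriv)
      moreover have "0 \<le> 1 + 2 * (2 * (inverse (sqrt (2 * x)) / 2)) - dWgap x"
      proof -
        have "2 / q = 2 * (2 * (inverse q / 2))" for q :: real by (cases "q = 0") (simp_all add: field_simps)
        from this[of "sqrt (2 * x)"] show ?thesis using dWgap_bounds(2)[OF x0] by linarith
      qed
      ultimately show "\<exists>y. ((\<lambda>x. x + 2 * sqrt (2 * x) - Wgap x) has_real_derivative y) (at x) \<and> 0 \<le> y" by blast
    next
      show "continuous_on {s..t} (\<lambda>x. x + 2 * sqrt (2 * x) - Wgap x)" by (intro continuous_intros c)
    qed
    moreover have "sqrt (2 * t) \<le> sqrt (2 * s) + sqrt (2 * (t - s))"
      using sqrt_add_le_add_sqrt[of "2 * s" "2 * (t - s)"] that by (simp add: algebra_simps)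
    ultimately show "Wgap t - Wgap s \<le> (t - s) + 2 * sqrt (2 * (t - s))" by simp
  qed
  have nn: "0 \<le> (t - s) + 2 * sqrt (2 * (t - s))" using assms by simp
  have "0 \<le> Wgap t - Wgap s \<and> Wgap t - Wgap s \<le> (t - s) + 2 * sqrt (2 * (t - s))"
  proof -
    consider "t < 0" | "s < 0" "0 \<le> t" | "0 \<le> s" using assms by linarith
    then show ?thesis
    proof cases
      case 2
      have "sqrt (2 * (t - 0)) \<le> sqrt (2 * (t - s))" using 2 by (intro real_sqrt_le_mono) auto
      then show ?thesis using *[OF order_refl 2(2)] 2 Wgap_neg[OF 2(1)] Wgap_0 by (intro conjI; linarith)
    qed (use * assms Wgap_neg nn in auto)
  qed
  then show "0 \<le> Wgap t - Wgap s" "Wgap t - Wgap s \<le> (t - s) + 2 * sqrt (2 * (t - s))" by auto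
qed

lemma Wgap_nonneg: "0 \<le> Wgap s"
  using Wgap_increment(1)[of 0 s] Wgap_neg[of s] Wgap_0 by (cases "s < 0") auto

lemma Wgap_pos: "0 < s \<Longrightarrow> 0 < Wgap s"
  using low_root_strict[of s] up_root_strict[of s] by (simp add: Wgap_eq)

lemma Wgap_strict: "0 < t \<Longrightarrow> s < t \<Longrightarrow> Wgap s < Wgap t"
proof -
  assume t: "0 < t" and st: "s < t"
  show ?thesis
  proof (cases "s \<le> 0")
    case True
    then show ?thesis using Wgap_pos[OF t] Wgap_neg[of s] Wgap_0 by (cases "s = 0") auto
  next
    case False
    then have s: "0 < s" by simp
    have "up_root s < up_root t" using up_root[of s] up_root[of t] excess_strict_inc[of "up_root t" "up_root s"] s st
      by (cases "up_root s" "up_root t" rule: linorder_cases) auto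
    moreover have "low_root t < low_root s" using low_root[of s] low_root[of t] excess_strict_dec[of "low_root s" "low_root t"] s st
      by (cases "low_root s" "low_root t" rule: linorder_cases) auto
    ultimately show ?thesis by (simp add: Wgap_eq)
  qed
qed

lemma Wgap_cont: "continuous_on UNIV Wgap"
  unfolding continuous_on_eq_continuous_at[OF open_UNIV]
proof
  fix x :: real
  have "((\<lambda>y. \<bar>y - x\<bar> + 2 * sqrt (2 * \<bar>y - x\<bar>)) \<longlongrightarrow> \<bar>x - x\<bar> + 2 * sqrt (2 * \<bar>x - x\<bar>)) (at x)" by (intro tendsto_intros)
  then have l: "((\<lambda>y. \<bar>y - x\<bar> + 2 * sqrt (2 * \<bar>y - x\<bar>)) \<longlongrightarrow> 0) (at x)" by simp
  have "((\<lambda>y. Wgap y - Wgap x) \<longlongrightarrow> 0) (at x)"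
  proof (rule Lim_null_comparison[OF always_eventually l], rule allI)
    fix y show "norm (Wgap y - Wgap x) \<le> \<bar>y - x\<bar> + 2 * sqrt (2 * \<bar>y - x\<bar>)"
      using Wgap_increment[of x y] Wgap_increment[of y x] by (cases "x \<le> y") auto
  qed
  then show "isCont Wgap x" unfolding isCont_def by (simp add: LIM_zero_iff)
qed

text \<open>A bound on difference quotients uniform in the step h, made for dominated convergence.
  If |h| is at least |s| / 2, the global modulus suffices; otherwise s - h stays on the side of s,
  and the mean value bound on [s/2, infinity) applies when s > 0. \<open>S\<close> only serves to
  absorb the linear term into 1 / sqrt |s|.\<close>

lemma Wgap_lipschitz_away:
  assumes "s \<noteq> 0" "\<bar>s\<bar> \<le> S"
  shows "\<bar>Wgap s - Wgap (s - h)\<bar> \<le> (sqrt S + 4) * \<bar>h\<bar> / sqrt \<bar>s\<bar>"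
proof -
  have q: "0 < sqrt \<bar>s\<bar>" "sqrt \<bar>s\<bar> \<le> sqrt S" using assms by auto
  have one: "\<bar>h\<bar> \<le> sqrt S * \<bar>h\<bar> / sqrt \<bar>s\<bar>"
  proof -
    have "\<bar>h\<bar> * sqrt \<bar>s\<bar> \<le> \<bar>h\<bar> * sqrt S" using q by (intro mult_left_mono) auto
    then show ?thesis using q by (simp add: pos_le_divide_eq mult.commute)
  qed
  show ?thesis
  proof (cases "\<bar>s\<bar> / 2 \<le> \<bar>h\<bar>")
    case True
    have "\<bar>Wgap s - Wgap (s - h)\<bar> \<le> \<bar>h\<bar> + 2 * sqrt (2 * \<bar>h\<bar>)"
      using Wgap_increment[of s "s - h"] Wgap_increment[of "s - h" s] by (cases "0 \<le> h") auto
    moreover have "2 * sqrt (2 * \<bar>h\<bar>) \<le> 4 * \<bar>h\<bar> / sqrt \<bar>s\<bar>"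
    proof -
      have "sqrt (2 * \<bar>h\<bar>) * sqrt \<bar>s\<bar> = sqrt (2 * \<bar>h\<bar> * \<bar>s\<bar>)" by (simp add: real_sqrt_mult)
      also have "\<dots> \<le> sqrt ((2 * \<bar>h\<bar>)\<^sup>2)"
        unfolding power2_eq_square using True by (intro real_sqrt_le_mono mult_left_mono) auto
      also have "\<dots> = 2 * \<bar>h\<bar>" by (subst real_sqrt_abs) simp
      finally have "2 * sqrt (2 * \<bar>h\<bar>) * sqrt \<bar>s\<bar> \<le> 4 * \<bar>h\<bar>" by (simp add: mult.commute)
      then show ?thesis using q by (simp add: pos_le_divide_eq)
    qed
    ultimately show ?thesis using one by (simp add: distrib_right add_divide_distrib)
  next
    case False
    then have h: "\<bar>h\<bar> < \<bar>s\<bar> / 2" by simp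
    show ?thesis
    proof (cases "s < 0")
      case True
      then have "Wgap s = 0" "Wgap (s - h) = 0" using h by (auto intro!: Wgap_neg simp: abs_if split: if_splits)
      moreover have "0 \<le> S" using assms by linarith
      ultimately show ?thesis using q by simp
    next
      case False
      then have s: "0 < s" using assms by simp
      define B where "B = 1 + 2 / sqrt s"
      have bd: "dWgap x \<le> B \<and> 0 \<le> dWgap x" if "s / 2 \<le> x" for x
      proof -
        have x: "0 < x" using that s by simp
        have "2 / sqrt (2 * x) \<le> 2 / sqrt s" using that s x by (intro divide_left_mono mult_pos_pos) auto
        then show ?thesis using dWgap_bounds[OF x] by (simp add: B_def)
      qed
      have "\<bar>Wgap s - Wgap (s - h)\<bar> \<le> B * \<bar>s - (s - h)\<bar>"
      proof (rule field_differentiable_bound[of "{s/2..}" Wgap dWgap, unfolded real_norm_def])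
        fix x assume x: "x \<in> {s/2..}"
        then have "x \<noteq> 0" using s by auto
        then show "(Wgap has_field_derivative dWgap x) (at x within {s/2..})"
          by (rule has_field_derivative_at_within[OF Wgap_deriv])
        show "\<bar>dWgap x\<bar> \<le> B" using bd[of x] x by (simp add: abs_if)
      qed (use s h in \<open>auto simp: abs_if split: if_splits\<close>)
      then have "\<bar>Wgap s - Wgap (s - h)\<bar> \<le> \<bar>h\<bar> + 2 * \<bar>h\<bar> / sqrt s" by (simp add: B_def distrib_right)
      also have "\<dots> \<le> sqrt S * \<bar>h\<bar> / sqrt \<bar>s\<bar> + 4 * \<bar>h\<bar> / sqrt \<bar>s\<bar>"
      proof -
        have "2 * \<bar>h\<bar> / sqrt s \<le> 4 * \<bar>h\<bar> / sqrt s" by (intro divide_right_mono) (use s in auto)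
        then show ?thesis using one s by simp
      qed
      finally show ?thesis by (simp add: distrib_right add_divide_distrib)
    qed
  qed
qed

lemma Wgap_measurable: "Wgap \<in> borel_measurable borel"
  by (rule borel_measurable_continuous_onI[OF Wgap_cont])

lemma dWgap_measurable: "dWgap \<in> borel_measurable borel"
proof (rule borel_measurable_LIMSEQ_real)
  fix s :: real
  \<comment> \<open>The sequence is set to 0 at s = 0, where the quotients do not converge.\<close>
  show "(\<lambda>n. if s = 0 then 0 else (Wgap (s + inverse (real (Suc n))) - Wgap s) / inverse (real (Suc n))) \<longlonglongrightarrow> dWgap s"
  proof (cases "s = 0")
    case False
    have "((\<lambda>h. (Wgap (s + h) - Wgap s) / h) \<longlongrightarrow> dWgap s) (at 0)"
      using Wgap_deriv[OF False] by (simp add: DERIV_def)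
    then have "(\<lambda>n. (Wgap (s + inverse (real (Suc n))) - Wgap s) / inverse (real (Suc n))) \<longlonglongrightarrow> dWgap s"
      unfolding tendsto_at_iff_sequentially o_def
      using LIMSEQ_inverse_real_of_nat by (auto simp del: of_nat_Suc dest!: spec[of _ "\<lambda>n. inverse (real (Suc n))"])
    then show ?thesis using False by simp
  qed (simp add: dWgap_def)
next
  note Wgap_measurable[measurable]
  show "(\<lambda>s. if s = 0 then 0 else (Wgap (s + inverse (real (Suc n))) - Wgap s) / inverse (real (Suc n))) \<in> borel_measurable borel" for n
    by measurable
qed

section \<open>The counting function of the initial datum\<close>

text \<open>The difference quotient at \<open>q\<close>, completed by \<open>D\<close>, is
  continuous and without zeros on a compact interval; \<open>c\<close> is the minimum of its
  modulus. Applied at the turning points, it keeps |u0 x - v| above a multiple of the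
  distance.\<close>

lemma DERIV_linear_lower_bound:
  fixes f :: "real \<Rightarrow> real"
  assumes der: "(f has_real_derivative D) (at q)" and D: "D \<noteq> 0"
    and cont: "continuous_on {a..b} f" and ne: "\<And>x. x \<in> {a..b} \<Longrightarrow> x \<noteq> q \<Longrightarrow> f x \<noteq> f q"
  obtains c where "0 < c" "\<And>x. x \<in> {a..b} \<Longrightarrow> c * \<bar>x - q\<bar> \<le> \<bar>f x - f q\<bar>"
proof (cases "a \<le> b")
  case False
  then show thesis using that[of 1] by auto
next
  case True
  define r where "r x = \<bar>if x = q then D else (f x - f q) / (x - q)\<bar>" for x
  have "continuous_on {a..b} (\<lambda>x. if x = q then D else (f x - f q) / (x - q))"
    unfolding continuous_on_eq_continuous_within
  proof
    fix x assume x: "x \<in> {a..b}"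
    show "continuous (at x within {a..b}) (\<lambda>x. if x = q then D else (f x - f q) / (x - q))"
    proof (cases "x = q")
      case True
      have "((\<lambda>x. (f x - f q) / (x - q)) \<longlongrightarrow> D) (at q)"
        using der by (simp add: has_field_derivative_iff)
      then have "((\<lambda>x. (f x - f q) / (x - q)) \<longlongrightarrow> D) (at q within {a..b})"
        by (rule tendsto_within_subset) simp
      then have "((\<lambda>x. if x = q then D else (f x - f q) / (x - q)) \<longlongrightarrow> D) (at q within {a..b})"
        by (rule Lim_transform_eventually) (simp add: eventually_at_filter)
      then show ?thesis using True by (simp add: continuous_within)
    next
      case False
      have cf: "continuous (at x within {a..b}) f" using cont x by (simp add: continuous_on_eq_continuous_within)
      have "continuous (at x within {a..b}) (\<lambda>x. (f x - f q) / (x - q))"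
        using False by (intro continuous_intros cf) auto
      then have "((\<lambda>x. (f x - f q) / (x - q)) \<longlongrightarrow> (f x - f q) / (x - q)) (at x within {a..b})"
        by (simp add: continuous_within)
      then have "((\<lambda>x. if x = q then D else (f x - f q) / (x - q)) \<longlongrightarrow> (f x - f q) / (x - q)) (at x within {a..b})"
      proof (rule Lim_transform_eventually)
        have "\<forall>\<^sub>F y in at x within {a..b}. y \<noteq> q"
          using False by (metis eventually_neq_at_within)
        then show "\<forall>\<^sub>F y in at x within {a..b}. (f y - f q) / (y - q) = (if y = q then D else (f y - f q) / (y - q))"
          by eventually_elim simp
      qed
      then show ?thesis using False by (simp add: continuous_within)
    qed
  qed
  then have "continuous_on {a..b} r" unfolding r_def[abs_def] by (rule continuous_on_rabs)
  then obtain x0 where x0: "x0 \<in> {a..b}" "\<And>x. x \<in> {a..b} \<Longrightarrow> r x0 \<le> r x"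
    using continuous_attains_inf[of "{a..b}" r] True by auto
  have "0 < r x0" using ne[OF x0(1)] D by (auto simp: r_def)
  moreover have "r x0 * \<bar>x - q\<bar> \<le> \<bar>f x - f q\<bar>" if "x \<in> {a..b}" for x
    using x0(2)[OF that] by (cases "x = q") (auto simp: r_def abs_divide pos_le_divide_eq)
  ultimately show thesis by (rule that)
qed

lemma integrable_inverse_sqrt:
  fixes a b q :: real
  shows "integrable lborel (\<lambda>x. indicator {a..b} x * (1 / sqrt \<bar>x - q\<bar>))"
proof (cases "a \<le> b")
  case True
  \<comment> \<open>The antiderivative is 2 sqrt (x - q) right of \<open>q\<close> and -2 sqrt (q -
    x) left of it; \<open>max\<close> joins the two continuously.\<close>
  have "((\<lambda>x. 1 / sqrt \<bar>x - q\<bar>) has_integral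
     (2 * sqrt (max 0 (b - q)) - 2 * sqrt (max 0 (q - b)) - (2 * sqrt (max 0 (a - q)) - 2 * sqrt (max 0 (q - a))))) {a..b}"
  proof (rule fundamental_theorem_of_calculus_interior_strong[of "{q}"])
    fix x assume x: "x \<in> {a<..<b} - {q}"
    have "((\<lambda>x. 2 * sqrt (max 0 (x - q)) - 2 * sqrt (max 0 (q - x))) has_real_derivative 1 / sqrt \<bar>x - q\<bar>) (at x)"
    proof (cases "q < x")
      case True
      have "((\<lambda>x. 2 * sqrt (x - q)) has_real_derivative 1 / sqrt \<bar>x - q\<bar>) (at x)"
        using True by (auto intro!: derivative_eq_intros simp: field_simps)
      then show ?thesis
        by (rule has_field_derivative_transform_within_open[of _ _ _ "{q<..}"]) (use True in auto)
    next
      case False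
      then have xq: "x < q" using x by auto
      have "((\<lambda>x. - (2 * sqrt (q - x))) has_real_derivative 1 / sqrt \<bar>x - q\<bar>) (at x)"
        using xq by (auto intro!: derivative_eq_intros simp: field_simps)
      then show ?thesis
        by (rule has_field_derivative_transform_within_open[of _ _ _ "{..<q}"]) (use xq in auto)
    qed
    then show "((\<lambda>x. 2 * sqrt (max 0 (x - q)) - 2 * sqrt (max 0 (q - x))) has_vector_derivative 1 / sqrt \<bar>x - q\<bar>) (at x)"
      by (simp add: has_real_derivative_iff_has_vector_derivative)
  next
    show "continuous_on {a..b} (\<lambda>x. 2 * sqrt (max 0 (x - q)) - 2 * sqrt (max 0 (q - x)))"
      by (intro continuous_intros)
  qed (use True in auto)
  then have "(\<lambda>x. 1 / sqrt \<bar>x - q\<bar>) absolutely_integrable_on {a..b}"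
    by (intro nonnegative_absolutely_integrable_1) auto
  then have "integrable lebesgue (\<lambda>x. indicator {a..b} x * (1 / sqrt \<bar>x - q\<bar>))"
    by (simp add: set_integrable_def)
  then show ?thesis by (subst (asm) integrable_completion) auto
qed simp

section \<open>Interpolation between the square root and the second moment\<close>

definition weight :: "real \<Rightarrow> real" where "weight x = (1 + \<bar>x\<bar>) powr (- 3 / 2)"

lemma weight_integrable: "integrable lborel weight"
proof -
  define f where "f x = (1 + x) powr (- 3 / 2)" for x :: real
  have f[measurable]: "f \<in> borel_measurable borel" unfolding f_def[abs_def] by measurable
  have 1: "(\<integral>\<^sup>+x. ennreal (f x) * indicator {0..} x \<partial>lborel) = ennreal (0 - (-2 * (1 + 0) powr (- 1 / 2)))"
  proof (rule nn_integral_FTC_atLeast)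
    fix x :: real assume "0 \<le> x"
    then show "((\<lambda>x::real. -2 * (1 + x) powr (- 1 / 2)) has_real_derivative f x) (at x)"
      unfolding f_def by (auto intro!: derivative_eq_intros)
    show "0 \<le> f x" by (simp add: f_def)
  next
    show "((\<lambda>x::real. -2 * (1 + x) powr (- 1 / 2)) \<longlongrightarrow> 0) at_top" by real_asymp
  qed measurable
  have 2: "(\<integral>\<^sup>+x. ennreal (f (0 + (-1) * x)) * indicator {0..} (0 + (-1) * x) \<partial>lborel) = (\<integral>\<^sup>+x. ennreal (f x) * indicator {0..} x \<partial>lborel)"
    using nn_integral_real_affine[of "\<lambda>x. ennreal (f x) * indicator {0..} x" "-1" 0] by simp
  have "(\<integral>\<^sup>+x. ennreal (weight x) \<partial>lborel) \<le>
    (\<integral>\<^sup>+x. ennreal (f x) * indicator {0..} x + ennreal (f (0 + (-1) * x)) * indicator {0..} (0 + (-1) * x) \<partial>lborel)"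
    by (intro nn_integral_mono) (auto simp: weight_def f_def indicator_def)
  also have "\<dots> = (\<integral>\<^sup>+x. ennreal (f x) * indicator {0..} x \<partial>lborel) + (\<integral>\<^sup>+x. ennreal (f (0 + (-1) * x)) * indicator {0..} (0 + (-1) * x) \<partial>lborel)"
    by (intro nn_integral_add) measurable
  also have "\<dots> < \<infinity>" unfolding 2 1 by (simp flip: ennreal_plus)
  finally show ?thesis
    by (intro integrableI_nonneg) (auto simp: weight_def[abs_def])
qed

text \<open>The weights are integrable by the moment condition and because \<open>3 / 2 > 1\<close>; the exponent is
  what remains of \<open>1 / 2 = 1 / 14 + 3 / 7\<close>.\<close>

lemma sqrt_min_le:
  fixes u h x :: real
  assumes u: "0 < u" and h: "0 \<le> h"
  shows "sqrt (min u h) \<le> h powr (1 / 14) * (2 * ((x\<^sup>2 + 1) * u) + weight x)"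
proof (cases "h = 0")
  case False
  define m where "m = min u h"
  have m: "0 < m" "m \<le> u" "m \<le> h" using assms False by (auto simp: m_def)
  have w: "0 < weight x" by (auto simp: weight_def)
  have *: "m powr (3 / 7) \<le> 2 * ((x\<^sup>2 + 1) * u) + weight x"
  \<comment> \<open>Either the weight dominates, or m^(4/7) exceeds weight^(4/3) = (1 + |x|)^(-2);
    in the latter case multiplying by m^(3/7) gives total power 1, and (1 + |x|)^2 times m is
    bounded by the second moment density.\<close>
  proof (cases "m powr (3 / 7) \<le> weight x")
    case True
    then show ?thesis using u by (simp add: add_increasing)
  next
    case False
    have "weight x powr (4 / 3) \<le> (m powr (3 / 7)) powr (4 / 3)" using False w by (intro powr_mono2) auto
    also have "\<dots> = m powr (4 / 7)" by (simp add: powr_powr)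
    finally have "m powr (3 / 7) * weight x powr (4 / 3) \<le> m powr (3 / 7) * m powr (4 / 7)"
      by (intro mult_left_mono) auto
    also have "\<dots> = m" using m by (simp flip: powr_add)
    also have "weight x powr (4 / 3) = (1 + \<bar>x\<bar>) powr (- 2)"
      by (simp only: weight_def powr_powr) simp
    also have "\<dots> = inverse ((1 + \<bar>x\<bar>)\<^sup>2)"
      by (simp add: powr_minus powr_numeral add_pos_nonneg)
    finally have "m powr (3 / 7) \<le> m * (1 + \<bar>x\<bar>)\<^sup>2" by (simp add: field_simps)
    also have "\<dots> \<le> u * (2 * (x\<^sup>2 + 1))"
    proof (intro mult_mono)
      have "0 \<le> (1 - \<bar>x\<bar>)\<^sup>2" by simp
      then show "(1 + \<bar>x\<bar>)\<^sup>2 \<le> 2 * (x\<^sup>2 + 1)" by (simp add: power2_eq_square algebra_simps)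
    qed (use m u in auto)
    finally show ?thesis using w by (simp add: algebra_simps)
  qed
  have "sqrt m = m powr (1 / 14) * m powr (3 / 7)" using m by (simp add: powr_half_sqrt[symmetric] flip: powr_add)
  also have "\<dots> \<le> h powr (1 / 14) * (2 * ((x\<^sup>2 + 1) * u) + weight x)"
    using m * by (intro mult_mono powr_mono2) auto
  finally show ?thesis by (simp add: m_def)
qed (use u in simp)

section \<open>Shape of the initial datum and its turning points\<close>

locale initial_data =
  fixes d :: real and u0 u0' :: "real \<Rightarrow> real" and xm :: real
  assumes d_pos: "d > 0"
    and deriv: "\<And>x. (u0 has_real_derivative u0' x) (at x)"
    and C1: "continuous_on UNIV u0'"
    and pos: "\<And>x. u0 x > 0"
    and lim_top: "(u0 \<longlongrightarrow> 0) at_top"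
    and lim_bot: "(u0 \<longlongrightarrow> 0) at_bot"
    and moment: "(\<lambda>x. (x\<^sup>2 + 1) * u0 x) integrable_on UNIV"
    and crit: "\<And>x. u0' x = 0 \<longleftrightarrow> x = xm"
    and maxim: "\<And>x. u0 x \<le> u0 xm"
    and sqrt_int: "(\<lambda>x. sqrt (u0 x)) integrable_on UNIV"
begin

abbreviation "um \<equiv> u0 xm"

lemma u0_cont: "continuous_on S u0"
  using deriv by (meson DERIV_isCont continuous_at_imp_continuous_on)

lemma u0_meas[measurable]: "u0 \<in> borel_measurable borel"
  by (rule borel_measurable_continuous_onI[OF u0_cont])

text \<open>A positive value would meet a nonpositive one, supplied by the mean value theorem and
  the maximum at \<open>xm\<close>, so the continuous \<open>u0'\<close> would vanish away from
  \<open>xm\<close>.\<close>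

lemma u0'_neg:
  assumes "xm < y"
  shows "u0' y < 0"
proof (rule ccontr)
  assume "\<not> ?thesis"
  then have y: "0 < u0' y" using crit[of y] assms by auto
  obtain c where c: "xm < c" "c < y" "u0 y - u0 xm = (y - xm) * u0' c"
    using MVT2[OF assms deriv] by auto
  then have "u0' c \<le> 0" using maxim[of y] assms by (metis diff_le_0_iff_le diff_gt_0_iff_gt mult_le_0_iff not_le)
  then obtain x where "c \<le> x" "x \<le> y" "u0' x = 0"
    using IVT'[of u0' c 0 y] y c continuous_on_subset[OF C1] by auto
  then show False using crit c by auto
qed

lemma u0'_pos:
  assumes "y < xm"
  shows "0 < u0' y"
proof (rule ccontr)
  assume "\<not> ?thesis"
  then have y: "u0' y < 0" using crit[of y] assms by auto
  obtain c where c: "y < c" "c < xm" "u0 xm - u0 y = (xm - y) * u0' c"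
    using MVT2[OF assms deriv] by auto
  have "0 \<le> u0' c"
  proof (rule ccontr)
    assume "\<not> 0 \<le> u0' c"
    then have "(xm - y) * u0' c < 0" using assms by (intro mult_pos_neg) auto
    then show False using c(3) maxim[of y] by simp
  qed
  then obtain x where "y \<le> x" "x \<le> c" "u0' x = 0"
    using IVT'[of u0' y 0 c] y c continuous_on_subset[OF C1] by auto
  then show False using crit c by auto
qed

lemma u0_dec: "xm \<le> x \<Longrightarrow> x < y \<Longrightarrow> u0 y < u0 x"
  by (rule DERIV_neg_imp_decreasing_open) (use deriv u0'_neg u0_cont in \<open>auto intro!: exI\<close>)

lemma u0_inc: "y \<le> xm \<Longrightarrow> x < y \<Longrightarrow> u0 x < u0 y"
  by (rule DERIV_pos_imp_increasing_open) (use deriv u0'_pos u0_cont in \<open>auto intro!: exI\<close>)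

text \<open>Turning points as functions of the level v = E(zeta(\<kappa>)) in place of \<kappa>,
  which separates the shape of \<open>u0\<close> from the trigonometry of
  \<open>zeta\<close>.\<close>

definition Xp :: "real \<Rightarrow> real" where "Xp v = (THE x. xm \<le> x \<and> u0 x = v)"
definition Xm :: "real \<Rightarrow> real" where "Xm v = (THE x. x \<le> xm \<and> u0 x = v)"

lemma Xp:
  assumes "0 < v" "v \<le> um"
  shows "xm \<le> Xp v" "u0 (Xp v) = v"
proof -
  have "\<forall>\<^sub>F x in at_top. u0 x < v" using order_tendstoD(2)[OF lim_top assms(1)] .
  then obtain B where "\<And>x. B \<le> x \<Longrightarrow> u0 x < v" by (auto simp: eventually_at_top_linorder)
  then have "u0 (max B xm) \<le> v" by (simp add: less_imp_le)
  then obtain x where x: "xm \<le> x" "u0 x = v"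
    using IVT2'[of u0 "max B xm" v xm] assms u0_cont by auto
  have "Xp v = x" unfolding Xp_def
  proof (rule the_equality)
    fix y assume "xm \<le> y \<and> u0 y = v"
    then show "y = x" using x u0_dec[of x y] u0_dec[of y x] by (cases x y rule: linorder_cases) auto
  qed (use x in auto)
  then show "xm \<le> Xp v" "u0 (Xp v) = v" using x by auto
qed

lemma Xm:
  assumes "0 < v" "v \<le> um"
  shows "Xm v \<le> xm" "u0 (Xm v) = v"
proof -
  have "\<forall>\<^sub>F x in at_bot. u0 x < v" using order_tendstoD(2)[OF lim_bot assms(1)] .
  then obtain B where "\<And>x. x \<le> B \<Longrightarrow> u0 x < v" by (auto simp: eventually_at_bot_linorder)
  then have "u0 (min B xm) \<le> v" by (simp add: less_imp_le)
  then obtain x where x: "x \<le> xm" "u0 x = v"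
    using IVT'[of u0 "min B xm" v xm] assms u0_cont by auto
  have "Xm v = x" unfolding Xm_def
  proof (rule the_equality)
    fix y assume "y \<le> xm \<and> u0 y = v"
    then show "y = x" using x u0_inc[of x y] u0_inc[of y x] by (cases x y rule: linorder_cases) auto
  qed (use x in auto)
  then show "Xm v \<le> xm" "u0 (Xm v) = v" using x by auto
qed

lemma u0_gt_iff:
  assumes "0 < v" "v \<le> um"
  shows "v < u0 x \<longleftrightarrow> Xm v < x \<and> x < Xp v" "v \<le> u0 x \<longleftrightarrow> Xm v \<le> x \<and> x \<le> Xp v"
proof -
  note p = Xp[OF assms] and m = Xm[OF assms]
  have "(v < u0 x \<longleftrightarrow> Xm v < x \<and> x < Xp v) \<and> (v \<le> u0 x \<longleftrightarrow> Xm v \<le> x \<and> x \<le> Xp v)"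
  proof (cases "xm \<le> x")
    case True
    have "Xm v \<le> x" using m True by simp
    moreover have "Xm v < x \<or> x = Xm v" using m True by auto
    ultimately show ?thesis
      using p m True u0_dec[of x "Xp v"] u0_dec[of "Xp v" x] u0_dec[of xm x]
      by (cases x "Xp v" rule: linorder_cases) (auto simp: less_le)
  next
    case False
    then show ?thesis
      using p m u0_inc[of x "Xm v"] u0_inc[of "Xm v" x]
      by (cases x "Xm v" rule: linorder_cases) auto
  qed
  then show "v < u0 x \<longleftrightarrow> Xm v < x \<and> x < Xp v" "v \<le> u0 x \<longleftrightarrow> Xm v \<le> x \<and> x \<le> Xp v" by auto
qed

section \<open>The counting function in terms of the level\<close>

lemma HK_lborel:
  fixes f :: "real \<Rightarrow> real"
  assumes "f integrable_on UNIV" "\<And>x. 0 \<le> f x" "f \<in> borel_measurable borel"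
  shows "integrable lborel f"
proof -
  have "f absolutely_integrable_on UNIV" using assms by (intro nonnegative_absolutely_integrable_1) auto
  then have "integrable lebesgue f" by (simp add: set_integrable_def)
  then show ?thesis using assms(3) by (subst (asm) integrable_completion) auto
qed

lemma sqrt_integrable: "integrable lborel (\<lambda>x. sqrt (u0 x))"
  using sqrt_int pos by (intro HK_lborel) (auto intro: less_imp_le)

lemma moment_integrable: "integrable lborel (\<lambda>x. (x\<^sup>2 + 1) * u0 x)"
proof (rule HK_lborel[OF moment])
  show "0 \<le> (x\<^sup>2 + 1) * u0 x" for x using pos[of x] by (intro mult_nonneg_nonneg) auto
qed measurable

lemma sqrt_min_integrable: "integrable lborel (\<lambda>x. sqrt (min (u0 x) h))" if "0 \<le> h"
  by (rule Bochner_Integration.integrable_bound[OF sqrt_integrable]) (use pos that in \<open>auto intro!: AE_I2 simp: less_imp_le\<close>)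

lemma sqrt_min_bound:
  obtains A where "0 \<le> A" "\<And>h. 0 \<le> h \<Longrightarrow> (\<integral>x. sqrt (min (u0 x) h) \<partial>lborel) \<le> A * h powr (1 / 14)"
proof -
  have i: "integrable lborel (\<lambda>x. 2 * ((x\<^sup>2 + 1) * u0 x) + weight x)"
    using moment_integrable weight_integrable by auto
  show thesis
  proof (rule that[of "\<integral>x. 2 * ((x\<^sup>2 + 1) * u0 x) + weight x \<partial>lborel"])
    show "0 \<le> (\<integral>x. 2 * ((x\<^sup>2 + 1) * u0 x) + weight x \<partial>lborel)"
      using pos by (intro Bochner_Integration.integral_nonneg) (auto simp: weight_def less_imp_le intro!: add_nonneg_nonneg mult_nonneg_nonneg)
    fix h :: real assume h: "0 \<le> h"
    have "(\<integral>x. sqrt (min (u0 x) h) \<partial>lborel) \<le> (\<integral>x. h powr (1 / 14) * (2 * ((x\<^sup>2 + 1) * u0 x) + weight x) \<partial>lborel)"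
      using i by (intro integral_mono sqrt_min_integrable h sqrt_min_le pos) auto
    then show "(\<integral>x. sqrt (min (u0 x) h) \<partial>lborel) \<le> (\<integral>x. 2 * ((x\<^sup>2 + 1) * u0 x) + weight x \<partial>lborel) * h powr (1 / 14)"
      by (simp add: mult.commute)
  qed
qed

text \<open>From the modulus of \<open>Wgap\<close> at an increment 2 d m with m <= um: the linear
  part is at most 2 d sqrt um * sqrt m, the root part is 4 sqrt d * sqrt m.\<close>

definition gap_const :: real where "gap_const = 2 * d * sqrt um + 4 * sqrt d"

text \<open>This is \<open>Rwyl\<close> as a function of the level. Integrating over the whole line
  covers v = 0, where the turning points are infinite, on the same footing.\<close>

definition Q :: "real \<Rightarrow> real" where "Q v = (\<integral>x. Wgap (2 * d * (u0 x - v)) \<partial>lborel) / (4 * d)"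

lemmas [measurable] = Wgap_measurable

text \<open>Only the positive part of the interval between the two arguments matters. Its length is
  at most 2 d (v' - v) and, the larger argument being at most 2 d u0 x, also at most 2 d u0 x. The
  minimum of the two makes the bound both small and integrable.\<close>

lemma Wgap_diff_bound:
  assumes "0 \<le> v" "v \<le> v'"
  shows "0 \<le> Wgap (2 * d * (u0 x - v)) - Wgap (2 * d * (u0 x - v'))"
    "Wgap (2 * d * (u0 x - v)) - Wgap (2 * d * (u0 x - v')) \<le> gap_const * sqrt (min (u0 x) (v' - v))"
proof -
  define a b m where "a = 2 * d * (u0 x - v)" and "b = 2 * d * (u0 x - v')" and "m = min (u0 x) (v' - v)"
  have ba: "b \<le> a" unfolding a_def b_def using assms d_pos by (intro mult_left_mono) auto
  have m: "0 \<le> m" "m \<le> um" using pos[of x] maxim[of x] assms by (auto simp: m_def)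
  show "0 \<le> Wgap (2 * d * (u0 x - v)) - Wgap (2 * d * (u0 x - v'))"
    using Wgap_increment(1)[OF ba] by (simp add: a_def b_def)
  have K0: "0 \<le> gap_const * sqrt m" using m d_pos pos[of xm] by (simp add: gap_const_def)
  show "Wgap (2 * d * (u0 x - v)) - Wgap (2 * d * (u0 x - v')) \<le> gap_const * sqrt (min (u0 x) (v' - v))"
  proof (cases "a \<le> 0")
    case True
    then have "Wgap a = 0" "Wgap b = 0" using ba Wgap_neg[of a] Wgap_neg[of b] Wgap_0 by (auto simp: le_less)
    then show ?thesis using K0 by (simp add: a_def b_def m_def)
  next
    case False
    define b' where "b' = max b 0"
    have b': "Wgap b = Wgap b'" using Wgap_neg[of b] Wgap_0 by (auto simp: b'_def max_def le_less)
    have le: "b' \<le> a" using False ba by (simp add: b'_def)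
    have am: "a - b' \<le> 2 * d * m"
    proof (cases "u0 x \<le> v' - v")
      case True
      have "2 * d * (u0 x - v) \<le> 2 * d * u0 x" using d_pos assms by (intro mult_left_mono) auto
      then show ?thesis using True by (simp add: m_def a_def b'_def)
    next
      case False
      then have mv: "m = v' - v" by (simp add: m_def)
      have "a - b = 2 * d * m" unfolding mv a_def b_def by (simp add: algebra_simps)
      then show ?thesis by (simp add: b'_def)
    qed
    have "Wgap a - Wgap b \<le> (a - b') + 2 * sqrt (2 * (a - b'))" unfolding b' by (rule Wgap_increment(2)[OF le])
    also have "\<dots> \<le> 2 * d * m + 2 * sqrt (2 * (2 * d * m))"
      using am by (intro add_mono mult_left_mono real_sqrt_le_mono) auto
    also have "2 * sqrt (2 * (2 * d * m)) = 4 * sqrt d * sqrt m"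
      by (simp add: real_sqrt_mult)
    also have "2 * d * m = 2 * d * sqrt m * sqrt m" using m by simp
    also have "\<dots> \<le> 2 * d * sqrt um * sqrt m" using m d_pos by (intro mult_right_mono mult_left_mono real_sqrt_le_mono) auto
    finally show ?thesis by (simp add: gap_const_def distrib_right a_def b_def m_def)
  qed
qed

lemma Wgap_um: "Wgap (2 * d * (u0 x - um)) = 0"
proof -
  have "2 * d * (u0 x - um) \<le> 2 * d * 0" using maxim[of x] d_pos by (intro mult_left_mono) auto
  then have "2 * d * (u0 x - um) < 0 \<or> 2 * d * (u0 x - um) = 0" by linarith
  then show ?thesis using Wgap_neg Wgap_0 by metis
qed

lemma Wgap_integrable:
  assumes "0 \<le> v" "v \<le> um"
  shows "integrable lborel (\<lambda>x. Wgap (2 * d * (u0 x - v)))"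
proof (rule Bochner_Integration.integrable_bound)
  show "integrable lborel (\<lambda>x. gap_const * sqrt (u0 x))" using sqrt_integrable by auto
  show "AE x in lborel. norm (Wgap (2 * d * (u0 x - v))) \<le> norm (gap_const * sqrt (u0 x))"
  proof (rule AE_I2)
    fix x
    have K: "0 \<le> gap_const" using d_pos pos[of xm] by (simp add: gap_const_def)
    \<comment> \<open>Integrability comes from the difference bound with \<open>v' = um\<close>, a
      level at which \<open>Wgap\<close> vanishes for every x.\<close>
    then have "gap_const * sqrt (min (u0 x) (um - v)) \<le> gap_const * sqrt (u0 x)" by (intro mult_left_mono real_sqrt_le_mono) auto
    then show "norm (Wgap (2 * d * (u0 x - v))) \<le> norm (gap_const * sqrt (u0 x))"
      using Wgap_diff_bound[OF assms, of x] Wgap_um[of x] Wgap_nonneg K pos[of x] by (simp add: abs_mult)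
  qed
qed measurable

lemma Q_um: "Q um = 0" by (simp add: Q_def Wgap_um)

lemma Q_diff:
  assumes "0 \<le> v" "v \<le> v'" "v' \<le> um"
  shows "Q v - Q v' = (\<integral>x. Wgap (2 * d * (u0 x - v)) - Wgap (2 * d * (u0 x - v')) \<partial>lborel) / (4 * d)"
  using Wgap_integrable[of v] Wgap_integrable[of v'] assms by (simp add: Q_def diff_divide_distrib)

lemma Q_strict:
  assumes "0 \<le> v" "v < v'" "v' \<le> um"
  shows "Q v' < Q v"
proof -
  define f where "f x = Wgap (2 * d * (u0 x - v)) - Wgap (2 * d * (u0 x - v'))" for x
  have f: "integrable lborel f" "\<And>x. 0 \<le> f x"
    using Wgap_integrable[of v] Wgap_integrable[of v'] Wgap_diff_bound(1)[of v v'] assms by (auto simp: f_def[abs_def])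
  \<comment> \<open>An intermediate level: where \<open>u0\<close> exceeds it, a nonempty open
    interval, the integrand is strictly positive.\<close>
  define s where "s = (v + v') / 2"
  have s: "0 < s" "s < um" "s \<le> um" "v < s" using assms by (auto simp: s_def)
  have "(\<integral>x. f x \<partial>lborel) \<noteq> 0"
  proof
    assume "(\<integral>x. f x \<partial>lborel) = 0"
    then have "AE x in lborel. f x = 0"
      using integral_nonneg_eq_0_iff_AE[OF f(1)] f(2) by simp
    moreover have "f x \<noteq> 0" if "x \<in> {Xm s<..<Xp s}" for x
    proof -
      have "s < u0 x" using u0_gt_iff(1)[OF s(1,3), of x] that by simp
      then have "0 < 2 * d * (u0 x - v)" "2 * d * (u0 x - v') < 2 * d * (u0 x - v)" using s d_pos assms by auto
      then have "Wgap (2 * d * (u0 x - v')) < Wgap (2 * d * (u0 x - v))" by (rule Wgap_strict)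
      then show ?thesis by (simp add: f_def)
    qed
    ultimately have "AE x in lborel. x \<notin> {Xm s<..<Xp s}" by (auto elim: eventually_mono)
    then have "emeasure lborel {Xm s<..<Xp s} = 0"
      by (subst (asm) AE_iff_measurable[where N="{Xm s<..<Xp s}"]) auto
    then show False using u0_gt_iff(1)[OF s(1,3), of xm] s by simp
  qed
  moreover have "0 \<le> (\<integral>x. f x \<partial>lborel)" using f(2) by (rule Bochner_Integration.integral_nonneg)
  ultimately have "0 < (\<integral>x. f x \<partial>lborel) / (4 * d)" using d_pos by simp
  then show ?thesis using Q_diff[of v v'] assms by (simp add: f_def)
qed

lemma Q_hoelder: "\<exists>A\<ge>0. \<forall>v v'. 0 \<le> v \<longrightarrow> v \<le> v' \<longrightarrow> v' \<le> um \<longrightarrow> Q v - Q v' \<le> A * (v' - v) powr (1 / 14)"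
proof -
  obtain A where A: "0 \<le> A" "\<And>h. 0 \<le> h \<Longrightarrow> (\<integral>x. sqrt (min (u0 x) h) \<partial>lborel) \<le> A * h powr (1 / 14)"
    using sqrt_min_bound by metis
  have K: "0 \<le> gap_const" using d_pos pos[of xm] by (simp add: gap_const_def)
  have "Q v - Q v' \<le> (gap_const * A / (4 * d)) * (v' - v) powr (1 / 14)" if v: "0 \<le> v" "v \<le> v'" "v' \<le> um" for v v'
  proof -
    have "(\<integral>x. Wgap (2 * d * (u0 x - v)) - Wgap (2 * d * (u0 x - v')) \<partial>lborel) \<le> (\<integral>x. gap_const * sqrt (min (u0 x) (v' - v)) \<partial>lborel)"
      using Wgap_integrable[of v] Wgap_integrable[of v'] v sqrt_min_integrable[of "v' - v"] Wgap_diff_bound(2)[OF v(1,2)]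
      by (intro integral_mono) auto
    also have "\<dots> \<le> gap_const * (A * (v' - v) powr (1 / 14))"
      using A(2)[of "v' - v"] v K by (simp add: mult_left_mono)
    finally show ?thesis unfolding Q_diff[OF v] using d_pos by (simp add: divide_right_mono field_simps)
  qed
  then show ?thesis using A(1) K d_pos by (intro exI[of _ "gap_const * A / (4 * d)"]) auto
qed

text \<open>Strictly below the maximum \<open>u0'\<close> does not vanish at the turning points, so
  \<open>u0\<close> crosses v linearly and the singularity is that of 1 / sqrt |x|. The level v/2
  confines everything to a compact interval that will contain the support of all difference
  quotients of step below v/2.\<close>

lemma inverse_sqrt_dominator:
  assumes "0 < v" "v < um"
  shows "integrable lborel (\<lambda>x. indicator {Xm (v/2)..Xp (v/2)} x * (1 / sqrt \<bar>u0 x - v\<bar>))"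
proof -
  have v: "0 < v" "v \<le> um" "0 < v / 2" "v / 2 \<le> um" using assms by auto
  note p = Xp[OF v(1,2)] and m = Xm[OF v(1,2)] and p2 = Xp[OF v(3,4)] and m2 = Xm[OF v(3,4)]
  have ne: "xm \<noteq> Xp v" "xm \<noteq> Xm v" using p m assms by auto
  obtain c1 where c1: "0 < c1" "\<And>x. x \<in> {xm..Xp (v/2)} \<Longrightarrow> c1 * \<bar>x - Xp v\<bar> \<le> \<bar>u0 x - u0 (Xp v)\<bar>"
  proof (rule DERIV_linear_lower_bound[OF deriv[of "Xp v"] _ u0_cont])
    show "u0' (Xp v) \<noteq> 0" using crit ne by auto
    fix x assume "x \<in> {xm..Xp (v/2)}" "x \<noteq> Xp v"
    then show "u0 x \<noteq> u0 (Xp v)" using p u0_dec[of x "Xp v"] u0_dec[of "Xp v" x] by (cases x "Xp v" rule: linorder_cases) auto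
  qed (rule that, assumption, blast)
  obtain c2 where c2: "0 < c2" "\<And>x. x \<in> {Xm (v/2)..xm} \<Longrightarrow> c2 * \<bar>x - Xm v\<bar> \<le> \<bar>u0 x - u0 (Xm v)\<bar>"
  proof (rule DERIV_linear_lower_bound[OF deriv[of "Xm v"] _ u0_cont])
    show "u0' (Xm v) \<noteq> 0" using crit ne by auto
    fix x assume "x \<in> {Xm (v/2)..xm}" "x \<noteq> Xm v"
    then show "u0 x \<noteq> u0 (Xm v)" using m u0_inc[of x "Xm v"] u0_inc[of "Xm v" x] by (cases x "Xm v" rule: linorder_cases) auto
  qed (rule that, assumption, blast)
  have le: "1 / sqrt \<bar>y\<bar> \<le> 1 / sqrt c * (1 / sqrt \<bar>t\<bar>)" if "0 < c" "c * \<bar>t\<bar> \<le> \<bar>y\<bar>" "t \<noteq> 0" for c t y :: real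
  proof -
    have ct: "0 < c * \<bar>t\<bar>" using that by simp
    then have "1 / sqrt \<bar>y\<bar> \<le> 1 / sqrt (c * \<bar>t\<bar>)"
      using that(2) less_le_trans[OF ct that(2)] by (intro divide_left_mono mult_pos_pos real_sqrt_le_mono) auto
    then show ?thesis by (simp add: real_sqrt_mult)
  qed
  define F where "F x = 1 / sqrt c1 * (indicator {xm..Xp (v/2)} x * (1 / sqrt \<bar>x - Xp v\<bar>)) +
     1 / sqrt c2 * (indicator {Xm (v/2)..xm} x * (1 / sqrt \<bar>x - Xm v\<bar>))" for x
  have "integrable lborel F" unfolding F_def[abs_def]
    by (intro Bochner_Integration.integrable_add integrable_mult_right integrable_inverse_sqrt)
  then show ?thesis
  proof (rule Bochner_Integration.integrable_bound)
    show "AE x in lborel. norm (indicator {Xm (v/2)..Xp (v/2)} x * (1 / sqrt \<bar>u0 x - v\<bar>)) \<le> norm (F x)"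
      using AE_lborel_singleton[of "Xp v"] AE_lborel_singleton[of "Xm v"]
    proof eventually_elim
      case (elim x)
      have nn: "0 \<le> 1 / sqrt c1 * (indicator {xm..Xp (v/2)} x * (1 / sqrt \<bar>x - Xp v\<bar>))"
        "0 \<le> 1 / sqrt c2 * (indicator {Xm (v/2)..xm} x * (1 / sqrt \<bar>x - Xm v\<bar>))"
        using c1 c2 by (auto intro!: mult_nonneg_nonneg)
      have "indicator {Xm (v/2)..Xp (v/2)} x * (1 / sqrt \<bar>u0 x - v\<bar>) \<le> F x"
      proof (cases "x \<in> {Xm (v/2)..Xp (v/2)}")
        case True
        show ?thesis
        proof (cases "xm \<le> x")
          case xm: True
          then have "1 / sqrt \<bar>u0 x - v\<bar> \<le> 1 / sqrt c1 * (1 / sqrt \<bar>x - Xp v\<bar>)"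
            using True c1(2)[of x] p elim by (intro le c1) auto
          then show ?thesis using True xm nn by (simp add: F_def)
        next
          case False
          then have "1 / sqrt \<bar>u0 x - v\<bar> \<le> 1 / sqrt c2 * (1 / sqrt \<bar>x - Xm v\<bar>)"
            using True c2(2)[of x] m elim by (intro le c2) auto
          then show ?thesis using True False nn by (simp add: F_def)
        qed
      qed (use nn in \<open>simp add: F_def\<close>)
      moreover have "0 \<le> F x" unfolding F_def using nn by (rule add_nonneg_nonneg)
      ultimately show ?case by (simp add: abs_mult)
    qed
  qed measurable
qed

text \<open>Differentiation under the integral sign: \<open>Wgap\<close> is not differentiable at 0,
  but the argument vanishes only at the two turning points, and \<open>Wgap_lipschitz_away\<close>
  with \<open>inverse_sqrt_dominator\<close> provides the dominating function.\<close>

lemma Q_differentiable: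
  assumes "0 < v" "v < um"
  shows "Q differentiable (at v)"
proof -
  have v: "0 < v" "v \<le> um" "0 < v / 2" "v / 2 \<le> um" using assms by auto
  define S where "S = 2 * d * (um + v)"
  define Cs where "Cs = (sqrt S + 4) * (2 * d) / sqrt (2 * d)"
  define D where "D = (\<integral>x. - 2 * d * dWgap (2 * d * (u0 x - v)) \<partial>lborel) / (4 * d)"
  have S0: "0 \<le> S" using d_pos pos[of xm] v by (simp add: S_def)
  have quot: "\<bar>(Wgap (2 * d * (u0 x - (v + h))) - Wgap (2 * d * (u0 x - v))) / h\<bar> \<le>
     Cs * (indicator {Xm (v/2)..Xp (v/2)} x * (1 / sqrt \<bar>u0 x - v\<bar>))" if h: "h \<noteq> 0" "\<bar>h\<bar> < v / 2" and x: "u0 x \<noteq> v" for h x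
  proof (cases "v / 2 \<le> u0 x")
    case True
    define s where "s = 2 * d * (u0 x - v)"
    have s: "s \<noteq> 0" "\<bar>s\<bar> \<le> S"
    proof -
      show "s \<noteq> 0" using x d_pos by (simp add: s_def)
      have "\<bar>u0 x - v\<bar> \<le> um + v" using pos[of x] maxim[of x] v by linarith
      then show "\<bar>s\<bar> \<le> S" using d_pos by (simp add: s_def S_def abs_mult)
    qed
    have "2 * d * (u0 x - (v + h)) = s - 2 * d * h" by (simp add: s_def algebra_simps)
    then have "\<bar>Wgap (2 * d * (u0 x - (v + h))) - Wgap (2 * d * (u0 x - v))\<bar> \<le> (sqrt S + 4) * \<bar>2 * d * h\<bar> / sqrt \<bar>s\<bar>"
      using Wgap_lipschitz_away[OF s, of "2 * d * h"] by (simp add: s_def abs_minus_commute)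
    also have "sqrt \<bar>s\<bar> = sqrt (2 * d) * sqrt \<bar>u0 x - v\<bar>"
      using d_pos by (simp add: s_def abs_mult real_sqrt_mult)
    also have "(sqrt S + 4) * \<bar>2 * d * h\<bar> / (sqrt (2 * d) * sqrt \<bar>u0 x - v\<bar>) = Cs * (1 / sqrt \<bar>u0 x - v\<bar>) * \<bar>h\<bar>"
      using d_pos by (simp add: Cs_def abs_mult)
    finally show ?thesis using True h(1) u0_gt_iff(2)[OF v(3,4), of x] by (simp add: abs_divide pos_divide_le_eq)
  next
    case False
    then have "u0 x - (v + h) < 0" "u0 x - v < 0" using h v by linarith+
    then have "Wgap (2 * d * (u0 x - (v + h))) = 0" "Wgap (2 * d * (u0 x - v)) = 0"
      using d_pos by (auto intro!: Wgap_neg mult_pos_neg)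
    moreover have "0 \<le> Cs" using d_pos S0 by (simp add: Cs_def)
    ultimately show ?thesis by simp
  qed
  have ae: "AE x in lborel. u0 x \<noteq> v"
    using AE_lborel_singleton[of "Xp v"] AE_lborel_singleton[of "Xm v"]
    by eventually_elim (use u0_gt_iff[OF v(1,2)] in \<open>smt (verit)\<close>)
  have "((\<lambda>h. (Q (v + h) - Q v) / h) \<longlongrightarrow> D) (at 0)"
    unfolding tendsto_at_iff_sequentially
  proof (intro allI impI)
    fix X :: "nat \<Rightarrow> real" assume X: "\<forall>i. X i \<in> UNIV - {0}" "X \<longlonglongrightarrow> 0"
    \<comment> \<open>Keeps v + h between 0 and um, where \<open>Q\<close> is finite, and |h| below
      v/2 as the domination requires.\<close>
    define r where "r = min (v / 2) (um - v)"
    have r: "0 < r" "r \<le> v / 2" "r \<le> um - v" using assms by (auto simp: r_def min_def)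
    obtain n0 where n0: "\<And>n. n \<ge> n0 \<Longrightarrow> \<bar>X n\<bar> < r"
      using X(2) r(1) unfolding LIMSEQ_iff by auto
    define Y where "Y n = X (n + n0)" for n
    have Y: "Y n \<noteq> 0" "\<bar>Y n\<bar> < r" for n using X(1) n0 by (auto simp: Y_def)
    have Y0: "Y \<longlonglongrightarrow> 0" unfolding Y_def by (rule LIMSEQ_ignore_initial_segment[OF X(2)])
    have "(\<lambda>n. \<integral>x. (Wgap (2 * d * (u0 x - (v + Y n))) - Wgap (2 * d * (u0 x - v))) / Y n \<partial>lborel)
       \<longlonglongrightarrow> (\<integral>x. - 2 * d * dWgap (2 * d * (u0 x - v)) \<partial>lborel)"
    proof (rule integral_dominated_convergence)
      show "integrable lborel (\<lambda>x. Cs * (indicator {Xm (v/2)..Xp (v/2)} x * (1 / sqrt \<bar>u0 x - v\<bar>)))"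
        by (intro integrable_mult_right inverse_sqrt_dominator assms)
      show "AE x in lborel. norm ((Wgap (2 * d * (u0 x - (v + Y n))) - Wgap (2 * d * (u0 x - v))) / Y n) \<le>
         Cs * (indicator {Xm (v/2)..Xp (v/2)} x * (1 / sqrt \<bar>u0 x - v\<bar>))" for n
        using ae
      proof eventually_elim
        case (elim x)
        have "\<bar>Y n\<bar> < v / 2" using Y(2)[of n] r by linarith
        from quot[OF Y(1) this elim] show ?case by simp
      qed
      show lim: "AE x in lborel. (\<lambda>n. (Wgap (2 * d * (u0 x - (v + Y n))) - Wgap (2 * d * (u0 x - v))) / Y n)
          \<longlonglongrightarrow> - 2 * d * dWgap (2 * d * (u0 x - v))"
        using ae
      proof eventually_elim
        case (elim x)
        have "((\<lambda>t. Wgap (2 * d * (u0 x - t))) has_real_derivative - 2 * d * dWgap (2 * d * (u0 x - v))) (at v)"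
        proof -
          have "((\<lambda>t. 2 * d * (u0 x - t)) has_real_derivative - 2 * d) (at v)"
            by (auto intro!: derivative_eq_intros)
          from DERIV_chain2[OF Wgap_deriv this] show ?thesis using elim d_pos by (simp add: mult.commute)
        qed
        then have "((\<lambda>h. (Wgap (2 * d * (u0 x - (v + h))) - Wgap (2 * d * (u0 x - v))) / h) \<longlongrightarrow> - 2 * d * dWgap (2 * d * (u0 x - v))) (at 0)"
          by (simp add: DERIV_def)
        then show ?case
          unfolding tendsto_at_iff_sequentially using Y(1) Y0 by (auto simp: o_def)
      qed
      show "(\<lambda>x. - 2 * d * dWgap (2 * d * (u0 x - v))) \<in> borel_measurable lborel"
      proof -
        note dWgap_measurable[measurable]
        show ?thesis by measurable
      qed
    qed measurable
    then have "(\<lambda>n. (\<integral>x. (Wgap (2 * d * (u0 x - (v + Y n))) - Wgap (2 * d * (u0 x - v))) / Y n \<partial>lborel) / (4 * d)) \<longlonglongrightarrow> D"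
      unfolding D_def by (rule tendsto_divide[OF _ tendsto_const]) (use d_pos in simp)
    moreover have "(\<integral>x. (Wgap (2 * d * (u0 x - (v + Y n))) - Wgap (2 * d * (u0 x - v))) / Y n \<partial>lborel) / (4 * d) = (Q (v + Y n) - Q v) / Y n" for n
    proof -
      have "0 \<le> v + Y n" "v + Y n \<le> um" using Y(2)[of n] r v by linarith+
      then show ?thesis
        using Wgap_integrable[of v] Wgap_integrable[of "v + Y n"] v
        by (simp add: Q_def diff_divide_distrib mult.commute)
    qed
    ultimately have "(\<lambda>n. (Q (v + Y n) - Q v) / Y n) \<longlonglongrightarrow> D" by simp
    then show "((\<lambda>h. (Q (v + h) - Q v) / h) \<circ> X) \<longlonglongrightarrow> D"
      unfolding o_def Y_def by (rule LIMSEQ_offset)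
  qed
  then have "(Q has_real_derivative D) (at v)" by (simp add: DERIV_def)
  then show ?thesis by (auto simp: real_differentiable_def)
qed

end

section \<open>The spectral quantities of the initial datum\<close>

text \<open>The derivative of \<open>level\<close> extends continuously to 0 with value 0, so it is
  bounded on intervals that stay away from pi. It carries the Hoelder bound from the level to
  \<kappa>.\<close>

lemma level_lipschitz:
  assumes "0 \<le> b0" "b0 < pi"
  obtains K where "0 \<le> K" "\<And>a b. 0 \<le> a \<Longrightarrow> a \<le> b \<Longrightarrow> b \<le> b0 \<Longrightarrow> level b - level a \<le> K * (b - a)"
proof -
  define f where "f \<theta> = (if \<theta> = 0 then 0 else ((1 - \<theta> * cot \<theta>)\<^sup>2 + \<theta>\<^sup>2) / \<theta>)" for \<theta> :: real
  have "continuous_on {0..b0} f"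
    unfolding continuous_on_eq_continuous_within
  proof
    fix x assume x: "x \<in> {0..b0}"
    show "continuous (at x within {0..b0}) f"
    proof (cases "x = 0")
      case True
      have "((\<lambda>\<theta>::real. ((1 - \<theta> * (cos \<theta> / sin \<theta>))\<^sup>2 + \<theta>\<^sup>2) / \<theta>) \<longlongrightarrow> 0) (at_right 0)" by real_asymp
      then have "(f \<longlongrightarrow> 0) (at_right 0)"
        by (rule Lim_transform_eventually) (auto simp: eventually_at_filter f_def cot_def)
      then have "(f \<longlongrightarrow> 0) (at 0 within {0..})" by (simp add: at_within_Ici_at_right)
      then have "(f \<longlongrightarrow> 0) (at 0 within {0..b0})" by (rule tendsto_within_subset) auto
      then show ?thesis using True by (simp add: continuous_within f_def)
    next
      case False
      have "sin x \<noteq> 0" using sin_gt_zero[of x] x False assms by auto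
      then have "isCont (\<lambda>\<theta>. ((1 - \<theta> * cot \<theta>)\<^sup>2 + \<theta>\<^sup>2) / \<theta>) x" using False by (intro continuous_intros isCont_cot) auto
      then have "((\<lambda>\<theta>. ((1 - \<theta> * cot \<theta>)\<^sup>2 + \<theta>\<^sup>2) / \<theta>) \<longlongrightarrow> f x) (at x)" using False by (simp add: isCont_def f_def)
      then have "(f \<longlongrightarrow> f x) (at x)"
      proof (rule Lim_transform_eventually)
        have "\<forall>\<^sub>F y in at x. y \<noteq> 0" using False by (metis eventually_neq_at_within)
        then show "\<forall>\<^sub>F y in at x. ((1 - y * cot y)\<^sup>2 + y\<^sup>2) / y = f y" by eventually_elim (simp add: f_def)
      qed
      then show ?thesis by (auto intro: continuous_at_imp_continuous_at_within simp: isCont_def)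
    qed
  qed
  then have "bounded (f ` {0..b0})" by (intro compact_imp_bounded compact_continuous_image) auto
  then obtain K where K: "\<And>x. x \<in> {0..b0} \<Longrightarrow> \<bar>f x\<bar> \<le> K" unfolding bounded_iff real_norm_def by blast
  show thesis
  proof (rule that)
    show "0 \<le> K" using K[of 0] assms by simp
    fix a b assume ab: "0 \<le> a" "a \<le> b" "b \<le> b0"
    have "K * a - level a \<le> K * b - level b"
    proof (rule DERIV_nonneg_imp_increasing_open[OF ab(2)])
      fix x assume x: "a < x" "x < b"
      have "((\<lambda>x. K * x - level x) has_real_derivative (K - f x)) (at x)"
        using x ab assms by (auto intro!: derivative_eq_intros level_deriv simp: f_def)
      moreover have "0 \<le> K - f x" using K[of x] x ab by (simp add: abs_le_iff)
      ultimately show "\<exists>y. ((\<lambda>x. K * x - level x) has_real_derivative y) (at x) \<and> 0 \<le> y" by blast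
    next
      show "continuous_on {a..b} (\<lambda>x. K * x - level x)"
        using ab assms by (intro continuous_intros continuous_on_subset[OF level_cont[of b]]) auto
    qed
    then show "level b - level a \<le> K * (b - a)" by (simp add: algebra_simps)
  qed
qed

section \<open>The level and the counting function in terms of kappa\<close>

context initial_data begin

abbreviation "km \<equiv> kmax d um"
abbreviation "e \<equiv> height d"

lemma km_eq: "2 * d * km = angle (2 * d * um)" using d_pos by (simp add: kmax_angle)

lemma um_pos: "0 < 2 * d * um" using d_pos pos[of xm] by simp

lemma km_pos: "0 < km"
  using angle_strict[of 0 "2 * d * um"] um_pos angle_nonpos[of 0] d_pos by (simp add: kmax_angle)

lemma scaled_lt_pi: "\<kappa> \<le> km \<Longrightarrow> 2 * d * \<kappa> < pi"
proof -
  assume "\<kappa> \<le> km"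
  then have "2 * d * \<kappa> \<le> 2 * d * km" using d_pos by (intro mult_left_mono) auto
  then show ?thesis unfolding km_eq using angle(2)[of "2 * d * um"] um_pos by simp
qed

lemma e_0: "e 0 = 0" by (simp add: height_def level_0)

lemma e_km: "e km = um"
  using d_pos angle(3)[of "2 * d * um"] um_pos by (simp add: height_def km_eq)

lemma e_strict: "0 \<le> a \<Longrightarrow> a < b \<Longrightarrow> b \<le> km \<Longrightarrow> e a < e b"
  unfolding height_def using d_pos scaled_lt_pi[of b]
  by (intro divide_strict_right_mono level_strict mult_strict_left_mono) auto

lemma e_mono: "0 \<le> a \<Longrightarrow> a \<le> b \<Longrightarrow> b \<le> km \<Longrightarrow> e a \<le> e b"
  using e_strict[of a b] by (cases "a = b") auto

lemma e_range: "0 \<le> a \<Longrightarrow> a \<le> km \<Longrightarrow> 0 \<le> e a \<and> e a \<le> um"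
  using e_mono[of 0 a] e_mono[of a km] e_0 e_km by simp

lemma e_pos: "0 < a \<Longrightarrow> a \<le> km \<Longrightarrow> 0 < e a"
  using e_strict[of 0 a] e_0 by simp

lemma e_cont: "continuous_on {0..km} e"
  unfolding height_def
proof (intro continuous_on_divide continuous_on_const)
  show "continuous_on {0..km} (\<lambda>\<kappa>. level (2 * d * \<kappa>))"
  proof (rule continuous_on_compose2[OF level_cont[of "2 * d * km"]])
    show "2 * d * km < pi" by (rule scaled_lt_pi) simp
    show "continuous_on {0..km} (\<lambda>\<kappa>. 2 * d * \<kappa>)" by (intro continuous_intros)
  qed (use d_pos in auto)
qed (use d_pos in auto)

lemma e_differentiable:
  assumes "0 < a" "a < km"
  shows "\<exists>D. (e has_real_derivative D) (at a)"
proof -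
  have "0 < 2 * d * a" "2 * d * a < pi" using assms d_pos scaled_lt_pi[of a] by auto
  note h = level_deriv[OF this]
  have g: "((\<lambda>x. 2 * d * x) has_real_derivative 2 * d) (at a)" by (auto intro!: derivative_eq_intros)
  have "((\<lambda>\<kappa>. level (2 * d * \<kappa>)) has_real_derivative
      ((1 - 2 * d * a * cot (2 * d * a))\<^sup>2 + (2 * d * a)\<^sup>2) / (2 * d * a) * (2 * d)) (at a)"
    by (rule DERIV_chain2[where f=level and g="\<lambda>x. 2 * d * x", OF h g])
  from DERIV_cdivide[OF this, of "2 * d"] show ?thesis unfolding height_def by blast
qed

lemma e_lipschitz: "\<exists>K\<ge>0. \<forall>a b. 0 \<le> a \<longrightarrow> a \<le> b \<longrightarrow> b \<le> km \<longrightarrow> e b - e a \<le> K * (b - a)"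
proof -
  have s: "0 \<le> 2 * d * km" "2 * d * km < pi" using d_pos km_pos scaled_lt_pi[of km] by auto
  obtain K where K: "0 \<le> K" "\<And>a b. 0 \<le> a \<Longrightarrow> a \<le> b \<Longrightarrow> b \<le> 2 * d * km \<Longrightarrow> level b - level a \<le> K * (b - a)"
    using level_lipschitz[OF s] by metis
  have "e b - e a \<le> K * (b - a)" if "0 \<le> a" "a \<le> b" "b \<le> km" for a b
  proof -
    have "level (2 * d * b) - level (2 * d * a) \<le> K * (2 * d * b - 2 * d * a)"
      using that d_pos by (intro K) auto
    then have "(level (2 * d * b) - level (2 * d * a)) / (2 * d) \<le> (K * (2 * d * b - 2 * d * a)) / (2 * d)"
      using d_pos by (intro divide_right_mono) auto
    also have "\<dots> = K * (b - a)" using d_pos by (simp add: field_simps)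
    finally show ?thesis by (simp add: height_def diff_divide_distrib)
  qed
  then show ?thesis using K(1) by blast
qed

lemma xplus_Xp: "0 \<le> \<kappa> \<Longrightarrow> \<kappa> \<le> km \<Longrightarrow> xplus d u0 xm \<kappa> = Xp (e \<kappa>)"
  using Re_Efun[OF d_pos _ scaled_lt_pi, of \<kappa>] by (simp add: xplus_def Xp_def)

lemma xminus_Xm: "0 \<le> \<kappa> \<Longrightarrow> \<kappa> \<le> km \<Longrightarrow> xminus d u0 xm \<kappa> = Xm (e \<kappa>)"
  using Re_Efun[OF d_pos _ scaled_lt_pi, of \<kappa>] by (simp add: xminus_def Xm_def)

text \<open>At \<kappa> = 0 the definition integrates over the line, elsewhere between the turning
  points; outside them the argument of \<open>Wgap\<close> is negative and the integrand is 0, so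
  both cases give \<open>Q\<close>.\<close>

lemma Rwyl_Q:
  assumes "0 \<le> \<kappa>" "\<kappa> \<le> km"
  shows "Rwyl d u0 xm \<kappa> = Q (e \<kappa>)"
proof -
  have aa: "Re (aa d \<kappa> u) = - exp (- 1 - 2 * d * (u - e \<kappa>))" for u
    unfolding Re_aa[OF d_pos assms(1) scaled_lt_pi[OF assms(2)]] by (simp add: algebra_simps)
  define f where "f x = Wgap (2 * d * (u0 x - e \<kappa>))" for x
  have f: "Re (lambertW0 (Re (aa d \<kappa> (u0 x))) - lambertWm1 (Re (aa d \<kappa> (u0 x)))) = f x" for x
    unfolding aa f_def Wgap_def ..
  have int: "integral UNIV f = (\<integral>x. f x \<partial>lborel)"
    unfolding f_def using e_range[OF assms] Wgap_integrable[of "e \<kappa>"]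
    by (intro integral_unique has_integral_integral_lborel) auto
  have "integral {Xm (e \<kappa>)..Xp (e \<kappa>)} f = integral UNIV f" if "\<kappa> \<noteq> 0"
  proof -
    have ep: "0 < e \<kappa>" "e \<kappa> \<le> um" using e_pos[of \<kappa>] e_range[OF assms] assms that by auto
    have "f = (\<lambda>x. if x \<in> {Xm (e \<kappa>)..Xp (e \<kappa>)} then f x else 0)"
    proof
      fix x
      show "f x = (if x \<in> {Xm (e \<kappa>)..Xp (e \<kappa>)} then f x else 0)"
      proof (cases "e \<kappa> \<le> u0 x")
        case True
        then show ?thesis using u0_gt_iff(2)[OF ep, of x] by simp
      next
        case False
        then have "2 * d * (u0 x - e \<kappa>) < 0" using d_pos by (intro mult_pos_neg) auto
        then show ?thesis using False by (simp add: f_def Wgap_neg)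
      qed
    qed
    then have "integral UNIV f = integral UNIV (\<lambda>x. if x \<in> {Xm (e \<kappa>)..Xp (e \<kappa>)} then f x else 0)" by simp
    then show ?thesis by (simp only: integral_restrict_UNIV)
  qed
  moreover have "Q (e \<kappa>) = integral UNIV f / (4 * d)" unfolding int Q_def f_def ..
  ultimately show ?thesis
    unfolding Rwyl_def f Let_def xplus_Xp[OF assms] xminus_Xm[OF assms] by simp
qed

lemma zeta_cont: "continuous_on {0..km} (zeta d)"
proof -
  define rz where "rz \<kappa> = (if \<kappa> = 0 then 1 / (2 * d) else \<kappa> * cot (2 * d * \<kappa>))" for \<kappa>
  have z: "zeta d = (\<lambda>\<kappa>. of_real (rz \<kappa>) + \<i> * of_real \<kappa>)"
    by (auto simp: fun_eq_iff zeta_def rz_def complex_eq_iff)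
  have "continuous_on {0..km} rz"
    unfolding continuous_on_eq_continuous_within
  proof
    fix x assume x: "x \<in> {0..km}"
    show "continuous (at x within {0..km}) rz"
    proof (cases "x = 0")
      case True
      have "((\<lambda>\<kappa>::real. \<kappa> * (cos (2 * d * \<kappa>) / sin (2 * d * \<kappa>))) \<longlongrightarrow> 1 / (2 * d)) (at_right 0)"
      proof -
        have "1 / (2 * d) = inverse d / 2" by (simp add: field_simps)
        then show ?thesis using d_pos by (simp only:) real_asymp
      qed
      then have "(rz \<longlongrightarrow> 1 / (2 * d)) (at_right 0)"
        by (rule Lim_transform_eventually) (auto simp: eventually_at_filter rz_def cot_def)
      then have "(rz \<longlongrightarrow> 1 / (2 * d)) (at 0 within {0..})" by (simp add: at_within_Ici_at_right)
      then have "(rz \<longlongrightarrow> 1 / (2 * d)) (at 0 within {0..km})" by (rule tendsto_within_subset) auto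
      then show ?thesis using True by (simp add: continuous_within rz_def)
    next
      case False
      then have "0 < 2 * d * x" "2 * d * x < pi" using x d_pos scaled_lt_pi[of x] by auto
      then have "sin (2 * d * x) \<noteq> 0" using sin_gt_zero[of "2 * d * x"] by simp
      then have "isCont (\<lambda>\<kappa>. \<kappa> * (cos (2 * d * \<kappa>) / sin (2 * d * \<kappa>))) x" by (intro continuous_intros) auto
      then have "((\<lambda>\<kappa>. \<kappa> * (cos (2 * d * \<kappa>) / sin (2 * d * \<kappa>))) \<longlongrightarrow> rz x) (at x)" using False by (simp add: isCont_def rz_def cot_def)
      then have "(rz \<longlongrightarrow> rz x) (at x)"
      proof (rule Lim_transform_eventually)
        have "\<forall>\<^sub>F y in at x. y \<noteq> 0" using False by (metis eventually_neq_at_within)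
        then show "\<forall>\<^sub>F y in at x. y * (cos (2 * d * y) / sin (2 * d * y)) = rz y" by eventually_elim (simp add: rz_def cot_def)
      qed
      then show ?thesis by (auto intro: continuous_at_imp_continuous_at_within simp: isCont_def)
    qed
  qed
  then show ?thesis unfolding z by (intro continuous_intros)
qed

lemma zeta_Im: "Im (zeta d \<kappa>) = \<kappa>" by (simp add: zeta_def)

text \<open>\<open>Rwyl\<close> is \<open>Q\<close> after \<open>height\<close>. The Hoelder
  constant combines that of \<open>Q\<close> with the Lipschitz constant of \<open>height\<close>,
  raised to the exponent; continuity is read off the same estimate.\<close>

lemma weyl_gas_initial_data: "\<exists>C. weyl_gas km (Rwyl d u0 xm) (zeta d) C (1 / 14)"
proof -
  obtain A where A: "0 \<le> A" "\<And>v v'. 0 \<le> v \<Longrightarrow> v \<le> v' \<Longrightarrow> v' \<le> um \<Longrightarrow> Q v - Q v' \<le> A * (v' - v) powr (1 / 14)"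
    using Q_hoelder by blast
  obtain K where K: "0 \<le> K" "\<And>a b. 0 \<le> a \<Longrightarrow> a \<le> b \<Longrightarrow> b \<le> km \<Longrightarrow> e b - e a \<le> K * (b - a)"
    using e_lipschitz by blast
  define C where "C = A * K powr (1 / 14)"
  have hoelder: "Rwyl d u0 xm a - Rwyl d u0 xm b \<le> C * (b - a) powr (1 / 14)" if ab: "0 \<le> a" "a \<le> b" "b \<le> km" for a b
  proof -
    have "Q (e a) - Q (e b) \<le> A * (e b - e a) powr (1 / 14)"
      using ab e_mono[of a b] e_range[of a] e_range[of b] by (intro A) auto
    also have "\<dots> \<le> A * (K * (b - a)) powr (1 / 14)"
      using A(1) K(2)[OF ab] e_mono[OF ab] by (intro mult_left_mono powr_mono2) auto
    also have "\<dots> = C * (b - a) powr (1 / 14)" using K(1) ab by (simp add: C_def powr_mult)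
    finally show ?thesis using Rwyl_Q[of a] Rwyl_Q[of b] ab by simp
  qed
  have strict: "Rwyl d u0 xm b < Rwyl d u0 xm a" if "0 \<le> a" "a < b" "b \<le> km" for a b
    using Rwyl_Q[of a] Rwyl_Q[of b] Q_strict[of "e a" "e b"] e_strict[of a b] e_range[of a] e_range[of b] that by simp
  have "continuous_on {0..km} (Rwyl d u0 xm)"
    unfolding continuous_on_iff
  proof (intro ballI allI impI)
    fix x \<epsilon> :: real assume x: "x \<in> {0..km}" and \<epsilon>: "0 < \<epsilon>"
    have "((\<lambda>t::real. C * t powr (1 / 14)) \<longlongrightarrow> C * 0) (at_right 0)"
      by (intro tendsto_intros powr_tendsto_0_at_right) simp
    then have "\<forall>\<^sub>F t in at_right 0. C * t powr (1 / 14) < \<epsilon>" by (rule order_tendstoD(2)) (use \<epsilon> in simp)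
    then obtain b where b: "0 < b" "\<And>t. 0 < t \<Longrightarrow> t < b \<Longrightarrow> C * t powr (1 / 14) < \<epsilon>"
      by (auto simp: eventually_at_right_field)
    show "\<exists>\<delta>>0. \<forall>y\<in>{0..km}. dist y x < \<delta> \<longrightarrow> dist (Rwyl d u0 xm y) (Rwyl d u0 xm x) < \<epsilon>"
    proof (intro exI[of _ b] conjI b(1) ballI impI)
      fix y assume y: "y \<in> {0..km}" "dist y x < b"
      show "dist (Rwyl d u0 xm y) (Rwyl d u0 xm x) < \<epsilon>"
      proof (cases x y rule: linorder_cases)
        case less
        then show ?thesis using hoelder[of x y] strict[of x y] b(2)[of "y - x"] x y by (simp add: dist_real_def)
      next
        case greater
        then show ?thesis using hoelder[of y x] strict[of y x] b(2)[of "x - y"] x y by (simp add: dist_real_def)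
      qed (use \<epsilon> in simp)
    qed
  qed
  moreover have "Rwyl d u0 xm differentiable (at a)" if a: "0 < a" "a < km" for a
  proof -
    obtain D1 where D1: "(e has_real_derivative D1) (at a)" using e_differentiable[OF a] by blast
    have "0 < e a" "e a < um" using e_pos[of a] e_strict[of a km] e_km a by auto
    then obtain D2 where "(Q has_real_derivative D2) (at (e a))"
      using Q_differentiable by (auto simp: real_differentiable_def)
    from DERIV_chain2[OF this D1] have "((\<lambda>\<kappa>. Q (e \<kappa>)) has_real_derivative D2 * D1) (at a)" .
    then have "(Rwyl d u0 xm has_real_derivative D2 * D1) (at a)"
      by (rule has_field_derivative_transform_within_open[of _ _ _ "{0<..<km}"]) (use a Rwyl_Q in auto)
    then show ?thesis by (auto simp: real_differentiable_def)
  qed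
  moreover have "Rwyl d u0 xm km = 0" using Rwyl_Q[of km] km_pos by (simp add: e_km Q_um)
  ultimately have "weyl_gas km (Rwyl d u0 xm) (zeta d) C (1 / 14)"
    by unfold_locales (use km_pos strict hoelder zeta_cont zeta_Im in auto)
  then show ?thesis ..
qed

section \<open>The phase theta_+ and the external field\<close>

text \<open>On \<open>[xm, x_+]\<close> the integrand equals \<open>\<kappa>\<close>, which removes the unbounded point \<open>x_+\<close> from \<open>thetaPlus\<close>. At \<open>\<kappa> = 0\<close>,
  where \<open>thetaPlus\<close> is a junk value, this is the continuous extension.\<close>

definition theta_ext :: "real \<Rightarrow> real" where
  "theta_ext \<kappa> = \<kappa> * xm + (\<integral>x. indicator {xm..} x * (\<kappa> - angle (2 * d * (e \<kappa> - u0 x)) / (2 * d)) \<partial>lborel)"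

lemma angle_meas[measurable]: "angle \<in> borel_measurable borel"
  by (rule borel_measurable_continuous_onI[OF angle_cont])

lemma angle_e: "0 \<le> \<kappa> \<Longrightarrow> \<kappa> \<le> km \<Longrightarrow> angle (2 * d * e \<kappa>) = 2 * d * \<kappa>"
  using angle_level[of "2 * d * \<kappa>"] d_pos scaled_lt_pi[of \<kappa>] by (simp add: height_def)

text \<open>Since \<kappa> is itself angle (2 d e(\<kappa>)) / (2 d), the integrand is an increment
  of \<open>angle\<close> over a step 2 d u0 x. Its square-root modulus gives sqrt (u0 x), whose
  integrability makes the phase converge uniformly in \<kappa>.\<close>

lemma theta_ext_integrand_bound:
  assumes "0 \<le> \<kappa>" "\<kappa> \<le> km"
  shows "\<bar>\<kappa> - angle (2 * d * (e \<kappa> - u0 x)) / (2 * d)\<bar> \<le> sqrt (u0 x) / sqrt d"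
proof -
  have le: "2 * d * (e \<kappa> - u0 x) \<le> 2 * d * e \<kappa>" using d_pos pos[of x] by (intro mult_left_mono) auto
  have eq: "\<kappa> - angle (2 * d * (e \<kappa> - u0 x)) / (2 * d) = (angle (2 * d * e \<kappa>) - angle (2 * d * (e \<kappa> - u0 x))) / (2 * d)"
    using angle_e[OF assms] d_pos by (simp add: diff_divide_distrib)
  have "angle (2 * d * e \<kappa>) - angle (2 * d * (e \<kappa> - u0 x)) \<le> sqrt (2 * (2 * d * e \<kappa> - 2 * d * (e \<kappa> - u0 x)))"
    by (rule angle_increment(2)[OF le])
  also have "2 * (2 * d * e \<kappa> - 2 * d * (e \<kappa> - u0 x)) = (2\<^sup>2 * d) * u0 x" by (simp add: algebra_simps)
  also have "sqrt \<dots> = 2 * sqrt d * sqrt (u0 x)" by (simp only: real_sqrt_mult real_sqrt_abs abs_numeral)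
  finally have "(angle (2 * d * e \<kappa>) - angle (2 * d * (e \<kappa> - u0 x))) / (2 * d) \<le> 2 * sqrt d * sqrt (u0 x) / (2 * d)"
    using d_pos by (intro divide_right_mono) auto
  also have "\<dots> = sqrt (u0 x) * (sqrt d / d)" by simp
  also have "sqrt d / d = 1 / sqrt d" using d_pos by (simp add: field_simps)
  finally show ?thesis
    unfolding eq using angle_increment(1)[OF le] d_pos by simp
qed

lemma theta_ext_integrable:
  assumes "0 \<le> \<kappa>" "\<kappa> \<le> km" "A \<in> sets borel"
  shows "integrable lborel (\<lambda>x. indicator A x * (\<kappa> - angle (2 * d * (e \<kappa> - u0 x)) / (2 * d)))"
proof (rule Bochner_Integration.integrable_bound)
  show "integrable lborel (\<lambda>x. sqrt (u0 x) / sqrt d)" using sqrt_integrable by auto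
  show "AE x in lborel. norm (indicator A x * (\<kappa> - angle (2 * d * (e \<kappa> - u0 x)) / (2 * d))) \<le> norm (sqrt (u0 x) / sqrt d)"
    using theta_ext_integrand_bound[OF assms(1,2)] pos d_pos by (intro AE_I2) (auto simp: indicator_def abs_mult less_imp_le)
qed (use assms(3) in measurable)

lemma theta_ext_cont: "continuous_on {0..km} theta_ext"
  unfolding continuous_on_sequentially
proof (intro allI ballI impI)
  fix X :: "nat \<Rightarrow> real" and a assume a: "a \<in> {0..km}" and "(\<forall>n. X n \<in> {0..km}) \<and> X \<longlonglongrightarrow> a"
  then have X: "\<And>n. X n \<in> {0..km}" "X \<longlonglongrightarrow> a" by auto
  have eX: "(\<lambda>n. e (X n)) \<longlonglongrightarrow> e a"
    using e_cont X a unfolding continuous_on_sequentially by (auto simp: o_def)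
  have "(\<lambda>n. \<integral>x. indicator {xm..} x * (X n - angle (2 * d * (e (X n) - u0 x)) / (2 * d)) \<partial>lborel) \<longlonglongrightarrow>
    (\<integral>x. indicator {xm..} x * (a - angle (2 * d * (e a - u0 x)) / (2 * d)) \<partial>lborel)"
  proof (rule integral_dominated_convergence)
    show "integrable lborel (\<lambda>x. sqrt (u0 x) / sqrt d)" using sqrt_integrable by auto
    show "AE x in lborel. norm (indicator {xm..} x * (X n - angle (2 * d * (e (X n) - u0 x)) / (2 * d))) \<le> sqrt (u0 x) / sqrt d" for n
    proof (rule AE_I2)
      fix x
      have "0 \<le> sqrt (u0 x) / sqrt d" using pos[of x] d_pos by (simp add: less_imp_le)
      then show "norm (indicator {xm..} x * (X n - angle (2 * d * (e (X n) - u0 x)) / (2 * d))) \<le> sqrt (u0 x) / sqrt d"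
        using theta_ext_integrand_bound[of "X n" x] X(1)[of n] by (auto simp: indicator_def)
    qed
    show "AE x in lborel. (\<lambda>n. indicator {xm..} x * (X n - angle (2 * d * (e (X n) - u0 x)) / (2 * d))) \<longlonglongrightarrow>
       indicator {xm..} x * (a - angle (2 * d * (e a - u0 x)) / (2 * d))"
    proof (rule AE_I2)
      fix x
      have "(\<lambda>n. 2 * d * (e (X n) - u0 x)) \<longlonglongrightarrow> 2 * d * (e a - u0 x)" by (intro tendsto_intros eX)
      then have "(\<lambda>n. angle (2 * d * (e (X n) - u0 x))) \<longlonglongrightarrow> angle (2 * d * (e a - u0 x))"
        using continuous_on_tendsto_compose[OF angle_cont] by auto
      then show "(\<lambda>n. indicator {xm..} x * (X n - angle (2 * d * (e (X n) - u0 x)) / (2 * d))) \<longlonglongrightarrow>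
       indicator {xm..} x * (a - angle (2 * d * (e a - u0 x)) / (2 * d))"
        using d_pos by (intro tendsto_intros X) auto
    qed
  qed measurable
  then show "(theta_ext \<circ> X) \<longlonglongrightarrow> theta_ext a"
    unfolding theta_ext_def o_def by (intro tendsto_intros X)
qed

lemma thetaPlus_theta_ext:
  assumes "0 < \<kappa>" "\<kappa> \<le> km"
  shows "thetaPlus d u0 xm \<kappa> = theta_ext \<kappa>"
proof -
  have k0: "0 \<le> \<kappa>" using assms by simp
  have ep: "0 < e \<kappa>" "e \<kappa> \<le> um" using e_pos[OF assms] e_range[of \<kappa>] assms by auto
  define F where "F x = \<kappa> - angle (2 * d * (e \<kappa> - u0 x)) / (2 * d)" for x
  have F: "Im (zeta d \<kappa> + lambertWm1 (Re (aa d \<kappa> (u0 x))) / (2 * of_real d)) = F x" for x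
  proof -
    have "Im (w / (2 * of_real d)) = Im w / (2 * d)" for w
      using Im_divide_of_real[of w "2 * d"] by simp
    then show ?thesis
      unfolding Re_aa[OF d_pos k0 scaled_lt_pi[OF assms(2)]] by (simp add: F_def angle_def zeta_Im)
  qed
  have i: "integrable lborel (\<lambda>x. indicator A x * F x)" if "A \<in> sets borel" for A
    unfolding F_def by (rule theta_ext_integrable[OF k0 assms(2) that])
  have tail: "integral {Xp (e \<kappa>)..} F = (\<integral>x. indicator {Xp (e \<kappa>)..} x * F x \<partial>lborel)"
  proof -
    have "((\<lambda>x. indicator {Xp (e \<kappa>)..} x * F x) has_integral (\<integral>x. indicator {Xp (e \<kappa>)..} x * F x \<partial>lborel)) UNIV"
      by (intro has_integral_integral_lborel i) simp
    moreover have "(\<lambda>x. indicator {Xp (e \<kappa>)..} x * F x) = (\<lambda>x. if x \<in> {Xp (e \<kappa>)..} then F x else 0)"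
      by (auto simp: fun_eq_iff indicator_def)
    ultimately show ?thesis by (simp only: has_integral_restrict_UNIV integral_unique)
  qed
  have split: "indicator {xm..} x * F x = indicator {xm..<Xp (e \<kappa>)} x * \<kappa> + indicator {Xp (e \<kappa>)..} x * F x" for x
  proof (cases "xm \<le> x \<and> x < Xp (e \<kappa>)")
    case True
    then have "Xm (e \<kappa>) \<le> x" using Xm[OF ep] by simp
    then have "e \<kappa> \<le> u0 x" using u0_gt_iff(2)[OF ep, of x] True by simp
    then have "2 * d * (e \<kappa> - u0 x) \<le> 0" using d_pos by (intro mult_nonneg_nonpos) auto
    then show ?thesis using True by (simp add: F_def angle_nonpos)
  next
    case False
    then show ?thesis using Xp(1)[OF ep] by (auto simp: indicator_def)
  qed
  have i1: "integrable lborel (\<lambda>x. indicator {xm..<Xp (e \<kappa>)} x * \<kappa>)"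
    using Xp(1)[OF ep] by (intro integrable_mult_left impI integrable_real_indicator) auto
  have "(\<integral>x. indicator {xm..} x * F x \<partial>lborel) =
      (\<integral>x. indicator {xm..<Xp (e \<kappa>)} x * \<kappa> \<partial>lborel) + (\<integral>x. indicator {Xp (e \<kappa>)..} x * F x \<partial>lborel)"
    unfolding split by (rule Bochner_Integration.integral_add[OF i1 i]) simp
  also have "(\<integral>x. indicator {xm..<Xp (e \<kappa>)} x * \<kappa> \<partial>lborel) = (Xp (e \<kappa>) - xm) * \<kappa>"
    using Xp(1)[OF ep] by simp
  finally show ?thesis
    unfolding thetaPlus_def theta_ext_def F xplus_Xp[OF k0 assms(2)] tail F_def[symmetric] by (simp add: algebra_simps)
qed

definition V_ext :: "real \<times> real \<Rightarrow> real \<Rightarrow> real" where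
  "V_ext p \<kappa> = fst p * \<kappa> + snd p * Im ((zeta d \<kappa> - of_real (1 / (2 * d)))\<^sup>2) - theta_ext \<kappa>"

lemma Vfun_V_ext: "0 < \<kappa> \<Longrightarrow> \<kappa> \<le> km \<Longrightarrow> Vfun d u0 xm \<kappa> (fst p) (snd p) = V_ext p \<kappa>"
  by (simp add: Vfun_def V_ext_def thetaPlus_theta_ext)

lemma V_ext_cont: "continuous_on {0..km} (V_ext p)"
  unfolding V_ext_def[abs_def] by (intro continuous_intros zeta_cont theta_ext_cont)

end

section \<open>Identification of the two energies\<close>

context initial_data begin

text \<open>x and t enter linearly as coefficients, bounded on \<open>K\<close>, of two fixed
  continuous functions of \<kappa>.\<close>

lemma V_ext_equicontinuous:
  assumes gas: "weyl_gas km R z C \<alpha>" and K: "compact K" and \<epsilon>: "0 < \<epsilon>"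
  shows "\<exists>\<tau>>0. \<forall>p\<in>K. weyl_gas.equi km \<tau> \<epsilon> (V_ext p)"
proof -
  interpret G: weyl_gas km R z C \<alpha> by (rule gas)
  have "bounded K" using K by (rule compact_imp_bounded)
  then obtain B where B: "\<And>p. p \<in> K \<Longrightarrow> norm p \<le> B" unfolding bounded_iff by blast
  define b where "b = max B 1"
  have b: "1 \<le> b" "\<And>p. p \<in> K \<Longrightarrow> \<bar>fst p\<bar> \<le> b \<and> \<bar>snd p\<bar> \<le> b"
  proof -
    show "1 \<le> b" by (simp add: b_def)
    fix p :: "real \<times> real" assume "p \<in> K"
    then have "norm p \<le> b" using B[of p] by (simp add: b_def)
    then show "\<bar>fst p\<bar> \<le> b \<and> \<bar>snd p\<bar> \<le> b"
      using norm_fst_le[of "fst p" "snd p"] norm_snd_le[of "snd p" "fst p"] by simp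
  qed
  define v where "v \<kappa> = Im ((zeta d \<kappa> - of_real (1 / (2 * d)))\<^sup>2)" for \<kappa>
  \<comment> \<open>A third of \<open>\<epsilon>\<close> for each of the three terms of
    \<open>V_ext\<close>, two of them multiplied by a coefficient of size at most
    \<open>b\<close>.\<close>
  define \<eta> where "\<eta> = \<epsilon> / (3 * b)"
  have \<eta>: "0 < \<eta>" "b * \<eta> = \<epsilon> / 3" "\<eta> \<le> \<epsilon> / 3" using \<epsilon> b(1) by (auto simp: \<eta>_def field_simps)
  have "continuous_on {0..km} v" unfolding v_def by (intro continuous_intros zeta_cont)
  from G.equi_exists[OF this \<eta>(1)] obtain t1 where t1: "0 < t1" "G.equi t1 \<eta> v" by auto
  from G.equi_exists[OF theta_ext_cont \<eta>(1)] obtain t2 where t2: "0 < t2" "G.equi t2 \<eta> theta_ext" by auto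
  define \<tau> where "\<tau> = min \<eta> (min t1 t2)"
  show ?thesis
  proof (intro exI[of _ \<tau>] conjI ballI)
    show "0 < \<tau>" using \<eta> t1 t2 by (simp add: \<tau>_def)
    fix p assume p: "p \<in> K"
    show "G.equi \<tau> \<epsilon> (V_ext p)"
      unfolding G.equi_def
    proof (intro conjI V_ext_cont ballI impI)
      fix x y assume xy: "x \<in> {0..km}" "y \<in> {0..km}" "\<bar>x - y\<bar> < \<tau>"
      have "\<bar>v x - v y\<bar> \<le> \<eta>" "\<bar>theta_ext x - theta_ext y\<bar> \<le> \<eta>" "\<bar>x - y\<bar> \<le> \<eta>"
        using t1(2) t2(2) xy by (auto simp: G.equi_def \<tau>_def)
      then have "\<bar>fst p\<bar> * \<bar>x - y\<bar> \<le> b * \<eta>" "\<bar>snd p\<bar> * \<bar>v x - v y\<bar> \<le> b * \<eta>" "\<bar>theta_ext x - theta_ext y\<bar> \<le> \<epsilon> / 3"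
        using b(2)[OF p] \<eta> b(1) by (auto intro!: mult_mono)
      then have "\<bar>fst p * (x - y)\<bar> \<le> \<epsilon> / 3" "\<bar>snd p * (v x - v y)\<bar> \<le> \<epsilon> / 3" "\<bar>theta_ext x - theta_ext y\<bar> \<le> \<epsilon> / 3"
        using \<eta>(2) by (auto simp: abs_mult)
      moreover have "V_ext p x - V_ext p y = fst p * (x - y) + snd p * (v x - v y) - (theta_ext x - theta_ext y)"
        by (simp add: V_ext_def v_def algebra_simps)
      ultimately show "\<bar>V_ext p x - V_ext p y\<bar> \<le> \<epsilon>" by linarith
    qed
  qed
qed

text \<open>The concrete energies are those of the abstract gas up to null sets: densities are
  compared off the end points, \<open>Vfun\<close> and \<open>V_ext\<close> off \<kappa> = 0. In the
  discrete energy no exception arises, all nodes being positive.\<close>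

lemma minimizer_and_limit:
  "(\<forall>x t. \<exists>\<rho>\<in>Aset d u0 xm. \<forall>\<sigma>\<in>Aset d u0 xm. Efunc d u0 xm \<rho> x t \<le> Efunc d u0 xm \<sigma> x t)
       \<and> (\<forall>K :: (real \<times> real) set. compact K \<longrightarrow>
             uniform_limit K (\<lambda>N p. EminN d u0 xm N (fst p) (snd p))
               (\<lambda>p. EminInf d u0 xm (fst p) (snd p)) sequentially)"
proof -
  obtain C where gas: "weyl_gas km (Rwyl d u0 xm) (zeta d) C (1 / 14)" using weyl_gas_initial_data by blast
  interpret G: weyl_gas km "Rwyl d u0 xm" "zeta d" C "1 / 14" by (rule gas)
  have w: "G.w \<kappa> = rhoWyl d u0 xm \<kappa>" if "0 < \<kappa>" "\<kappa> < km" for \<kappa>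
    using that by (simp add: G.w_def rhoWyl_def)
  have adm: "Aset d u0 xm = G.adm"
  proof -
    have "(AE \<kappa> in lebesgue. \<kappa> \<in> {0..km} \<longrightarrow> 0 \<le> \<rho> \<kappa> \<and> \<rho> \<kappa> \<le> rhoWyl d u0 xm \<kappa>) \<longleftrightarrow>
       (AE \<kappa> in G.L. 0 \<le> \<rho> \<kappa> \<and> \<rho> \<kappa> \<le> G.w \<kappa>)" for \<rho>
    proof -
      have "(AE \<kappa> in lebesgue. \<kappa> \<in> {0..km} \<longrightarrow> 0 \<le> \<rho> \<kappa> \<and> \<rho> \<kappa> \<le> rhoWyl d u0 xm \<kappa>) \<longleftrightarrow>
        (AE \<kappa> in G.L. 0 \<le> \<rho> \<kappa> \<and> \<rho> \<kappa> \<le> rhoWyl d u0 xm \<kappa>)"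
        by (subst AE_restrict_space_iff) auto
      also have "\<dots> \<longleftrightarrow> (AE \<kappa> in G.L. 0 \<le> \<rho> \<kappa> \<and> \<rho> \<kappa> \<le> G.w \<kappa>)"
      proof -
        have ae: "AE \<kappa> in G.L. rhoWyl d u0 xm \<kappa> = G.w \<kappa>"
          using G.AE_L_neq[of 0] G.AE_L_neq[of km] G.AE_L_I by eventually_elim (simp add: w)
        show ?thesis
        proof
          assume "AE \<kappa> in G.L. 0 \<le> \<rho> \<kappa> \<and> \<rho> \<kappa> \<le> rhoWyl d u0 xm \<kappa>"
          then show "AE \<kappa> in G.L. 0 \<le> \<rho> \<kappa> \<and> \<rho> \<kappa> \<le> G.w \<kappa>" using ae by eventually_elim simp
        next
          assume "AE \<kappa> in G.L. 0 \<le> \<rho> \<kappa> \<and> \<rho> \<kappa> \<le> G.w \<kappa>"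
          then show "AE \<kappa> in G.L. 0 \<le> \<rho> \<kappa> \<and> \<rho> \<kappa> \<le> rhoWyl d u0 xm \<kappa>" using ae by eventually_elim simp
        qed
      qed
      finally show ?thesis .
    qed
    moreover have "set_borel_measurable lebesgue {0..km} \<rho> \<longleftrightarrow> \<rho> \<in> borel_measurable G.L" for \<rho> :: "real \<Rightarrow> real"
      unfolding set_borel_measurable_def by (subst borel_measurable_restrict_space_iff) auto
    ultimately show ?thesis by (simp add: Aset_def G.adm_def)
  qed
  have Lop: "Lop d u0 xm \<rho> (zeta d \<kappa>) = G.pot \<rho> \<kappa> / pi" if "\<rho> \<in> G.adm" for \<rho> \<kappa>
  proof -
    have "G.pot \<rho> \<kappa> = (\<integral>\<eta>. G.g \<kappa> \<eta> * \<rho> \<eta> \<partial>G.L)"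
      unfolding G.pot_def by (rule G.integral_\<nu>[OF that G.g_meas])
    also have "\<dots> = (LINT \<eta>:{0..km}|lebesgue. G.g \<kappa> \<eta> * \<rho> \<eta>)"
      unfolding set_lebesgue_integral_def by (subst integral_restrict_space) auto
    finally show ?thesis by (simp add: Lop_def G.g_def)
  qed
  have energy: "Efunc d u0 xm \<rho> (fst p) (snd p) = G.energy (V_ext p) \<rho>" if \<rho>: "\<rho> \<in> G.adm" for \<rho> p
  proof -
    define F where "F \<kappa> = (Vfun d u0 xm \<kappa> (fst p) (snd p) + Lop d u0 xm \<rho> (zeta d \<kappa>) / 2) * \<rho> \<kappa>" for \<kappa>
    define H where "H \<kappa> = (V_ext p \<kappa> + G.pot \<rho> \<kappa> / (2 * pi)) * \<rho> \<kappa>" for \<kappa>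
    have m: "(\<lambda>\<kappa>. V_ext p \<kappa> + G.pot \<rho> \<kappa> / (2 * pi)) \<in> borel_measurable G.L"
      using G.cont_L[OF V_ext_cont] G.pot_meas[OF \<rho>] by measurable
    have H: "H \<in> borel_measurable G.L" unfolding H_def using m G.admD(1)[OF \<rho>] by measurable
    have FH: "F \<kappa> = H \<kappa>" if "0 < \<kappa>" "\<kappa> \<le> km" for \<kappa>
      using that by (simp add: F_def H_def Vfun_V_ext Lop[OF \<rho>])
    have "F \<in> borel_measurable G.L"
    proof -
      \<comment> \<open>\<open>F\<close> has an uncontrolled value at \<kappa> = 0, where
        \<open>thetaPlus\<close> is junk. Changing \<open>H\<close> at this single point yields
        \<open>F\<close> and shows its measurability.\<close>
      have "(\<lambda>\<kappa>. if \<kappa> = 0 then F 0 else H \<kappa>) \<in> borel_measurable G.L"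
      proof (rule measurable_If[OF _ H])
        have "{\<kappa> \<in> space G.L. \<kappa> = 0} = {0}" using km_pos by auto
        then show "{\<kappa> \<in> space G.L. \<kappa> = 0} \<in> sets G.L" using G.L_sets[of "{0}"] km_pos by simp
      qed simp
      then show ?thesis
        by (rule measurable_cong[THEN iffD1, rotated]) (use FH in auto)
    qed
    have "Efunc d u0 xm \<rho> (fst p) (snd p) = (\<integral>\<kappa>. F \<kappa> \<partial>G.L)"
      unfolding Efunc_def set_lebesgue_integral_def F_def by (subst integral_restrict_space) auto
    also have "\<dots> = (\<integral>\<kappa>. H \<kappa> \<partial>G.L)"
      by (rule integral_cong_AE[OF \<open>F \<in> _\<close> H])
        (use G.AE_L_neq[of 0] G.AE_L_I in eventually_elim, use FH in auto)
    also have "\<dots> = G.energy (V_ext p) \<rho>"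
      unfolding G.energy_def H_def by (rule G.integral_\<nu>[OF \<rho> m, symmetric])
    finally show ?thesis .
  qed
  have mesh: "pi * epsN d u0 xm N = G.mesh N" for N
    by (simp add: epsN_def G.mesh_def)
  have node: "kappaN d u0 xm N n = G.node N n" for N n
    unfolding kappaN_def G.node_def mesh[symmetric] by (simp add: mult.assoc mult.left_commute mult.commute)
  have ENS: "ENS d u0 xm N S (fst p) (snd p) = G.node_energy N (V_ext p) S" if S: "S \<subseteq> {1..N}" for N S p
  proof -
    have "Vfun d u0 xm (G.node N n) (fst p) (snd p) = V_ext p (G.node N n)" if "n \<in> S" for n
      using G.node[of n N] that S by (intro Vfun_V_ext) auto
    moreover have "gfun (zeta d (G.node N n)) (zeta d (G.node N l)) = G.node_kernel N n l" if "n \<in> S" "l \<in> S" for n l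
    proof -
      have n: "n \<in> {1..N}" and l: "l \<in> {1..N}" using that S by auto
      show ?thesis
      proof (cases "n = l")
        case True
        have "zeta d (G.node N l) - cnj (zeta d (G.node N l)) = 2 * \<i> * of_real (G.node N l)"
          by (simp add: complex_eq_iff zeta_Im)
        then have "cmod (zeta d (G.node N l) - cnj (zeta d (G.node N l))) = 2 * G.node N l"
          using G.node(4)[OF l] by (simp add: norm_mult)
        then show ?thesis using True by (simp add: gfun_def G.node_kernel_def)
      next
        case False
        then have "G.node N n \<noteq> G.node N l" using G.node(3)[OF n] G.node(3)[OF l] by auto
        then have "zeta d (G.node N n) \<noteq> zeta d (G.node N l)" by (metis zeta_Im)
        then show ?thesis using False by (simp add: gfun_def G.node_kernel_def G.g_def)
      qed
    qed
    ultimately show ?thesis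
      unfolding ENS_def G.node_energy_def node mesh[symmetric]
      by (simp add: power2_eq_square cong: sum.cong)
  qed
  have inf: "EminInf d u0 xm (fst p) (snd p) = Inf (G.energy (V_ext p) ` G.adm)" for p
    unfolding EminInf_def adm using energy[of _ p] by (intro arg_cong[of _ _ Inf] image_cong) auto
  have fin: "EminN d u0 xm N (fst p) (snd p) = Min (G.node_energy N (V_ext p) ` Pow {1..N})" for N p
    unfolding EminN_def using ENS[of _ N p] by (intro arg_cong[of _ _ Min] image_cong) auto
  show ?thesis
  proof (intro conjI allI impI)
    fix x t
    show "\<exists>\<rho>\<in>Aset d u0 xm. \<forall>\<sigma>\<in>Aset d u0 xm. Efunc d u0 xm \<rho> x t \<le> Efunc d u0 xm \<sigma> x t"
      using G.energy_minimizer[OF V_ext_cont[of "(x, t)"]] energy[of _ "(x, t)"] by (auto simp: adm)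
  next
    fix K :: "(real \<times> real) set" assume K: "compact K"
    show "uniform_limit K (\<lambda>N p. EminN d u0 xm N (fst p) (snd p)) (\<lambda>p. EminInf d u0 xm (fst p) (snd p)) sequentially"
      unfolding fin inf by (rule G.discrete_uniform_limit) (rule V_ext_equicontinuous[OF gas K])
  qed
qed

end

theorem mainTheorem6:
  fixes d :: real and u0 u0' :: "real \<Rightarrow> real" and xm :: real
  assumes d_pos: "d > 0"
    and deriv: "\<And>x. (u0 has_real_derivative u0' x) (at x)"
    and C1: "continuous_on UNIV u0'"
    and pos: "\<And>x. u0 x > 0"
    and lim_top: "(u0 \<longlongrightarrow> 0) at_top"
    and lim_bot: "(u0 \<longlongrightarrow> 0) at_bot"
    and moment: "(\<lambda>x. (x\<^sup>2 + 1) * u0 x) integrable_on UNIV"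
    and crit: "\<And>x. u0' x = 0 \<longleftrightarrow> x = xm"
    and maxim: "\<And>x. u0 x \<le> u0 xm"
    and sqrt_int: "(\<lambda>x. sqrt (u0 x)) integrable_on UNIV"
  shows "(\<forall>x t. \<exists>\<rho>\<in>Aset d u0 xm. \<forall>\<sigma>\<in>Aset d u0 xm.
             Efunc d u0 xm \<rho> x t \<le> Efunc d u0 xm \<sigma> x t)
       \<and> (\<forall>K :: (real \<times> real) set. compact K \<longrightarrow>
             uniform_limit K (\<lambda>N p. EminN d u0 xm N (fst p) (snd p))
               (\<lambda>p. EminInf d u0 xm (fst p) (snd p)) sequentially)"
  by (rule initial_data.minimizer_and_limit, unfold_locales) (fact assms)+

end
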